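(* Up to isomorphism there are exactly $82$ directed strongly regular graphs with parameters $(22,9,6,3,4)$ that admit an automorphism of order two fixing exactly $6$ vertices. Among them, $64$ have full automorphism group isomorphic to $\mathbb{Z}_2$, $4$ have full automorphism group isomorphic to $\mathbb{Z}_4$, $10$ have full automorphism group isomorphic to $\mathbb{Z}_2\times\mathbb{Z}_2$, and $4$ have full automorphism group isomorphic to $\mathbb{Z}_4\times\mathbb{Z}_2$.
   Context: A directed strongly regular graph with parameters $(v,k,t,\lambda,\mu)$ is a loopless directed graph $\Gamma=(V,E)$ on $v$ vertices in which every vertex has in-degree and out-degree $k$, every vertex $x$ has exactly $t$ out-neighbors that are also in-neighbors of $x$, and for any vertices $x,y$ the number of directed paths of length two from $x$ to $y$ is $\lambda$ if $(x,y)\in E$ and $\mu$ if $(x,y)\notin E$. An automorphism is a permutation $\sigma$ of $V$ with $(x,y)\in E\iff(\sigma(x),\sigma(y))\in E$; the full automorphism group is the group of all automorphisms. Two directed graphs are isomorphic if there is a bijection between their vertex sets mapping edges exactly onto edges.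
   Formalization: In the definition of a directed strongly regular graph, the condition on paths of length two is required only for distinct vertices x, y; for x = y the count is t = 6, not μ = 4, so taken literally no such graph would exist. *)

theory Defs
  imports
    "Graph_Theory.Pair_Digraph"
    "Graph_Theory.Digraph_Isomorphism"
    "HOL-Algebra.Bij"
    "HOL-Algebra.Multiplicative_Group"
    "HOL-Algebra.Elementary_Groups"
begin

text \<open>
  The condition on paths of length two is imposed for \<open>x \<noteq> y\<close> only, as usual: the paths of
  length two from \<open>x\<close> to \<open>x\<close> are the out-neighbours of \<open>x\<close> that are also in-neighbours,
  so their number is \<open>t\<close>. A path of length two is given by its midpoint.
\<close>

locale directed_strongly_regular_graph = pair_digraph G
  for G :: "'a pair_pre_digraph" and v k t l m :: nat +
  assumes order: "card (pverts G) = v"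
    and in_degree: "x \<in> pverts G \<Longrightarrow> in_degree (with_proj G) x = k"
    and out_degree: "x \<in> pverts G \<Longrightarrow> out_degree (with_proj G) x = k"
    and reciprocal: "x \<in> pverts G \<Longrightarrow> card {y. (x, y) \<in> parcs G \<and> (y, x) \<in> parcs G} = t"
    and paths_adjacent: "(x, y) \<in> parcs G \<Longrightarrow>
      card {z. (x, z) \<in> parcs G \<and> (z, y) \<in> parcs G} = l"
    and paths_nonadjacent:
      "\<lbrakk>x \<in> pverts G; y \<in> pverts G; x \<noteq> y; (x, y) \<notin> parcs G\<rbrakk> \<Longrightarrow>
      card {z. (x, z) \<in> parcs G \<and> (z, y) \<in> parcs G} = m"

definition digraph_auto :: "'a pair_pre_digraph \<Rightarrow> ('a \<Rightarrow> 'a) set" where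
  "digraph_auto G = {\<sigma> \<in> Bij (pverts G).
     \<forall>x \<in> pverts G. \<forall>y \<in> pverts G. (x, y) \<in> parcs G \<longleftrightarrow> (\<sigma> x, \<sigma> y) \<in> parcs G}"

definition digraph_AutoGroup :: "'a pair_pre_digraph \<Rightarrow> ('a \<Rightarrow> 'a) monoid" where
  "digraph_AutoGroup G = BijGroup (pverts G) \<lparr>carrier := digraph_auto G\<rparr>"

definition has_involution_fixing :: "nat \<Rightarrow> 'a pair_pre_digraph \<Rightarrow> bool" where
  "has_involution_fixing f G \<longleftrightarrow>
     (\<exists>\<sigma> \<in> carrier (digraph_AutoGroup G).
        group.ord (digraph_AutoGroup G) \<sigma> = 2 \<and> card {x \<in> pverts G. \<sigma> x = x} = f)"

definition iso_classes :: "'a pair_pre_digraph set \<Rightarrow> 'a pair_pre_digraph set set" where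
  "iso_classes S = S // {(G, H). G \<in> S \<and> H \<in> S \<and> digraph_iso (with_proj G) (with_proj H)}"

lemma digraph_auto_subgroup: "subgroup (digraph_auto G) (BijGroup (pverts G))"
proof (rule group.subgroupI[OF group_BijGroup])
  let ?V = "pverts G"
  show "digraph_auto G \<subseteq> carrier (BijGroup ?V)"
    by (auto simp: digraph_auto_def BijGroup_def)
  have "(\<lambda>x\<in>?V. x) \<in> digraph_auto G"
    by (auto simp: digraph_auto_def id_Bij)
  then show "digraph_auto G \<noteq> {}" by blast
next
  fix f assume f: "f \<in> digraph_auto G"
  let ?V = "pverts G" and ?g = "\<lambda>x\<in>pverts G. (inv_into (pverts G) f) x"
  have fB: "f \<in> Bij ?V" using f by (simp add: digraph_auto_def)
  then have img: "f ` ?V = ?V" by (simp add: Bij_def bij_betw_def)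
  have g: "?g x \<in> ?V" "f (?g x) = x" if "x \<in> ?V" for x
    using that img by (auto simp: f_inv_into_f inv_into_into)
  have "(x, y) \<in> parcs G \<longleftrightarrow> (?g x, ?g y) \<in> parcs G" if "x \<in> ?V" "y \<in> ?V" for x y
    using f g[OF that(1)] g[OF that(2)] unfolding digraph_auto_def by fastforce
  then have "?g \<in> digraph_auto G"
    using restrict_inv_into_Bij[OF fB] by (simp add: digraph_auto_def)
  then show "inv\<^bsub>BijGroup ?V\<^esub> f \<in> digraph_auto G"
    by (simp add: inv_BijGroup[OF fB])
next
  fix f g assume fg: "f \<in> digraph_auto G" "g \<in> digraph_auto G"
  then have B: "f \<in> Bij (pverts G)" "g \<in> Bij (pverts G)"
    by (auto simp: digraph_auto_def)
  have "g x \<in> pverts G" if "x \<in> pverts G" for x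
    using that B(2) by (auto simp: Bij_def bij_betw_def)
  then show "f \<otimes>\<^bsub>BijGroup (pverts G)\<^esub> g \<in> digraph_auto G"
    using fg B by (simp add: BijGroup_def digraph_auto_def compose_Bij compose_eq)
qed

lemma group_digraph_AutoGroup: "group (digraph_AutoGroup G)"
  unfolding digraph_AutoGroup_def
  by (rule subgroup.subgroup_is_group[OF digraph_auto_subgroup group_BijGroup])

text \<open>
  For digraphs without multiple arcs, \<^const>\<open>digraph_iso\<close> amounts to a bijection of the
  vertices that maps the arcs exactly onto the arcs.
\<close>

lemma digraph_iso_with_proj_iff:
  assumes "pair_wf_digraph G"
  shows "digraph_iso (with_proj G) (with_proj H) \<longleftrightarrow>
    (\<exists>f. bij_betw f (pverts G) (pverts H) \<and> map_prod f f ` parcs G = parcs H)"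
proof
  assume "digraph_iso (with_proj G) (with_proj H)"
  then obtain h where h: "pre_digraph.digraph_isomorphism (with_proj G) h"
    "with_proj H = app_iso h (with_proj G)"
    by (auto simp: digraph_iso_def)
  have V: "pverts H = iso_verts h ` pverts G" and A: "parcs H = iso_arcs h ` parcs G"
    and ht: "iso_tail h = fst" "iso_head h = snd"
    using h(2) by (auto simp: with_proj_def app_iso_def)
  have "iso_arcs h a = map_prod (iso_verts h) (iso_verts h) a" if "a \<in> parcs G" for a
    using h(1) that ht by (auto simp: pre_digraph.digraph_isomorphism_def prod_eq_iff)
  then have "map_prod (iso_verts h) (iso_verts h) ` parcs G = parcs H"
    using A by simp
  moreover have "bij_betw (iso_verts h) (pverts G) (pverts H)"
    using h(1) V by (simp add: pre_digraph.digraph_isomorphism_def bij_betw_def)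
  ultimately show "\<exists>f. bij_betw f (pverts G) (pverts H) \<and> map_prod f f ` parcs G = parcs H"
    by blast
next
  assume "\<exists>f. bij_betw f (pverts G) (pverts H) \<and> map_prod f f ` parcs G = parcs H"
  then obtain f where f: "inj_on f (pverts G)" "f ` pverts G = pverts H"
    "map_prod f f ` parcs G = parcs H"
    by (auto simp: bij_betw_def)
  let ?h = "\<lparr>iso_verts = f, iso_arcs = map_prod f f, iso_head = snd, iso_tail = fst\<rparr>"
  have "parcs G \<subseteq> pverts G \<times> pverts G"
    using pair_wf_digraph.in_arcsD1[OF assms] pair_wf_digraph.in_arcsD2[OF assms] by auto
  then have "inj_on (map_prod f f) (parcs G)"
    using inj_on_subset[OF map_prod_inj_on[OF f(1) f(1)]] by blast
  then have "pre_digraph.digraph_isomorphism (with_proj G) ?h"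
    using assms f(1) by (simp add: pre_digraph.digraph_isomorphism_def wf_digraph_wp_iff)
  moreover have "with_proj H = app_iso ?h (with_proj G)"
    using f(2,3) by (simp add: with_proj_def app_iso_def)
  ultimately show "digraph_iso (with_proj G) (with_proj H)"
    unfolding digraph_iso_def by blast
qed

lemma equiv_digraph_iso:
  assumes "\<And>G. G \<in> S \<Longrightarrow> pair_wf_digraph G"
  shows "equiv S {(G, H). G \<in> S \<and> H \<in> S \<and> digraph_iso (with_proj G) (with_proj H)}"
proof (rule equivI)
  let ?R = "{(G, H). G \<in> S \<and> H \<in> S \<and> digraph_iso (with_proj G) (with_proj H)}"
  show "?R \<subseteq> S \<times> S" by blast
  note iso_iff = digraph_iso_with_proj_iff[OF assms]
  have "digraph_iso (with_proj G) (with_proj G)" if "G \<in> S" for G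
  proof -
    have "bij_betw id (pverts G) (pverts G) \<and> map_prod id id ` parcs G = parcs G"
      by (simp add: map_prod.id)
    then show ?thesis using iso_iff[OF that, THEN iffD2] by metis
  qed
  then show "refl_on S ?R" by (auto simp: refl_on_def)
  have "digraph_iso (with_proj H) (with_proj G)"
    if S: "G \<in> S" "H \<in> S" and iso: "digraph_iso (with_proj G) (with_proj H)" for G H
  proof -
    obtain f where f: "bij_betw f (pverts G) (pverts H)" "map_prod f f ` parcs G = parcs H"
      using iso_iff[OF S(1), THEN iffD1, OF iso] by blast
    let ?g = "inv_into (pverts G) f"
    have inj: "inj_on f (pverts G)" using f(1) by (rule bij_betw_imp_inj_on)
    have "map_prod ?g ?g (map_prod f f a) = a" if a: "a \<in> parcs G" for a
      using inv_into_f_f[OF inj pair_wf_digraph.arc_fst_in_verts[OF assms[OF S(1)] a]]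
        inv_into_f_f[OF inj pair_wf_digraph.arc_snd_in_verts[OF assms[OF S(1)] a]]
      by (simp add: prod_eq_iff)
    then have "map_prod ?g ?g ` map_prod f f ` parcs G = parcs G"
      by (simp add: image_image)
    then have "map_prod ?g ?g ` parcs H = parcs G" by (simp only: f(2))
    with bij_betw_inv_into[OF f(1)] show ?thesis
      using iso_iff[OF S(2), THEN iffD2] by metis
  qed
  then show "sym ?R" by (auto simp: sym_def)
  have "digraph_iso (with_proj G) (with_proj K)"
    if S: "G \<in> S" "H \<in> S" and GH: "digraph_iso (with_proj G) (with_proj H)"
      and HK: "digraph_iso (with_proj H) (with_proj K)" for G H K
  proof -
    obtain f where f: "bij_betw f (pverts G) (pverts H)" "map_prod f f ` parcs G = parcs H"
      using iso_iff[OF S(1), THEN iffD1, OF GH] by blast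
    obtain g where g: "bij_betw g (pverts H) (pverts K)" "map_prod g g ` parcs H = parcs K"
      using iso_iff[OF S(2), THEN iffD1, OF HK] by blast
    have "map_prod (g \<circ> f) (g \<circ> f) ` parcs G = map_prod g g ` map_prod f f ` parcs G"
      by (force simp: image_iff)
    also have "\<dots> = parcs K" by (simp only: f(2) g(2))
    finally show ?thesis
      using iso_iff[OF S(1), THEN iffD2] bij_betw_trans[OF f(1) g(1)] by metis
  qed
  then show "trans ?R" by (fastforce simp: trans_def)
qed

end

theory Submission
  imports Defs "HOL-Combinatorics.List_Permutation"
begin

text \<open>
  An involution with six fixed points splits the adjacency matrix into a block \<open>F\<close> on the fixed points,
  blocks \<open>B\<close> and \<open>C\<close> between the fixed points and the eight transposed pairs, and circulant blocks of
  size two, with first rows \<open>(x, y)\<close>, between the pairs. Let \<open>S\<close> and \<open>T\<close> have the entries \<open>x + y\<close> and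
  \<open>x - y\<close>. The equation \<open>A\<^sup>2 + A = 4 J + 2 I\<close> for the adjacency matrix becomes a system for these matrices.

  Modulo two, \<open>F\<close> is idempotent. This leaves 120 possibilities, and all of them satisfy \<open>F\<^sup>2 + F = 2 J\<close>,
  so that \<open>B C = I + J\<close>, which has 112 solutions up to permutations of the points and the pairs. The common
  kernel of \<open>B\<close> and the all one vector has dimension one, and \<open>S\<close> acts on it by 1 or -2. With
  \<open>S C = 4 J - C (F + I)\<close> this determines \<open>S\<close> from \<open>F\<close>, \<open>B\<close>, \<open>C\<close> and this eigenvalue. A search for \<open>T\<close> with
  \<open>T\<^sup>2 + T = 2 I\<close> and \<open>T = S\<close> modulo two then finds 152 matrices, each isomorphic to one of 82. A sum over the
  vertices separates the 82 graphs, and backtracking bounds their automorphism groups from above.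
\<close>

subsection \<open>Backtracking\<close>

text \<open>Vectors that are constant on the transposed pairs and vectors that change sign under the
  transpositions form two invariant spaces. Thus \<open>A\<close> splits into a quotient of order 14
  made of \<open>F\<close>, \<open>B\<close>, \<open>C\<close>, \<open>S\<close> and the matrix
  \<open>T\<close> of order 8, coupled through \<open>T = S\<close> modulo two and the zero
  diagonal; this is why they can be enumerated one after the other. The size of the enumeration is
  the obstacle, as everything is evaluated by rewriting. Hence \<open>S\<close> is not searched for
  but computed from a projection of rank one, and representatives, isomorphisms and generators of
  groups are stored and merely verified. Of each search only completeness is used: its leaves may
  repeat or be isomorphic. In the other direction the 82 matrices are checked directly against the
  definition. For the groups, the stored generators bound the order from below.\<close>

fun extend_all :: "('a list \<Rightarrow> 'b list) \<Rightarrow> 'a list \<Rightarrow> 'a list \<Rightarrow> 'b list" where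
  "extend_all f p [] = []"
| "extend_all f p (y # ys) = f (p @ [y]) @ extend_all f p ys"

text \<open>One scheme drives the searches for the rows of \<open>F\<close>, for the row and column
  pairs of \<open>T\<close> and for automorphisms.\<close>

fun dfs :: "('a list \<Rightarrow> 'a list) \<Rightarrow> nat \<Rightarrow> 'a list \<Rightarrow> 'a list list" where
  "dfs cand 0 p = [p]"
| "dfs cand (Suc n) p = extend_all (dfs cand n) p (cand p)"

text \<open>
  The searches below are evaluated by rewriting. Rewriting re-traverses the branches of a
  conditional, so the filters pass the outcome of a test to a function instead.
\<close>

fun cons_if :: "bool \<Rightarrow> 'a \<Rightarrow> 'a list \<Rightarrow> 'a list" where
  "cons_if True x xs = x # xs"
| "cons_if False x xs = xs"

fun all_true :: "('a \<Rightarrow> bool) \<Rightarrow> 'a list \<Rightarrow> bool"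
  and all_true_if :: "bool \<Rightarrow> ('a \<Rightarrow> bool) \<Rightarrow> 'a list \<Rightarrow> bool" where
  "all_true P [] = True"
| "all_true P (x # xs) = all_true_if (P x) P xs"
| "all_true_if True P xs = all_true P xs"
| "all_true_if False P xs = False"

fun sieve :: "('a \<Rightarrow> bool) \<Rightarrow> 'a list \<Rightarrow> 'a list" where
  "sieve P [] = []"
| "sieve P (x # xs) = cons_if (P x) x (sieve P xs)"

fun cons_all :: "'a \<Rightarrow> 'a list list \<Rightarrow> 'a list list" where
  "cons_all x [] = []"
| "cons_all x (ys # yss) = (x # ys) # cons_all x yss"

fun cons_any :: "'a list \<Rightarrow> 'a list list \<Rightarrow> 'a list list" where
  "cons_any [] yss = []"
| "cons_any (x # xs) yss = cons_all x yss @ cons_any xs yss"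

fun choices :: "'a list list \<Rightarrow> 'a list list" where
  "choices [] = [[]]"
| "choices (xs # xss) = cons_any xs (choices xss)"

fun weighted :: "nat \<Rightarrow> nat \<Rightarrow> bool list list" where
  "weighted 0 0 = [[]]"
| "weighted 0 (Suc k) = []"
| "weighted (Suc n) 0 = cons_all False (weighted n 0)"
| "weighted (Suc n) (Suc k) = cons_all False (weighted n (Suc k)) @ cons_all True (weighted n k)"

fun meet :: "bool list \<Rightarrow> bool list \<Rightarrow> nat" where
  "meet [] ys = 0"
| "meet (x # xs) [] = 0"
| "meet (False # xs) (y # ys) = meet xs ys"
| "meet (True # xs) (False # ys) = meet xs ys"
| "meet (True # xs) (True # ys) = Suc (meet xs ys)"

fun num_bits :: "num \<Rightarrow> bool list" where
  "num_bits num.One = []"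
| "num_bits (num.Bit0 n) = False # num_bits n"
| "num_bits (num.Bit1 n) = True # num_bits n"

text \<open>The leading binary digit only marks the end of the list.\<close>

definition to_num :: "int \<Rightarrow> num" where
  "to_num n = num_of_nat (nat n)"

lemma to_num_Pos [code]: "to_num (Int.Pos n) = n"
  by (simp add: to_num_def num_of_nat_numeral_eq)

definition bits :: "int \<Rightarrow> bool list" where
  "bits n = num_bits (to_num n)"

text \<open>Three binary digits, lowest first, make one octal digit, so a permutation of the six
  fixed points is stored as a single number.\<close>

fun octal :: "bool list \<Rightarrow> nat list" where
  "octal (x # y # z # xs) = (of_bool x + (of_bool y + of_bool y) + (of_bool z + of_bool z + (of_bool z + of_bool z))) # octal xs"
| "octal _ = []"

declare nth.simps [code del]
declare nth_Cons_0 [code] nth_Cons_Suc [code]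

subsection \<open>The fixed part\<close>

fun xor :: "bool list \<Rightarrow> bool list \<Rightarrow> bool list" where
  "xor (x # xs) (y # ys) = (x \<noteq> y) # xor xs ys"
| "xor _ _ = []"

fun xor_rows :: "bool list \<Rightarrow> bool list list \<Rightarrow> bool list \<Rightarrow> bool list" where
  "xor_rows (True # s) (r # rs) a = xor_rows s rs (xor r a)"
| "xor_rows (False # s) (r # rs) a = xor_rows s rs a"
| "xor_rows _ _ a = a"

text \<open>A row can be tested once all rows selected by its ones are known; rows beyond the known
  ones must not be selected.\<close>

fun decided :: "bool list \<Rightarrow> bool list list \<Rightarrow> bool" where
  "decided (x # s) (r # rs) = decided s rs"
| "decided (True # s) [] = False"
| "decided (False # s) [] = decided s []"
| "decided [] rs = True"

text \<open>The sum of the selected rows starts at \<open>r\<close> itself, so a zero result is the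
  row of \<open>F^2 + F = 0\<close> modulo two that belongs to \<open>r\<close>.\<close>

fun xor_ok_if :: "bool \<Rightarrow> bool list \<Rightarrow> bool list list \<Rightarrow> bool" where
  "xor_ok_if True r rs = (xor_rows r rs r = [False, False, False, False, False, False])"
| "xor_ok_if False r rs = True"

fun xor_ok :: "bool list list \<Rightarrow> bool list \<Rightarrow> bool" where
  "xor_ok rs r = xor_ok_if (decided r rs) r rs"

text \<open>Every row is tested again, because a new row may be the last one that an earlier row was
  waiting for.\<close>

fun all_xor_ok_aux :: "bool list list \<Rightarrow> bool" where
  "all_xor_ok_aux q = all_true (xor_ok q) q"

fun all_xor_ok :: "bool list list \<Rightarrow> bool list \<Rightarrow> bool" where
  "all_xor_ok p r = all_xor_ok_aux (p @ [r])"

fun tally :: "bool list \<Rightarrow> nat list \<Rightarrow> nat list" where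
  "tally (True # r) (n # ns) = Suc n # tally r ns"
| "tally (False # r) (n # ns) = n # tally r ns"
| "tally _ _ = []"

fun tallies :: "bool list list \<Rightarrow> nat list" where
  "tallies [] = [0, 0, 0, 0, 0, 0]"
| "tallies (r # rs) = tally r (tallies rs)"

fun at_least_three :: "nat list \<Rightarrow> bool list" where
  "at_least_three [] = []"
| "at_least_three (Suc (Suc (Suc n)) # ns) = True # at_least_three ns"
| "at_least_three (Suc (Suc 0) # ns) = False # at_least_three ns"
| "at_least_three (Suc 0 # ns) = False # at_least_three ns"
| "at_least_three (0 # ns) = False # at_least_three ns"

text \<open>Positions marked in \<open>s\<close> may not hold a one, positions marked in
  \<open>t\<close> may not hold a zero.\<close>

fun fits :: "bool list \<Rightarrow> bool list \<Rightarrow> bool list \<Rightarrow> bool" where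
  "fits (False # s) t (True # r) = fits s (tl t) r"
| "fits (True # s) t (True # r) = False"
| "fits s (False # t) (False # r) = fits (tl s) t r"
| "fits s (True # t) (False # r) = False"
| "fits _ _ _ = True"

fun flip_bits :: "bool list \<Rightarrow> bool list" where
  "flip_bits [] = []"
| "flip_bits (x # xs) = (\<not> x) # flip_bits xs"

fun flip_rows :: "bool list list \<Rightarrow> bool list list" where
  "flip_rows [] = []"
| "flip_rows (r # rs) = flip_bits r # flip_rows rs"

text \<open>Columns of \<open>F\<close> have three ones and three zeros, so a column that already
  has three of one kind is forced from there on. The entry set to \<open>True\<close> forbids a loop
  at the new point.\<close>

fun fixed_cand :: "bool list list \<Rightarrow> bool list list \<Rightarrow> bool list list" where
  "fixed_cand rows p = sieve (all_xor_ok p)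
     (sieve (fits ((at_least_three (tallies p))[length p := True]) (at_least_three (tallies (flip_rows p))))
       rows)"

definition fixed_search :: "bool list list list" where
  "fixed_search = dfs (fixed_cand (weighted 6 3)) 6 []"

subsection \<open>The blocks between fixed points and transposed pairs\<close>

text \<open>\<open>B C = I + J\<close> compares a row of \<open>B\<close> with a column of
  \<open>C\<close>. Attaching both to their fixed point turns the equation into a compatibility
  relation between six objects.\<close>

type_synonym crow = "bool list \<times> bool list"

fun compat :: "crow \<Rightarrow> crow \<Rightarrow> bool" where
  "compat (b, c) (b', c') = (meet b c' = 1 \<and> meet b' c = 1)"

fun conj_bits :: "bool list \<Rightarrow> bool list \<Rightarrow> bool list" where
  "conj_bits (x # xs) (y # ys) = (x \<and> y) # conj_bits xs ys"
| "conj_bits _ _ = []"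

text \<open>A measure that is symmetric in the two points and independent of the order of the pairs.
  Every solution can be arranged so that its first two points maximise it; after that, two points
  with a larger value need not be combined.\<close>

fun tau :: "crow \<Rightarrow> crow \<Rightarrow> nat" where
  "tau (b, c) (b', c') = meet b b' + meet c c' + meet (conj_bits b c) (conj_bits b' c')"

fun compat_tau :: "nat \<Rightarrow> crow \<Rightarrow> crow \<Rightarrow> bool" where
  "compat_tau m x y = (compat x y \<and> tau x y \<le> m)"

fun pair_up :: "'a \<Rightarrow> 'b list \<Rightarrow> ('a \<times> 'b) list" where
  "pair_up x [] = []"
| "pair_up x (y # ys) = (x, y) # pair_up x ys"

fun all_pairs :: "'a list \<Rightarrow> 'b list \<Rightarrow> ('a \<times> 'b) list" where
  "all_pairs [] ys = []"
| "all_pairs (x # xs) ys = pair_up x ys @ all_pairs xs ys"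

fun meet_is :: "nat \<Rightarrow> bool list \<Rightarrow> bool list \<Rightarrow> bool" where
  "meet_is n x y = (meet x y = n)"

fun meet_pair :: "nat \<Rightarrow> crow \<Rightarrow> bool" where
  "meet_pair n (b, c) = (meet b c = n)"

text \<open>The two bits of the first point weigh most, so sorting the pairs by this key also sorts
  the first point by itself.\<close>

fun col_key :: "bool \<Rightarrow> bool \<Rightarrow> bool \<Rightarrow> bool \<Rightarrow> nat" where
  "col_key a b c d = (if a then 8 else 0) + (if b then 4 else 0) + (if c then 2 else 0) + (if d then 1 else 0)"

fun col_keys :: "bool list \<Rightarrow> bool list \<Rightarrow> bool list \<Rightarrow> bool list \<Rightarrow> nat list" where
  "col_keys (x # xs) (y # ys) (z # zs) (w # ws) = col_key x y z w # col_keys xs ys zs ws"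
| "col_keys _ _ _ _ = []"

fun sorted_cols :: "crow \<Rightarrow> crow \<Rightarrow> bool" where
  "sorted_cols (b, c) (b', c') = sorted (col_keys b c b' c')"

text \<open>Two sets of size 3 with two common elements among eight: listing the pairs in neither
  set, in the second only, in the first only and in both gives this normal form.\<close>

definition row0 :: crow where
  "row0 = ([False, False, False, False, False, True, True, True],
    [False, False, False, False, True, False, True, True])"

definition row_cands :: "crow list" where
  "row_cands = sieve (meet_pair 2)
     (all_pairs (sieve (meet_is 1 (snd row0)) (weighted 8 3)) (sieve (meet_is 1 (fst row0)) (weighted 8 3)))"

text \<open>The remaining points form a set without order, so each clique is built in the order of
  the candidate list only.\<close>

fun cliques :: "nat \<Rightarrow> nat \<Rightarrow> crow list \<Rightarrow> crow list list" where
  "cliques m 0 cs = [[]]"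
| "cliques m (Suc n) [] = []"
| "cliques m (Suc n) (x # cs) = cons_all x (cliques m n (sieve (compat_tau m x) cs)) @ cliques m (Suc n) cs"

definition bc_completions :: "crow list \<Rightarrow> crow \<Rightarrow> nat \<Rightarrow> crow list list" where
  "bc_completions cs r m = cons_all row0 (cons_all r
     (cliques m 4 (sieve (compat_tau m r) (sieve (compat_tau m row0) cs))))"

fun bc_search :: "crow list \<Rightarrow> crow list \<Rightarrow> crow list list" where
  "bc_search cs [] = []"
| "bc_search cs (r # rs) = bc_completions cs r (tau row0 r) @ bc_search cs rs"

definition bc_leaves :: "crow list list" where
  "bc_leaves = bc_search row_cands (sieve (sorted_cols row0) row_cands)"

fun bit_num :: "bool \<Rightarrow> num \<Rightarrow> num" where
  "bit_num False n = num.Bit0 n"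
| "bit_num True n = num.Bit1 n"

fun push_row :: "bool list \<Rightarrow> bool list \<Rightarrow> num list \<Rightarrow> num list" where
  "push_row (b # bs) (c # cs) (n # ns) = bit_num b (bit_num c n) # push_row bs cs ns"
| "push_row _ _ _ = []"

text \<open>The code of a transposed pair interleaves its column of \<open>B\<close> with its row of
  \<open>C\<close>. Sorting the eight codes removes the freedom to permute the pairs.\<close>

fun col_codes :: "crow list \<Rightarrow> num list" where
  "col_codes [] = [num.One, num.One, num.One, num.One, num.One, num.One, num.One, num.One]"
| "col_codes ((b, c) # rs) = push_row b c (col_codes rs)"

fun insert_num :: "num \<Rightarrow> num list \<Rightarrow> num list"
  and insert_num_if :: "bool \<Rightarrow> num \<Rightarrow> num \<Rightarrow> num list \<Rightarrow> num list" where
  "insert_num x [] = [x]"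
| "insert_num x (y # ys) = insert_num_if (x \<le> y) x y ys"
| "insert_num_if True x y ys = x # y # ys"
| "insert_num_if False x y ys = y # insert_num x ys"

fun sort_nums :: "num list \<Rightarrow> num list" where
  "sort_nums [] = []"
| "sort_nums (x # xs) = insert_num x (sort_nums xs)"

fun select :: "nat list \<Rightarrow> 'a list \<Rightarrow> 'a list" where
  "select [] xs = []"
| "select (i # is) xs = xs ! i # select is xs"

fun is_perm :: "nat \<Rightarrow> nat list \<Rightarrow> bool" where
  "is_perm n p = (length p = n \<and> distinct p \<and> list_all (\<lambda>i. i < n) p)"

fun bc_cert_ok :: "num list list \<Rightarrow> crow list list \<Rightarrow> (nat \<times> int) list \<Rightarrow> bool"
  and bc_cert_ok_if :: "bool \<Rightarrow> num list list \<Rightarrow> crow list list \<Rightarrow> (nat \<times> int) list \<Rightarrow> bool" where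
  "bc_cert_ok reps [] cs = True"
| "bc_cert_ok reps (l # ls) [] = False"
| "bc_cert_ok reps (l # ls) ((k, p) # cs) =
     bc_cert_ok_if (k < 112 \<and> is_perm 6 (octal (bits p)) \<and>
       sort_nums (col_codes (select (octal (bits p)) l)) = reps ! k) reps ls cs"
| "bc_cert_ok_if True reps ls cs = bc_cert_ok reps ls cs"
| "bc_cert_ok_if False reps ls cs = False"

subsection \<open>The blocks between transposed pairs\<close>

fun evens :: "'a list \<Rightarrow> 'a list" where
  "evens (x # y # xs) = x # evens xs"
| "evens _ = []"

fun odds :: "'a list \<Rightarrow> 'a list" where
  "odds (x # y # xs) = y # odds xs"
| "odds _ = []"

fun b_cols :: "num list \<Rightarrow> bool list list" where
  "b_cols [] = []"
| "b_cols (n # ns) = evens (num_bits n) # b_cols ns"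

fun c_rows :: "num list \<Rightarrow> bool list list" where
  "c_rows [] = []"
| "c_rows (n # ns) = odds (num_bits n) # c_rows ns"

fun to_int :: "nat \<Rightarrow> int" where
  "to_int 0 = 0"
| "to_int (Suc n) = to_int n + 1"

text \<open>The entry in row \<open>j\<close> and column \<open>l\<close> of the matrix that is
  called \<open>E\<close> in the locale \<open>swap_dsrg\<close>. Matrices are lists of columns
  here, hence the order of the indices.\<close>

definition e2_entry :: "bool list list \<Rightarrow> bool list list \<Rightarrow> nat \<Rightarrow> nat \<Rightarrow> int" where
  "e2_entry bs cs l j = (let g = to_int (meet (cs ! j) (cs ! j)); h = to_int (meet (bs ! l) (bs ! l)) in
     (if j = l then 2 else 0) - 2 * to_int (meet (cs ! j) (bs ! l)) - 7 + 3 * g + 3 * h - g * h)"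

definition e2_col :: "bool list list \<Rightarrow> bool list list \<Rightarrow> nat \<Rightarrow> int list" where
  "e2_col bs cs l = map (e2_entry bs cs l) [0..<8]"

definition e2_cols :: "bool list list \<Rightarrow> bool list list \<Rightarrow> int list list" where
  "e2_cols bs cs = map (e2_col bs cs) [0..<8]"

fun proportional :: "int \<Rightarrow> int \<Rightarrow> int list \<Rightarrow> int list \<Rightarrow> bool" where
  "proportional a b (x # xs) (y # ys) = (x * b = a * y \<and> proportional a b xs ys)"
| "proportional a b _ _ = True"

text \<open>A certificate of rank one: a non-zero entry in row \<open>p\<close> and column
  \<open>q\<close>, and every column a multiple of column \<open>q\<close>.\<close>

definition pivot_ok :: "int list list \<Rightarrow> nat \<times> nat \<Rightarrow> bool" where
  "pivot_ok E pq = (case pq of (p, q) \<Rightarrow>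
     p < 8 \<and> q < 8 \<and> E ! q ! p \<noteq> 0 \<and> list_all (\<lambda>c. proportional (c ! p) (E ! q ! p) c (E ! q)) E)"

fun half_int :: "int \<Rightarrow> int option" where
  "half_int n = (if n mod 2 = 0 then Some (n div 2) else None)"

fun to_nat_opt :: "int \<Rightarrow> nat option" where
  "to_nat_opt n = (if 0 \<le> n then Some (nat n) else None)"

text \<open>An entry of \<open>S + C F B\<close>, which depends only on \<open>B\<close>,
  \<open>C\<close> and the eigenvalue \<open>th\<close>, so it is computed once for all candidates
  \<open>F\<close>. A fractional or negative value rules out the eigenvalue.\<close>

definition w_entry :: "int \<Rightarrow> bool list list \<Rightarrow> bool list list \<Rightarrow> int list list \<Rightarrow> nat \<Rightarrow> nat \<Rightarrow> nat option" where
  "w_entry th bs cs E l j = Option.bind (half_int ((th + 1) * (E ! l ! j)))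
     (\<lambda>e. to_nat_opt (e - (if j = l then 1 else 0) - 1 + to_int (meet (cs ! j) (cs ! j)) + to_int (meet (bs ! l) (bs ! l))))"

fun all_some :: "'a option list \<Rightarrow> 'a list option" where
  "all_some [] = Some []"
| "all_some (None # xs) = None"
| "all_some (Some x # xs) = map_option (Cons x) (all_some xs)"

definition w_col :: "int \<Rightarrow> bool list list \<Rightarrow> bool list list \<Rightarrow> int list list \<Rightarrow> nat \<Rightarrow> nat list option" where
  "w_col th bs cs E l = all_some (map (w_entry th bs cs E l) [0..<8])"

definition w_cols :: "int \<Rightarrow> bool list list \<Rightarrow> bool list list \<Rightarrow> int list list \<Rightarrow> nat list list option" where
  "w_cols th bs cs E = all_some (map (w_col th bs cs E) [0..<8])"

fun meets :: "bool list \<Rightarrow> bool list list \<Rightarrow> nat list" where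
  "meets b [] = []"
| "meets b (f # fs) = meet f b # meets b fs"

fun sum_where :: "bool list \<Rightarrow> nat list \<Rightarrow> nat" where
  "sum_where (True # c) (n # ns) = n + sum_where c ns"
| "sum_where (False # c) (n # ns) = sum_where c ns"
| "sum_where _ _ = 0"

fun small_diff :: "nat \<Rightarrow> nat \<Rightarrow> nat option" where
  "small_diff (Suc m) (Suc n) = small_diff m n"
| "small_diff 0 (Suc n) = None"
| "small_diff 0 0 = Some 0"
| "small_diff (Suc 0) 0 = Some 1"
| "small_diff (Suc (Suc 0)) 0 = Some 2"
| "small_diff (Suc (Suc (Suc m))) 0 = None"

fun cons_some :: "'a \<Rightarrow> 'a list option \<Rightarrow> 'a list option" where
  "cons_some x None = None"
| "cons_some x (Some xs) = Some (x # xs)"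

fun s_col :: "nat list \<Rightarrow> bool list list \<Rightarrow> nat list \<Rightarrow> nat list option"
  and s_col_if :: "nat option \<Rightarrow> nat list \<Rightarrow> bool list list \<Rightarrow> nat list \<Rightarrow> nat list option" where
  "s_col (w # ws) (c # cs) fb = s_col_if (small_diff w (sum_where c fb)) ws cs fb"
| "s_col [] cs fb = Some []"
| "s_col (w # ws) [] fb = Some []"
| "s_col_if None ws cs fb = None"
| "s_col_if (Some s) ws cs fb = cons_some s (s_col ws cs fb)"

fun s_cols :: "nat list list \<Rightarrow> bool list list \<Rightarrow> bool list list \<Rightarrow> bool list list \<Rightarrow> nat list list option"
  and s_cols_if :: "nat list option \<Rightarrow> nat list list \<Rightarrow> bool list list \<Rightarrow> bool list list \<Rightarrow> bool list list \<Rightarrow> nat list list option"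
  where
  "s_cols (w # ws) cs (b # bs) F = s_cols_if (s_col w cs (meets b F)) ws cs bs F"
| "s_cols [] cs bs F = Some []"
| "s_cols (w # ws) cs [] F = Some []"
| "s_cols_if None ws cs bs F = None"
| "s_cols_if (Some s) ws cs bs F = cons_some s (s_cols ws cs bs F)"

datatype trit = Zer | Pls | Mns

text \<open>Products of entries are 1, 0 or -1. The two signs are counted separately instead of
  adding integers, and the initial counters carry the constant terms.\<close>

fun bal :: "trit list \<Rightarrow> trit list \<Rightarrow> nat \<Rightarrow> nat \<Rightarrow> bool" where
  "bal [] ys p m = (p = m)"
| "bal (x # xs) [] p m = (p = m)"
| "bal (Zer # xs) (y # ys) p m = bal xs ys p m"
| "bal (Pls # xs) (Zer # ys) p m = bal xs ys p m"
| "bal (Pls # xs) (Pls # ys) p m = bal xs ys (Suc p) m"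
| "bal (Pls # xs) (Mns # ys) p m = bal xs ys p (Suc m)"
| "bal (Mns # xs) (Zer # ys) p m = bal xs ys p m"
| "bal (Mns # xs) (Pls # ys) p m = bal xs ys p (Suc m)"
| "bal (Mns # xs) (Mns # ys) p m = bal xs ys (Suc p) m"

text \<open>The entry of \<open>T\<^sup>2 + T\<close> with row \<open>r\<close>, column \<open>c\<close> and value \<open>t\<close> of \<open>T\<close> equals \<open>d\<close>.\<close>

fun t_eq :: "nat \<Rightarrow> trit list \<Rightarrow> trit list \<Rightarrow> trit \<Rightarrow> bool" where
  "t_eq d r c Zer = bal r c 0 d"
| "t_eq d r c Pls = bal r c 1 d"
| "t_eq d r c Mns = bal r c 0 (Suc d)"

text \<open>These are the entries of \<open>T^2 + T\<close> in the new row and the earlier columns.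
  Rows and columns are chosen together, so each of these products is complete when it is
  tested.\<close>

fun row_ok :: "(trit list \<times> trit list) list \<Rightarrow> trit list \<Rightarrow> trit list \<Rightarrow> bool"
  and row_ok_if :: "bool \<Rightarrow> (trit list \<times> trit list) list \<Rightarrow> trit list \<Rightarrow> trit list \<Rightarrow> bool" where
  "row_ok ((r', c') # p) (t # ts) r = row_ok_if (t_eq 0 r c' t) p ts r"
| "row_ok p ts r = True"
| "row_ok_if True p ts r = row_ok p ts r"
| "row_ok_if False p ts r = False"

fun col_ok :: "(trit list \<times> trit list) list \<Rightarrow> trit list \<Rightarrow> trit list \<Rightarrow> bool"
  and col_ok_if :: "bool \<Rightarrow> (trit list \<times> trit list) list \<Rightarrow> trit list \<Rightarrow> trit list \<Rightarrow> bool" where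
  "col_ok ((r', c') # p) (t # ts) c = col_ok_if (t_eq 0 r' c t) p ts c"
| "col_ok p ts c = True"
| "col_ok_if True p ts c = col_ok p ts c"
| "col_ok_if False p ts c = False"

fun row_good :: "(trit list \<times> trit list) list \<Rightarrow> trit list \<Rightarrow> bool" where
  "row_good p r = row_ok p r r"

fun col_good :: "(trit list \<times> trit list) list \<Rightarrow> trit list \<Rightarrow> trit \<Rightarrow> trit list \<Rightarrow> bool" where
  "col_good p r t c = col_ok_if (t_eq 2 r c t) p c c"

text \<open>An entry of the new row that lies in an earlier column is already decided; it becomes a
  list with a single option.\<close>

fun heads_at :: "nat \<Rightarrow> (trit list \<times> trit list) list \<Rightarrow> trit list list" where
  "heads_at k [] = []"
| "heads_at k ((r, c) # p) = [c ! k] # heads_at k p"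

fun tails_at :: "nat \<Rightarrow> (trit list \<times> trit list) list \<Rightarrow> trit list list" where
  "tails_at k [] = []"
| "tails_at k ((r, c) # p) = [r ! k] # tails_at k p"

fun cross :: "(trit list \<times> trit list) list \<Rightarrow> nat \<Rightarrow> trit list list \<Rightarrow> trit list list \<Rightarrow> (trit list \<times> trit list) list"
  where
  "cross p k cc [] = []"
| "cross p k cc (r # rs) =
     pair_up r (sieve (col_good p r (r ! k)) (choices (tails_at k p @ [r ! k] # cc))) @ cross p k cc rs"

fun t_cand_aux :: "trit list list list \<Rightarrow> trit list list list \<Rightarrow> (trit list \<times> trit list) list \<Rightarrow> nat \<Rightarrow> (trit list \<times> trit list) list" where
  "t_cand_aux R Q p k = cross p k (drop (Suc k) (Q ! k)) (sieve (row_good p) (choices (heads_at k p @ drop k (R ! k))))"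

fun t_cand :: "trit list list list \<Rightarrow> trit list list list \<Rightarrow> (trit list \<times> trit list) list \<Rightarrow> (trit list \<times> trit list) list" where
  "t_cand R Q p = t_cand_aux R Q p (length p)"

definition s_odd :: "nat list list \<Rightarrow> nat \<Rightarrow> nat \<Rightarrow> bool" where
  "s_odd S a b = (S ! b ! a = 1)"

text \<open>
  Exchanging the two points of a transposed pair changes the signs in one row and the same column of
  \<open>T\<close>. This allows to make the first non-zero entry among \<open>T 0 k, T k 0, T 1 k, T k 1, \<dots>\<close> positive.
\<close>

definition s_lead :: "nat list list \<Rightarrow> nat \<Rightarrow> nat \<Rightarrow> bool" where
  "s_lead S a b = (list_all (\<lambda>i. \<not> s_odd S i (max a b) \<and> \<not> s_odd S (max a b) i) [0..<min a b] \<and>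
     (b < a \<longrightarrow> \<not> s_odd S b a))"

text \<open>Off the diagonal \<open>T\<close> is non-zero exactly where \<open>S\<close> is 1. On
  the diagonal there are no loops, so a block \<open>(0, y)\<close> has sum \<open>y\<close> and
  difference \<open>-y\<close>, and the sum 2 cannot occur.\<close>

definition t_opt :: "nat list list \<Rightarrow> nat \<Rightarrow> nat \<Rightarrow> trit list" where
  "t_opt S a b = (if a = b then (if S ! a ! a = 0 then [Zer] else if S ! a ! a = 1 then [Mns] else [])
     else if s_odd S a b then (if s_lead S a b then [Pls] else [Pls, Mns]) else [Zer])"

definition t_opts :: "nat list list \<Rightarrow> trit list list list" where
  "t_opts S = map (\<lambda>a. map (t_opt S a) [0..<8]) [0..<8]"

definition t_opts' :: "nat list list \<Rightarrow> trit list list list" where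
  "t_opts' S = map (\<lambda>b. map (\<lambda>a. t_opt S a b) [0..<8]) [0..<8]"

definition t_search :: "nat list list \<Rightarrow> (trit list \<times> trit list) list list" where
  "t_search S = dfs (t_cand (t_opts S) (t_opts' S)) 8 []"

fun t_extend :: "bool list list \<Rightarrow> nat list list \<Rightarrow> (trit list \<times> trit list) list list \<Rightarrow>
    (bool list list \<times> nat list list \<times> (trit list \<times> trit list) list) list" where
  "t_extend F S [] = []"
| "t_extend F S (T # Ts) = (F, S, T) # t_extend F S Ts"

fun s_extend :: "bool list list \<Rightarrow> nat list list option \<Rightarrow>
    (bool list list \<times> nat list list \<times> (trit list \<times> trit list) list) list" where
  "s_extend F None = []"
| "s_extend F (Some S) = t_extend F S (t_search S)"

fun f_extend :: "nat list list \<Rightarrow> bool list list \<Rightarrow> bool list list \<Rightarrow> bool list list list \<Rightarrow>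
    (bool list list \<times> nat list list \<times> (trit list \<times> trit list) list) list" where
  "f_extend w cs bs [] = []"
| "f_extend w cs bs (F # Fs) = s_extend F (s_cols w cs bs F) @ f_extend w cs bs Fs"

fun w_extend :: "nat list list option \<Rightarrow> bool list list \<Rightarrow> bool list list \<Rightarrow> bool list list list \<Rightarrow>
    (bool list list \<times> nat list list \<times> (trit list \<times> trit list) list) list" where
  "w_extend None cs bs Fs = []"
| "w_extend (Some w) cs bs Fs = f_extend w cs bs Fs"

fun e_extend :: "bool list list list \<Rightarrow> bool list list \<Rightarrow> bool list list \<Rightarrow> int list list \<Rightarrow>
    (bool list list \<times> nat list list \<times> (trit list \<times> trit list) list) list" where
  "e_extend Fs bs cs E = w_extend (w_cols 1 bs cs E) cs bs Fs @ w_extend (w_cols (-2) bs cs E) cs bs Fs"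

definition rep_leaves :: "bool list list list \<Rightarrow> num list \<Rightarrow>
    (bool list list \<times> nat list list \<times> (trit list \<times> trit list) list) list" where
  "rep_leaves Fs r = e_extend Fs (b_cols r) (c_rows r) (e2_cols (b_cols r) (c_rows r))"

subsection \<open>Adjacency matrices\<close>

fun doubled :: "bool list \<Rightarrow> bool list" where
  "doubled [] = []"
| "doubled (x # xs) = x # x # doubled xs"

fun nth_all :: "'a list list \<Rightarrow> nat \<Rightarrow> 'a list" where
  "nth_all [] i = []"
| "nth_all (x # xs) i = x ! i # nth_all xs i"

fun fixed_rows :: "bool list list \<Rightarrow> bool list list \<Rightarrow> nat \<Rightarrow> bool list list" where
  "fixed_rows bs [] i = []"
| "fixed_rows bs (f # F) i = (f @ doubled (nth_all bs i)) # fixed_rows bs F (Suc i)"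

text \<open>Recovers \<open>x\<close> from \<open>s = x + y\<close> and \<open>t = x - y\<close>, as
  \<open>diff_bit\<close> recovers \<open>y\<close>.\<close>

fun same_bit :: "nat \<Rightarrow> trit \<Rightarrow> bool" where
  "same_bit 0 t = False"
| "same_bit (Suc 0) t = (t = Pls)"
| "same_bit (Suc (Suc n)) t = True"

fun diff_bit :: "nat \<Rightarrow> trit \<Rightarrow> bool" where
  "diff_bit 0 t = False"
| "diff_bit (Suc 0) t = (t = Mns)"
| "diff_bit (Suc (Suc n)) t = True"

fun pair_row :: "nat list \<Rightarrow> trit list \<Rightarrow> bool list" where
  "pair_row (s # ss) (t # ts) = same_bit s t # diff_bit s t # pair_row ss ts"
| "pair_row _ _ = []"

fun pair_row' :: "nat list \<Rightarrow> trit list \<Rightarrow> bool list" where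
  "pair_row' (s # ss) (t # ts) = diff_bit s t # same_bit s t # pair_row' ss ts"
| "pair_row' _ _ = []"

fun pair_rows :: "bool list list \<Rightarrow> nat list list \<Rightarrow> nat \<Rightarrow> (trit list \<times> trit list) list \<Rightarrow> bool list list" where
  "pair_rows (c # cs) S j ((r, r') # T) =
     (c @ pair_row (nth_all S j) r) # (c @ pair_row' (nth_all S j) r) # pair_rows cs S (Suc j) T"
| "pair_rows _ _ _ _ = []"

fun leaf_mat :: "bool list list \<Rightarrow> bool list list \<Rightarrow> (bool list list \<times> nat list list \<times> (trit list \<times> trit list) list) \<Rightarrow> bool list list" where
  "leaf_mat bs cs (F, S, T) = fixed_rows bs F 0 @ pair_rows cs S 0 T"

fun select_rows :: "nat list \<Rightarrow> bool list list \<Rightarrow> bool list list" where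
  "select_rows p [] = []"
| "select_rows p (r # rs) = select p r # select_rows p rs"

type_synonym leaf = "bool list list \<times> nat list list \<times> (trit list \<times> trit list) list"

subsection \<open>Verification of the graphs\<close>

text \<open>A row of \<open>4 J - A + 2 I\<close>; the diagonal entry is 4 - 0 + 2.\<close>

definition path_counts :: "bool list \<Rightarrow> nat \<Rightarrow> nat list" where
  "path_counts r i = (map (\<lambda>x. if x then 3 else 4) r)[i := 6]"

fun path_rows_ok :: "nat \<Rightarrow> bool list list \<Rightarrow> bool list list \<Rightarrow> bool" where
  "path_rows_ok i [] cols = True"
| "path_rows_ok i (r # rs) cols =
     (\<not> r ! i \<and> meet r r = 9 \<and> meets r cols = path_counts r i \<and> path_rows_ok (Suc i) rs cols)"

fun col_sums_ok :: "bool list list \<Rightarrow> bool" where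
  "col_sums_ok [] = True"
| "col_sums_ok (c # cs) = (meet c c = 9 \<and> col_sums_ok cs)"

definition cols_of :: "bool list list \<Rightarrow> bool list list" where
  "cols_of M = map (nth_all M) [0..<22]"

fun count_meet :: "nat \<Rightarrow> bool list \<Rightarrow> bool list list \<Rightarrow> nat" where
  "count_meet n r [] = 0"
| "count_meet n r (s # ss) = of_bool (meet r s = n) + count_meet n r ss"

definition swap_perm :: "nat list" where
  "swap_perm = [0, 1, 2, 3, 4, 5, 7, 6, 9, 8, 11, 10, 13, 12, 15, 14, 17, 16, 19, 18, 21, 20]"

definition mat_ok :: "bool list list \<Rightarrow> bool" where
  "mat_ok M = (length M = 22 \<and> list_all (\<lambda>r. length r = 22) M \<and> path_rows_ok 0 M (cols_of M) \<and>
     col_sums_ok (cols_of M) \<and> select_rows swap_perm (select swap_perm M) = M)"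

text \<open>A vertex is coloured by the number of vertices with which it shares exactly four
  out-neighbours, and likewise four in-neighbours. With degree nine it never counts itself.\<close>

fun colours :: "bool list list \<Rightarrow> bool list list \<Rightarrow> bool list list \<Rightarrow> bool list list \<Rightarrow> (nat \<times> nat) list" where
  "colours M N (r # rs) (c # cs) = (count_meet 4 r M, count_meet 4 c N) # colours M N rs cs"
| "colours M N _ _ = []"

definition colouring :: "bool list list \<Rightarrow> (nat \<times> nat) list" where
  "colouring M = colours M (cols_of M) M (cols_of M)"

text \<open>A sum over all vertices does not depend on their order. The coefficient 3 distinguishes
  the two counts, and squaring retains more than their totals.\<close>

fun colour_key :: "(nat \<times> nat) list \<Rightarrow> int" where
  "colour_key [] = 0"
| "colour_key ((a, b) # cs) = (3 * to_int a + to_int b) ^ 2 + colour_key cs"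

fun consistent :: "bool list \<Rightarrow> bool list \<Rightarrow> bool list \<Rightarrow> bool list \<Rightarrow> nat list \<Rightarrow> bool"
  and consistent_if :: "bool \<Rightarrow> bool list \<Rightarrow> bool list \<Rightarrow> bool list \<Rightarrow> bool list \<Rightarrow> nat list \<Rightarrow> bool" where
  "consistent (a # r) (b # c) r' c' (q # p) = consistent_if (a = r' ! q \<and> b = c' ! q) r c r' c' p"
| "consistent _ _ r' c' _ = True"
| "consistent_if True r c r' c' p = consistent r c r' c' p"
| "consistent_if False r c r' c' p = False"

fun aut_filter :: "bool list \<Rightarrow> bool list \<Rightarrow> nat \<times> nat \<Rightarrow> nat list \<Rightarrow> nat \<Rightarrow> bool list list \<Rightarrow> bool list list \<Rightarrow>
    (nat \<times> nat) list \<Rightarrow> nat list" where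
  "aut_filter r c k p y (r' # rs) (c' # cs) (k' # ks) =
     cons_if (consistent_if (k = k') r c r' c' p) y (aut_filter r c k p (Suc y) rs cs ks)"
| "aut_filter r c k p y _ _ _ = []"

fun aut_cand_aux :: "bool list list \<Rightarrow> bool list list \<Rightarrow> (nat \<times> nat) list \<Rightarrow> nat list \<Rightarrow> nat \<Rightarrow> nat list" where
  "aut_cand_aux M N ks p n = aut_filter (M ! n) (N ! n) (ks ! n) p 0 M N ks"

fun aut_cand :: "bool list list \<Rightarrow> bool list list \<Rightarrow> (nat \<times> nat) list \<Rightarrow> nat list \<Rightarrow> nat list" where
  "aut_cand M N ks p = aut_cand_aux M N ks p (length p)"

definition aut_search :: "bool list list \<Rightarrow> nat list list" where
  "aut_search M = dfs (aut_cand M (cols_of M) (colouring M)) 22 []"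

fun is_aut :: "bool list list \<Rightarrow> nat list \<Rightarrow> bool" where
  "is_aut M p = (is_perm 22 p \<and> select_rows p (select p M) = M)"

section \<open>Stored matrices, representatives and witnesses\<close>

definition fixed_codes :: "int list list" where
  "fixed_codes = [
    [120, 116, 75, 71, 102, 89], [120, 116, 75, 71, 105, 86], [120, 108, 83, 102, 71, 89], [120, 108, 83, 113, 71, 78],
    [120, 92, 99, 86, 105, 71], [120, 92, 99, 113, 78, 71], [120, 101, 90, 86, 105, 71], [120, 101, 90, 113, 78, 71],
    [120, 85, 106, 102, 71, 89], [120, 85, 106, 113, 71, 78], [120, 77, 114, 71, 102, 89], [120, 77, 114, 71, 105, 86],
    [116, 120, 75, 71, 106, 85], [116, 120, 75, 71, 101, 90], [116, 108, 106, 83, 75, 85], [116, 108, 113, 83, 75, 78],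
    [116, 92, 90, 99, 101, 75], [116, 92, 113, 99, 78, 75], [116, 105, 90, 86, 101, 75], [116, 105, 113, 86, 78, 75],
    [116, 89, 106, 102, 75, 85], [116, 89, 113, 102, 75, 78], [116, 77, 75, 114, 106, 85], [116, 77, 75, 114, 101, 90],
    [108, 120, 83, 114, 71, 77], [108, 120, 83, 101, 71, 90], [108, 116, 114, 83, 75, 77], [108, 116, 105, 83, 75, 86],
    [108, 92, 90, 101, 99, 83], [108, 92, 105, 86, 99, 83], [108, 113, 90, 101, 78, 83], [108, 113, 105, 86, 78, 83],
    [108, 89, 114, 83, 102, 77], [108, 89, 105, 83, 102, 86], [108, 85, 83, 114, 106, 77], [108, 85, 83, 101, 106, 90],
    [92, 120, 99, 114, 77, 71], [92, 120, 99, 85, 106, 71], [92, 116, 114, 99, 77, 75], [92, 116, 89, 99, 102, 75],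
    [92, 108, 106, 85, 99, 83], [92, 108, 89, 102, 99, 83], [92, 113, 106, 85, 99, 78], [92, 113, 89, 102, 99, 78],
    [92, 105, 114, 99, 77, 86], [92, 105, 89, 99, 102, 86], [92, 101, 99, 114, 77, 90], [92, 101, 99, 85, 106, 90],
    [114, 108, 106, 85, 77, 83], [114, 108, 89, 102, 77, 83], [114, 92, 90, 101, 99, 77], [114, 92, 105, 86, 99, 77],
    [114, 113, 106, 85, 77, 78], [114, 113, 90, 101, 78, 77], [114, 113, 105, 86, 78, 77], [114, 113, 89, 102, 77, 78],
    [114, 77, 120, 71, 108, 83], [114, 77, 120, 71, 99, 92], [114, 77, 75, 116, 108, 83], [114, 77, 75, 116, 99, 92],
    [106, 116, 114, 85, 77, 75], [106, 116, 89, 85, 102, 75], [106, 92, 90, 99, 101, 85], [106, 92, 113, 99, 78, 85],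
    [106, 105, 114, 85, 77, 86], [106, 105, 90, 86, 101, 85], [106, 105, 113, 86, 78, 85], [106, 105, 89, 85, 102, 86],
    [106, 85, 120, 116, 71, 75], [106, 85, 120, 99, 71, 92], [106, 85, 83, 116, 108, 75], [106, 85, 83, 99, 108, 92],
    [90, 116, 114, 101, 75, 77], [90, 116, 105, 101, 75, 86], [90, 108, 106, 83, 101, 85], [90, 108, 113, 83, 101, 78],
    [90, 89, 114, 101, 102, 77], [90, 89, 106, 102, 101, 85], [90, 89, 113, 102, 101, 78], [90, 89, 105, 101, 102, 86],
    [90, 101, 120, 116, 75, 71], [90, 101, 120, 83, 108, 71], [90, 101, 99, 116, 75, 92], [90, 101, 99, 83, 108, 92],
    [102, 120, 89, 114, 77, 71], [102, 120, 89, 85, 106, 71], [102, 92, 99, 86, 105, 89], [102, 92, 99, 113, 78, 89],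
    [102, 89, 120, 116, 75, 71], [102, 89, 120, 83, 108, 71], [102, 89, 99, 116, 75, 92], [102, 89, 99, 83, 108, 92],
    [102, 101, 90, 86, 105, 89], [102, 101, 90, 113, 78, 89], [102, 101, 89, 114, 77, 90], [102, 101, 89, 85, 106, 90],
    [86, 120, 105, 114, 71, 77], [86, 120, 105, 101, 71, 90], [86, 108, 83, 102, 105, 89], [86, 108, 83, 113, 105, 78],
    [86, 105, 120, 116, 71, 75], [86, 105, 120, 99, 71, 92], [86, 105, 83, 116, 108, 75], [86, 105, 83, 99, 108, 92],
    [86, 85, 106, 102, 105, 89], [86, 85, 106, 113, 105, 78], [86, 85, 105, 114, 106, 77], [86, 85, 105, 101, 106, 90],
    [78, 120, 113, 71, 106, 85], [78, 120, 113, 71, 101, 90], [78, 116, 75, 113, 102, 89], [78, 116, 75, 113, 105, 86],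
    [78, 113, 120, 71, 108, 83], [78, 113, 120, 71, 99, 92], [78, 113, 75, 116, 108, 83], [78, 113, 75, 116, 99, 92],
    [78, 77, 114, 113, 102, 89], [78, 77, 114, 113, 105, 86], [78, 77, 113, 114, 106, 85], [78, 77, 113, 114, 101, 90]
  ]"

definition fixed_parts :: "bool list list list" where
  "fixed_parts = map (map bits) fixed_codes"

text \<open>
  Representatives of the solutions of \<open>BC = I + J\<close>, given by codes of their eight columns, and for each
  of the leaves of the search the index of its representative and a permutation of the rows, in octal digits.
\<close>

definition bc_rep_codes :: "int list list" where
  "bc_rep_codes = [
    [4156, 4300, 4336, 4867, 5545, 6742, 7171, 7936], [4192, 4412, 4611, 5074, 5263, 6344, 7217, 7940],
    [4320, 4412, 4617, 5062, 5299, 6147, 7244, 7952], [4304, 4364, 4803, 4914, 5167, 6264, 7169, 8068],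
    [4288, 4330, 4656, 4877, 5559, 6147, 7196, 8000], [4272, 4296, 4892, 4931, 5135, 6194, 7653, 7680],
    [4272, 4301, 4642, 4872, 6007, 6147, 7196, 7616], [4272, 4301, 4872, 4898, 5751, 6147, 7196, 7616],
    [4272, 4294, 4620, 4883, 5609, 6204, 7171, 8000], [4272, 4301, 4872, 4914, 5735, 6147, 7196, 7616],
    [4192, 4302, 4867, 4916, 5171, 6553, 7180, 7872], [4272, 4301, 4872, 4915, 5734, 6147, 7196, 7616],
    [4224, 4400, 4623, 5080, 5317, 6259, 7212, 7938], [4288, 4400, 4623, 5080, 5253, 6259, 7212, 7938],
    [4256, 4558, 4611, 4980, 5179, 6156, 7377, 7936], [4320, 4412, 4611, 5078, 5259, 6220, 7217, 7936],
    [4288, 4400, 4829, 4874, 5127, 6259, 7212, 8064], [4320, 4490, 4620, 4913, 5343, 6147, 7220, 8000],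
    [4320, 4494, 4620, 4913, 5339, 6147, 7220, 8000], [4304, 4364, 4642, 4983, 5123, 6349, 7224, 8064],
    [4304, 4364, 4643, 4982, 5123, 6349, 7224, 8064], [4320, 4408, 4813, 4866, 5175, 6211, 7180, 8080],
    [4320, 4408, 4621, 5058, 5303, 6147, 7244, 7952], [4320, 4554, 4620, 4913, 5279, 6147, 7220, 8000],
    [4192, 4238, 4916, 5059, 5171, 6413, 7384, 7680], [4320, 4570, 4620, 4913, 5263, 6147, 7220, 8000],
    [4192, 4404, 4803, 4878, 5179, 6348, 7169, 8080], [4192, 4406, 4803, 4876, 5177, 6348, 7171, 8080],
    [4192, 4302, 4868, 5041, 5139, 6411, 7228, 7872], [4192, 4412, 4631, 5058, 5131, 6348, 7345, 7936],
    [4304, 4364, 4658, 5063, 5123, 6269, 7304, 7968], [4304, 4364, 4658, 4967, 5123, 6349, 7224, 8064],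
    [4176, 4302, 4868, 5043, 5123, 6204, 7433, 7904], [4304, 4364, 4726, 4899, 5123, 6349, 7224, 8064],
    [4304, 4364, 4662, 5059, 5123, 6265, 7308, 7968], [4208, 4294, 4355, 4908, 5171, 6873, 7180, 8064],
    [4256, 4301, 4872, 4979, 5180, 6147, 7632, 7686], [4256, 4596, 4611, 4942, 5179, 6156, 7361, 7952],
    [4320, 4404, 4611, 5070, 5307, 6156, 7233, 7952], [4320, 4532, 4611, 4942, 5179, 6156, 7361, 7952],
    [4320, 4412, 4759, 4866, 5195, 6156, 7217, 8128], [4288, 4309, 4400, 4878, 5123, 6779, 7212, 8064],
    [4192, 4404, 4819, 4878, 5123, 6348, 7225, 8064], [4320, 4372, 4611, 5054, 5323, 6156, 7217, 8000],
    [4320, 4500, 4611, 4926, 5323, 6156, 7217, 8000], [4320, 4502, 4611, 4924, 5323, 6156, 7217, 8000],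
    [4208, 4302, 4369, 4868, 5123, 7099, 7212, 7872], [4304, 4364, 4677, 4914, 5123, 6383, 7224, 8064],
    [4304, 4364, 4709, 4914, 5123, 6351, 7224, 8064], [4208, 4302, 4868, 4915, 5123, 6553, 7212, 7872],
    [4320, 4404, 4611, 5022, 5323, 6156, 7217, 8000], [4320, 4532, 4611, 4894, 5323, 6156, 7217, 8000],
    [4320, 4412, 4685, 4866, 5171, 6343, 7176, 8080], [4320, 4412, 4611, 5014, 5323, 6156, 7217, 8000],
    [4208, 4302, 4868, 4881, 5123, 6587, 7212, 7872], [4304, 4364, 4805, 4914, 5123, 6255, 7224, 8064],
    [4304, 4364, 4807, 4914, 5123, 6253, 7224, 8064], [4304, 4364, 4685, 4914, 5123, 6375, 7224, 8064],
    [4304, 4364, 4837, 4914, 5123, 6223, 7224, 8064], [4208, 4302, 4868, 4913, 5123, 6555, 7212, 7872],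
    [4320, 4380, 4611, 5046, 5323, 6156, 7217, 8000], [4320, 4508, 4611, 4918, 5323, 6156, 7217, 8000],
    [4320, 4558, 4611, 4916, 5275, 6156, 7217, 8000], [4320, 4506, 4620, 4913, 5327, 6147, 7220, 8000],
    [4176, 4364, 4850, 4999, 5123, 6205, 7368, 7968], [4304, 4388, 4723, 4878, 5123, 6349, 7224, 8064],
    [4304, 4484, 4659, 4878, 5323, 6204, 7169, 8032], [4304, 4364, 4807, 4914, 5161, 6268, 7171, 8064],
    [4176, 4364, 4803, 4914, 5167, 6392, 7169, 8068], [4304, 4484, 4723, 4878, 5123, 6204, 7369, 7968],
    [4304, 4364, 4659, 5062, 5257, 6268, 7171, 7968], [4304, 4364, 4710, 4915, 5123, 6349, 7224, 8064],
    [4320, 4412, 4678, 4867, 5171, 6349, 7176, 8080], [4192, 4404, 4623, 5058, 5299, 6348, 7169, 7960],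
    [4320, 4532, 4687, 4866, 5171, 6156, 7361, 7960], [4304, 4484, 4623, 4914, 5347, 6204, 7169, 8008],
    [4160, 4412, 4834, 4871, 5171, 6349, 7176, 8080], [4288, 4412, 4706, 4871, 5171, 6349, 7176, 8080],
    [4192, 4412, 4802, 4871, 5171, 6349, 7176, 8080], [4320, 4412, 4674, 4871, 5171, 6349, 7176, 8080],
    [4288, 4540, 4658, 4871, 5355, 6156, 7185, 8000], [4320, 4412, 4614, 4931, 5171, 6349, 7176, 8080],
    [4256, 4596, 4687, 4866, 5171, 6156, 7361, 7960], [4192, 4412, 4611, 5062, 5299, 6344, 7181, 7952],
    [4320, 4412, 4611, 5062, 5299, 6216, 7181, 7952], [4320, 4412, 4611, 5062, 5299, 6217, 7180, 7952],
    [4192, 4412, 4806, 4867, 5171, 6345, 7180, 8080], [4304, 4364, 4722, 4999, 5123, 6205, 7368, 7968],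
    [4304, 4364, 4706, 4919, 5123, 6349, 7224, 8064], [4304, 4364, 4722, 4903, 5123, 6349, 7224, 8064],
    [4176, 4364, 4807, 5042, 5123, 6205, 7400, 7936], [4208, 4292, 4908, 4995, 5169, 6159, 7424, 7898],
    [4304, 4364, 4734, 4899, 5131, 6341, 7216, 8064], [4304, 4364, 4662, 4963, 5123, 6349, 7224, 8064],
    [4304, 4364, 4707, 4918, 5123, 6349, 7224, 8064], [4304, 4492, 4670, 4867, 5323, 6193, 7172, 8032],
    [4192, 4412, 4615, 5074, 5259, 6348, 7217, 7936], [4304, 4364, 4734, 4995, 5131, 6193, 7364, 7968],
    [4320, 4412, 4615, 4930, 5171, 6349, 7176, 8080], [4320, 4412, 4675, 4870, 5171, 6349, 7176, 8080],
    [4320, 4412, 4627, 5062, 5131, 6220, 7345, 7936], [4192, 4412, 4819, 4870, 5131, 6348, 7217, 8064],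
    [4192, 4412, 4615, 5058, 5299, 6348, 7177, 7952], [4320, 4412, 4611, 5062, 5299, 6157, 7240, 7952],
    [4304, 4364, 4807, 4914, 5131, 6268, 7201, 8064], [4304, 4364, 4807, 4914, 5155, 6268, 7177, 8064],
    [4304, 4492, 4615, 4978, 5155, 6204, 7369, 7936], [4320, 4412, 4611, 5062, 5299, 6220, 7177, 7952],
    [4192, 4412, 4803, 4870, 5171, 6348, 7177, 8080], [4304, 4364, 4659, 5062, 5131, 6268, 7297, 7968],
    [4304, 4364, 4659, 5062, 5251, 6268, 7177, 7968], [4336, 4492, 4675, 4918, 5155, 6172, 7369, 7936]
  ]"

definition bc_witnesses :: "(nat \<times> int) list" where
  "bc_witnesses = [
    (0, 334616), (1, 305860), (2, 362637), (1, 277258), (2, 398533), (3, 305923), (3, 276810), (1, 305349),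
    (2, 363148), (3, 305860), (3, 280394), (1, 277258), (2, 398533), (1, 273100), (2, 366725), (1, 310018),
    (2, 394445), (3, 273163), (3, 309570), (1, 272589), (2, 367236), (3, 273100), (3, 313154), (1, 310018),
    (2, 394445), (1, 305349), (2, 363148), (3, 305860), (3, 280394), (1, 277258), (2, 398533), (1, 272589),
    (2, 367236), (3, 273100), (3, 313154), (1, 310018), (2, 394445), (4, 273163), (5, 362833), (4, 269075),
    (5, 362826), (5, 399170), (6, 279883), (7, 283411), (5, 403265), (7, 283915), (8, 304992), (8, 333664),
    (9, 279883), (4, 305923), (5, 366928), (5, 403272), (7, 316675), (8, 272225), (8, 329569), (9, 312643),
    (8, 268130), (8, 296802), (9, 344899), (10, 431776), (10, 435808), (10, 435745), (11, 279883), (4, 272715),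
    (5, 363281), (6, 279883), (7, 283411), (5, 399170), (5, 435969), (7, 279883), (8, 304936), (9, 279883),
    (8, 333664), (5, 362826), (4, 269075), (4, 305475), (5, 367376), (5, 435976), (7, 312643), (8, 272169),
    (9, 312643), (8, 329569), (9, 340741), (10, 400024), (11, 279883), (8, 268522), (10, 436312), (8, 297194),
    (10, 436249), (12, 349960), (12, 349960), (12, 280394), (12, 280394), (13, 277258), (13, 346824), (13, 349960),
    (13, 280394), (14, 377960), (15, 406541), (16, 415249), (16, 281290), (16, 379409), (14, 414808), (16, 284426),
    (15, 443403), (12, 382209), (17, 280170), (18, 280170), (19, 438916), (20, 406149), (21, 281290), (22, 281290),
    (22, 313987), (23, 276586), (24, 400080), (25, 365605), (26, 398981), (27, 313000), (28, 280170), (29, 415298),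
    (30, 381600), (31, 434380), (32, 330073), (33, 406149), (34, 381600), (35, 439392), (36, 329317), (37, 398981),
    (38, 367236), (39, 367236), (40, 315618), (40, 383042), (12, 382209), (21, 284874), (22, 313987), (22, 281290),
    (19, 438916), (17, 284258), (20, 406149), (18, 280170), (36, 329317), (30, 414360), (37, 398981), (31, 401739),
    (23, 281178), (26, 367236), (38, 367236), (39, 367236), (27, 309920), (40, 315618), (40, 383042), (28, 276586),
    (29, 383042), (32, 329569), (33, 377477), (34, 414360), (35, 443480), (24, 400080), (25, 365605), (15, 406597),
    (14, 377897), (16, 443984), (16, 310018), (16, 408144), (15, 443459), (16, 313154), (14, 414745), (12, 313154),
    (12, 313154), (13, 310018), (13, 349953), (13, 346817), (13, 313154), (23, 309290), (24, 395985), (25, 361573),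
    (26, 394893), (27, 280233), (30, 381089), (31, 434884), (32, 334168), (33, 405645), (34, 381089), (35, 439329),
    (28, 312874), (29, 415242), (36, 333349), (37, 394893), (38, 363148), (39, 363148), (40, 283362), (40, 382986),
    (36, 333349), (30, 413849), (37, 394893), (31, 402243), (23, 313882), (26, 363148), (38, 363148), (39, 363148),
    (27, 277153), (40, 283362), (40, 382986), (28, 309290), (29, 382986), (32, 333664), (33, 376973), (34, 413849),
    (35, 443417), (24, 395985), (25, 361573), (41, 443984), (41, 408144), (42, 398981), (42, 394893), (42, 367236),
    (42, 363148), (43, 367236), (44, 367236), (44, 370757), (45, 367236), (43, 363148), (44, 363148), (44, 370701),
    (45, 363148), (46, 436312), (47, 414913), (47, 443592), (48, 381698), (47, 439056), (48, 414913), (48, 443592),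
    (49, 436312), (43, 363092), (44, 363092), (44, 366613), (45, 363092), (50, 367236), (51, 367236), (52, 442577),
    (53, 370757), (50, 363148), (51, 363148), (52, 443088), (53, 370701), (54, 436312), (55, 414913), (55, 443592),
    (56, 439056), (57, 439056), (58, 414913), (58, 443592), (59, 367138), (60, 363092), (61, 363092), (61, 366613),
    (62, 277090), (43, 329835), (60, 329835), (44, 329835), (61, 329835), (44, 333356), (61, 333356), (45, 329835),
    (62, 272477), (63, 329821), (64, 348707), (65, 334147), (66, 394893), (67, 305496), (68, 377386), (69, 334595),
    (69, 394893), (70, 305944), (64, 381026), (65, 362826), (46, 367376), (47, 381600), (54, 377960), (57, 381600),
    (47, 342337), (48, 342337), (55, 342337), (58, 342337), (43, 408130), (44, 408130), (50, 398533), (52, 348441),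
    (66, 398533), (67, 276817), (47, 371016), (48, 371016), (55, 371016), (58, 371016), (48, 438916), (49, 367376),
    (56, 381600), (59, 431636), (71, 406149), (44, 398533), (45, 408130), (51, 398533), (53, 408130), (72, 401613),
    (64, 438356), (66, 334147), (72, 376973), (65, 427212), (67, 283873), (68, 376938), (69, 330507), (69, 398981),
    (70, 313000), (64, 406037), (66, 330507), (72, 377477), (65, 398533), (67, 312552), (43, 408074), (44, 408074),
    (50, 394445), (52, 348952), (44, 394445), (45, 408074), (51, 394445), (53, 408074), (72, 402117), (71, 344773),
    (63, 329821), (73, 394893), (74, 363148), (73, 363148), (74, 363148), (73, 431748), (74, 400003), (73, 400003),
    (74, 400003), (73, 394445), (73, 431300), (75, 394893), (75, 431748), (73, 394445), (73, 431300), (75, 394893),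
    (75, 431748), (74, 394893), (73, 363148), (74, 363148), (74, 431748), (73, 400003), (74, 400003), (75, 394893),
    (75, 431748), (73, 394445), (73, 431300), (75, 363148), (75, 400003), (75, 367362), (75, 330507), (75, 330507),
    (75, 367362), (74, 431300), (74, 431300), (74, 394445), (74, 394445), (76, 395929), (77, 395929), (76, 428185),
    (77, 428185), (76, 403993), (77, 403993), (76, 436249), (77, 436249), (37, 340517), (78, 428185), (79, 428185),
    (80, 334560), (81, 428185), (72, 428185), (76, 408144), (77, 408144), (82, 376938), (83, 305860), (84, 305860),
    (83, 276621), (84, 276621), (85, 305860), (86, 427681), (37, 340524), (78, 395929), (79, 395929), (80, 334056),
    (81, 395929), (72, 395929), (76, 440400), (77, 440400), (82, 381026), (83, 277132), (84, 277132), (83, 305349),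
    (84, 305349), (85, 277132), (86, 395929), (4, 408144), (4, 408144), (76, 400080), (77, 400080), (37, 368748),
    (78, 400080), (79, 400080), (19, 366928), (31, 366928), (30, 366928), (64, 367376), (87, 367376), (88, 366928),
    (89, 366928), (67, 439364), (19, 362833), (31, 362833), (30, 362833), (64, 363281), (87, 363281), (88, 362833),
    (89, 362833), (67, 439308), (6, 415312), (7, 415312), (17, 379521), (23, 379521), (36, 394473), (43, 344808),
    (60, 344808), (50, 340265), (53, 340265), (17, 408200), (23, 408200), (36, 431384), (50, 344808), (53, 344808),
    (63, 344773), (62, 402117), (45, 344808), (76, 432336), (77, 432336), (37, 368741), (78, 432336), (79, 432336),
    (6, 415312), (7, 415312), (17, 379521), (23, 379521), (19, 399184), (31, 399184), (36, 394473), (30, 431888),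
    (43, 344808), (60, 344808), (50, 340265), (53, 340265), (64, 400080), (87, 400080), (17, 408200), (23, 408200),
    (36, 431384), (50, 344808), (53, 344808), (63, 344773), (62, 402117), (45, 344808), (88, 399184), (89, 399184),
    (67, 443459), (19, 395089), (31, 395089), (30, 427793), (64, 395985), (87, 395985), (88, 395089), (89, 395089),
    (67, 443403), (80, 363169), (80, 362665), (80, 408130), (90, 414360), (41, 277258), (91, 330521), (90, 381600),
    (92, 362833), (41, 280394), (91, 330465), (92, 395089), (80, 408130), (41, 314050), (80, 379402), (41, 317186),
    (91, 334560), (92, 399184), (91, 334616), (92, 366928), (90, 381089), (90, 413849), (80, 379402), (81, 400080),
    (72, 400080), (10, 284300), (35, 269082), (35, 297754), (88, 382048), (93, 366928), (71, 366928), (33, 366928),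
    (88, 381985), (93, 362833), (71, 362833), (33, 362833), (17, 402152), (18, 402152), (63, 379521), (25, 379521),
    (63, 408200), (25, 408200), (11, 415312), (9, 333853), (81, 432336), (72, 432336), (17, 402152), (18, 402152),
    (63, 379521), (25, 379521), (88, 414808), (93, 399184), (63, 408200), (25, 408200), (10, 281227), (11, 415312),
    (9, 333853), (35, 269026), (71, 399184), (33, 399184), (88, 414745), (93, 395089), (35, 297698), (71, 395089),
    (33, 395089), (86, 399016), (86, 367264), (19, 394837), (20, 394837), (88, 394837), (94, 394837), (24, 434968),
    (28, 281227), (38, 402117), (40, 332075), (32, 363106), (34, 398568), (41, 269082), (91, 330059), (95, 399016),
    (96, 443074), (97, 363281), (46, 276810), (54, 283362), (47, 280170), (57, 280170), (91, 443585), (35, 312517),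
    (54, 276810), (59, 276810), (55, 280170), (58, 398365), (8, 439364), (91, 398659), (35, 365892), (97, 367264),
    (34, 309892), (91, 342792), (32, 431132), (38, 377162), (88, 398365), (94, 398365), (38, 340237), (40, 361132),
    (28, 305860), (91, 415368), (35, 284300), (8, 435724), (54, 305475), (59, 305475), (55, 312363), (58, 394837),
    (59, 402117), (49, 276810), (71, 394837), (56, 280170), (48, 394837), (10, 283362), (35, 277258), (10, 283292),
    (35, 362826), (34, 362833), (34, 277258), (40, 393941), (8, 440330), (91, 366914), (91, 371009), (35, 305475),
    (35, 334147), (10, 315604), (46, 279883), (54, 283411), (54, 279883), (59, 279883), (54, 308548), (59, 308548),
    (59, 340741), (49, 279883), (24, 438433), (95, 334616), (97, 334616), (96, 442507), (32, 427604), (34, 334168),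
    (34, 305923), (24, 340832), (96, 434947), (24, 344297), (96, 434380), (19, 329821), (20, 329821), (88, 329821),
    (94, 329821), (28, 283852), (47, 272491), (57, 272491), (55, 272491), (58, 333349), (88, 333349), (94, 333349),
    (28, 308485), (55, 304684), (58, 329821), (71, 329821), (56, 272491), (48, 329821), (32, 366634), (34, 427233),
    (91, 361804), (97, 395929), (35, 394571), (34, 281227), (38, 439042), (10, 315674), (40, 364884), (8, 443970),
    (41, 269082), (1, 342085), (2, 297684), (1, 276565), (2, 305860), (1, 297628), (2, 342029), (2, 277132),
    (1, 305181), (98, 440400), (98, 379458), (73, 393941), (73, 434884), (75, 394837), (75, 435780), (75, 398365),
    (98, 434380), (1, 379528), (2, 332061), (99, 440400), (100, 297635), (101, 297635), (74, 379521), (73, 379521),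
    (102, 379458), (103, 408144), (104, 394837), (105, 394837), (101, 443403), (106, 303340), (102, 393941),
    (106, 394837), (1, 269012), (2, 370757), (1, 342785), (2, 393941), (3, 269075), (3, 342337), (3, 297747),
    (3, 342344), (2, 268956), (1, 370701), (74, 345641), (74, 342120), (107, 268956), (107, 297635), (108, 297635),
    (74, 297635), (73, 297635), (103, 268956), (74, 315618), (102, 297635), (99, 268956), (99, 371268), (102, 342624),
    (73, 342624), (108, 342624), (107, 342624), (109, 439308), (110, 439308), (103, 297628), (102, 268963),
    (74, 283362), (99, 297628), (73, 268963), (74, 268963), (73, 342561), (99, 371212), (102, 342561), (109, 439364),
    (108, 342057), (110, 439364), (107, 342561), (104, 443459), (98, 268963), (98, 297628), (101, 312874),
    (105, 443459), (75, 340321), (100, 393941), (101, 280170), (105, 443403), (100, 397525), (75, 340776),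
    (104, 443403), (100, 309794), (100, 277090), (111, 279274), (98, 440337), (98, 379402), (3, 398869), (111, 414234),
    (110, 382048), (3, 394333), (110, 349729), (100, 443403), (105, 381600), (109, 349729), (3, 381600), (75, 342337),
    (75, 297306), (106, 297306), (106, 443459), (105, 297754), (104, 297754), (101, 434380), (1, 364821),
    (108, 348385), (101, 348385), (99, 439329), (100, 269075), (101, 269075), (100, 443970), (105, 348385),
    (109, 382048), (3, 348385), (104, 348385), (104, 381600), (73, 397469), (101, 443970), (106, 275116),
    (102, 397469), (99, 434443), (2, 404056), (74, 346824), (73, 346824), (102, 346635), (103, 403993), (104, 398365),
    (105, 398365), (106, 268634), (106, 443403), (105, 269082), (104, 269082), (75, 268634), (75, 342792),
    (101, 348896), (1, 393941), (101, 434884), (108, 348952), (2, 371233), (99, 434947), (75, 439308), (102, 439042),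
    (73, 434380), (98, 434947), (106, 398869), (102, 438538)
  ]"

definition graph_codes :: "int list list" where
  "graph_codes = [
    [4443164, 4394801, 7389977, 4403430, 7353123, 8175630, 5590284, 6983180, 6644294, 5935494, 6654545, 5916049, 5677649, 6902161, 6195461, 7161349, 4732138, 4471018, 6468194, 5337506, 4726008, 4467960],
    [4443192, 4404012, 7389971, 4394225, 7353095, 8175630, 5591436, 6988364, 6982726, 5590150, 6637905, 5932689, 5595473, 6984337, 5607749, 6972037, 4732586, 4471146, 6450722, 5348642, 4987128, 4990200],
    [4443186, 4404012, 7389977, 4394214, 7353101, 8175635, 5599500, 6992396, 6904326, 5678342, 5605969, 6964625, 6660689, 5919121, 5677381, 6902405, 4725994, 4467946, 6458978, 5328290, 4990200, 4987128],
    [4443186, 4404017, 7389977, 4394214, 7353101, 8175630, 5599500, 6992396, 6637126, 5933446, 6637905, 5932689, 6971985, 5607825, 6984261, 5595525, 4730090, 4463850, 5410210, 6377058, 4995192, 4994232],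
    [4443186, 4404017, 7389977, 4394214, 7353101, 8175630, 5599500, 6992396, 6637126, 5933446, 6637905, 5932689, 6660689, 5919121, 5939589, 6640197, 4725994, 4467946, 6458978, 5328290, 4995192, 4994232],
    [4443186, 4404017, 7389977, 4394214, 7353101, 8175630, 5599500, 6992396, 6899334, 5671238, 6637905, 5932689, 6660689, 5919121, 5677381, 6902405, 4725994, 4467946, 6458978, 5328290, 4995192, 4994232],
    [5033016, 4404012, 4984595, 4403441, 7353095, 8175630, 5591436, 6988364, 7921734, 7655558, 4921681, 4662929, 4392665, 4393433, 5548803, 6838019, 6593826, 5795362, 5327084, 6456556, 6968432, 5613744],
    [5033016, 4403989, 4984618, 4403441, 7353095, 8175630, 5527308, 6859532, 7921734, 7655558, 4921681, 4662929, 4392665, 4393433, 6726019, 5853763, 5941346, 6640802, 5262956, 6327724, 6924400, 5657776],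
    [5032998, 4404024, 4984601, 4403442, 7353101, 8175623, 6079756, 7129612, 6081030, 7128326, 6500945, 5452177, 6391001, 5392601, 6858307, 5527939, 4857186, 4533922, 5407980, 6375660, 6500720, 5452464],
    [5032998, 4404024, 4984601, 4403442, 7353101, 8175623, 6079756, 7129612, 6081030, 7128326, 6500945, 5452177, 5407961, 6375641, 6858307, 5527939, 4599138, 4791970, 6391020, 5392620, 6500720, 5452464],
    [5032998, 4403993, 4984632, 4403411, 7353132, 8175623, 6079756, 7129612, 7128582, 6080774, 4405585, 4404881, 6391001, 5392601, 7905603, 7623299, 5904994, 6628770, 5407980, 6375660, 4405872, 4404656],
    [5032998, 4403993, 4984632, 4403411, 7353132, 8175623, 6079756, 7129612, 7128582, 6080774, 4405585, 4404881, 5407961, 6375641, 7905603, 7623299, 5646946, 6886818, 6391020, 5392620, 4405872, 4404656],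
    [5032998, 4403993, 4984611, 4394228, 7353099, 8175644, 5578500, 6958852, 7882310, 7637382, 6447321, 5345497, 6891921, 5641809, 7898435, 7621251, 4640874, 4841642, 4404836, 4405668, 4907128, 4575416],
    [5032982, 4404009, 4984595, 4394211, 7353132, 8175644, 6114564, 7245316, 7898694, 7620998, 6459609, 5333209, 4678737, 4954257, 7637635, 7882051, 6304618, 5256106, 4936804, 4696228, 4354424, 4305592],
    [5033002, 4394793, 7390002, 4403413, 7353101, 8175638, 5625092, 7006724, 6844998, 5550470, 7441169, 7489297, 6687065, 5834393, 4860109, 4527309, 4859114, 4528362, 5812898, 6582626, 4672624, 4951216],
    [5032974, 4394765, 7390002, 4403441, 7353126, 8175641, 5625092, 7006724, 7106630, 6074502, 6924433, 5657681, 4597977, 4789465, 4860109, 4527309, 5375850, 6359978, 7901986, 7627554, 4410992, 4427184],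
    [4443192, 4403981, 7390002, 4993223, 7353126, 8175641, 5592204, 6989900, 7115846, 6056070, 4827473, 4609681, 4590809, 4787417, 4525261, 4852941, 7496482, 7443234, 7885602, 7643938, 4429424, 4417968],
    [4443192, 4403981, 7390002, 4993223, 7353126, 8175641, 5592204, 6989900, 7103558, 6068358, 4827473, 4609681, 4525273, 4852953, 4590797, 4787405, 7508770, 7430946, 7885602, 7643938, 4417136, 4430256],
    [4443164, 4404012, 7389977, 4993254, 7353123, 8175635, 5461260, 6531596, 5859846, 6722822, 7119441, 6050193, 4590809, 4787417, 4918349, 4656269, 5416290, 6380194, 5805410, 6580898, 6590960, 5792496],
    [4443164, 4404017, 7389977, 4993254, 7353123, 8175630, 5461260, 6531596, 6050374, 7119238, 7119441, 6050193, 4590809, 4787417, 4918349, 4656269, 5416290, 6380194, 5805410, 6580898, 6400432, 5396080],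
    [4443164, 4404009, 7390002, 4993251, 7353101, 8175638, 5330316, 6466124, 5543494, 6842758, 7184913, 6181137, 6949209, 5572249, 4787405, 4590797, 5395810, 6400674, 5805410, 6580898, 4679856, 4953200],
    [4443164, 4404009, 7390002, 4993251, 7353101, 8175638, 5330316, 6466124, 5805638, 6580614, 7233809, 6132241, 5834073, 6687385, 4525261, 4852941, 6445730, 5350754, 5793122, 6593186, 4696176, 4936880],
    [4443164, 4404009, 7390002, 4993251, 7353101, 8175638, 5330316, 6466124, 5543494, 6842758, 7233809, 6132241, 6621849, 5899609, 4787405, 4590797, 5395810, 6400674, 5805410, 6580898, 4958320, 4674736],
    [5033012, 4394808, 4403403, 4394183, 7353130, 8175637, 7689480, 8038920, 4676674, 4959362, 5542489, 6840729, 6857109, 5526101, 4434115, 4412611, 6840934, 5542310, 5902116, 6623012, 6578808, 5804472],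
    [5033016, 4394773, 4403434, 4394214, 7353095, 8175641, 5594376, 6991368, 5721154, 7048322, 6840921, 5542297, 6578773, 5804437, 6465285, 5331717, 5804646, 6578598, 4921570, 4662498, 6857144, 5526136],
    [5033012, 4394777, 4403434, 4394214, 7353099, 8175637, 5594376, 6991368, 5724226, 7054466, 6578777, 5804441, 6840917, 5542293, 6459141, 5328645, 5804646, 6578598, 4924642, 4659426, 6595000, 5788280],
    [5033012, 4394777, 4403434, 4394214, 7353099, 8175637, 5594376, 6991368, 5724226, 7054466, 5526105, 6857113, 6594965, 5788245, 5410565, 6377221, 6857318, 5525926, 4920546, 4663522, 6840952, 5542328],
    [5033012, 4394777, 4403434, 4394214, 7353099, 8175637, 5594376, 6991368, 6788226, 5990466, 5792089, 6591129, 5529941, 6853269, 5410565, 6377221, 6857318, 5525926, 4921570, 4662498, 6840952, 5542328],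
    [5033010, 4394796, 4403417, 4394214, 7353101, 8175635, 5594376, 6991368, 5598722, 6987010, 6595161, 5788057, 6980181, 5587349, 5474693, 6506053, 6857318, 5525926, 4863202, 4536546, 6574456, 5808824],
    [5033012, 4394777, 4403441, 4993254, 7353099, 8175630, 6059272, 7125512, 7655946, 7921930, 4921553, 4662481, 4392405, 4393685, 4597573, 4791173, 5409126, 6375078, 7391530, 7390762, 6924400, 5657776],
    [5033012, 4394777, 4403441, 4993254, 7353099, 8175630, 6059272, 7125512, 7655946, 7921930, 4663505, 4920529, 4393429, 4392661, 4855621, 4533125, 5409126, 6375078, 7390506, 7391786, 6924400, 5657776],
    [5033004, 4394804, 4403442, 4993235, 7353099, 8175629, 6123656, 7254088, 7131210, 6086794, 5446225, 6497681, 6456661, 5327509, 5548805, 6838021, 4738406, 4492966, 5392746, 6391466, 6493808, 5450160],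
    [5033002, 4394804, 4403442, 4993237, 7353101, 8175627, 6116616, 7252488, 6080010, 7129354, 5450129, 6493777, 6457941, 5326229, 6599237, 5796229, 4745446, 4494566, 6440554, 5343658, 6493552, 5450416],
    [5032986, 4394777, 4403441, 4993254, 7353125, 8175630, 6059272, 7125512, 7655946, 7921930, 4921553, 4662481, 4392405, 4393685, 6660677, 5919109, 6440550, 5343654, 7391530, 7390762, 4861296, 4529840],
    [5032986, 4394777, 4403441, 4993254, 7353125, 8175630, 6059272, 7125512, 7655946, 7921930, 4663505, 4920529, 4393429, 4392661, 6918725, 5661061, 6440550, 5343654, 7390506, 7391786, 4861296, 4529840],
    [5032988, 4404017, 7389977, 4403430, 7353123, 8175630, 6051084, 7121420, 5661254, 6918534, 6529617, 5460369, 4787417, 4590809, 5114957, 5049485, 5412194, 6384290, 5809506, 6576802, 6396336, 5400176],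
    [5032988, 4404009, 7390002, 4403427, 7353101, 8175638, 5526924, 6859340, 5527110, 6859142, 7053585, 5722641, 6883929, 5637529, 4590797, 4787405, 5412194, 6384290, 5789026, 6597282, 4696240, 4936816],
    [5032988, 4404009, 7390002, 4403427, 7353101, 8175638, 5526924, 6859340, 5527110, 6859142, 7053585, 5722641, 5637465, 6883993, 4525261, 4852941, 5399906, 6396578, 6838946, 5547362, 4958320, 4674736],
    [5032988, 4404009, 7390002, 4403427, 7353101, 8175638, 5526924, 6859340, 5527110, 6859142, 7053585, 5722641, 6621849, 5899609, 4590797, 4787405, 5412194, 6384290, 5789026, 6597282, 4958320, 4674736],
    [5032988, 4404009, 7390002, 4403427, 7353101, 8175638, 5526924, 6859340, 5527110, 6859142, 6791697, 5984529, 6883737, 5637721, 4590797, 4787405, 5412194, 6384290, 5789026, 6597282, 4958320, 4674736],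
    [5032974, 4403981, 7390002, 4403441, 7353126, 8175641, 4543884, 4893260, 7115846, 6056070, 5875793, 6706321, 4590809, 4787417, 4525261, 4852941, 7496482, 7443234, 7885602, 7643938, 4429424, 4417968],
    [5032974, 4403981, 7390002, 4403441, 7353126, 8175641, 4543884, 4893260, 7103558, 6068358, 5875793, 6706321, 4525273, 4852953, 4590797, 4787405, 7508770, 7430946, 7885602, 7643938, 4417136, 4430256],
    [5033016, 4404020, 4394187, 4403399, 7353126, 8175641, 7696648, 8040968, 4683842, 4961410, 5524053, 6849941, 5540441, 6833561, 4433091, 4413635, 6850150, 5523878, 5905192, 6629160, 6571636, 5802420],
    [5033016, 4403989, 4394218, 4403430, 7353095, 8175641, 5600520, 6994440, 5730370, 7057538, 6572629, 5801365, 5539417, 6834585, 6529219, 5460163, 5801574, 6572454, 4857640, 4534056, 6850996, 5523060],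
    [5033004, 4403993, 4394226, 4403411, 7353126, 8175629, 5723272, 7055432, 5727298, 7051394, 4479573, 4760981, 5523033, 6850969, 7446851, 7492227, 6834790, 5539238, 6956840, 5577512, 4757940, 4482676],
    [5033004, 4403993, 4394226, 4403411, 7353126, 8175629, 5723272, 7055432, 6771778, 6006914, 4479317, 4761237, 6850137, 5523865, 7512451, 7426627, 6588774, 5785254, 5843752, 6690600, 4478580, 4762036],
    [5033004, 4403993, 4394226, 4403411, 7353126, 8175629, 5723272, 7055432, 6771778, 6006914, 4479317, 4761237, 5802393, 6571609, 7447107, 7491971, 6834534, 5539494, 6956840, 5577512, 4478580, 4762036],
    [5032988, 4404009, 4394201, 4403427, 7353126, 8175638, 5453192, 6502984, 5453378, 6502786, 7127317, 6078997, 5539417, 6834585, 7446851, 7492227, 6572646, 5801382, 4791912, 4599208, 5032052, 5031092],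
    [5032988, 4404009, 4394201, 4403427, 7353126, 8175638, 5453192, 6502984, 5453378, 6502786, 7127317, 6078997, 6572633, 5801369, 7508291, 7430787, 5539430, 6834598, 4791912, 4599208, 5032052, 5031092],
    [5033016, 4403989, 4394218, 4403430, 7353095, 8175641, 5600520, 6994440, 5730370, 7057538, 6572629, 5801365, 6834777, 5539225, 6462217, 5334793, 5801574, 6572454, 4924642, 4659426, 6850996, 5523060],
    [5033004, 4403993, 4394226, 4403411, 7353126, 8175629, 5723272, 7055432, 5727298, 7051394, 4483413, 4757141, 5523033, 6850969, 7508745, 7430921, 5539430, 6834598, 6891106, 5642658, 4757940, 4482676],
    [5033004, 4403993, 4394226, 4403411, 7353126, 8175629, 5723272, 7055432, 6771778, 6006914, 4479317, 4761237, 6850137, 5523865, 7447305, 7492361, 6833766, 5540262, 5908898, 6624866, 4478580, 4762036],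
    [5033004, 4403993, 4394226, 4403411, 7353126, 8175629, 5723272, 7055432, 6771778, 6006914, 4479317, 4761237, 5802393, 6571609, 7512841, 7426825, 6588006, 5786022, 6891106, 5642658, 4478580, 4762036],
    [5033004, 4403993, 4394226, 4403411, 7353126, 8175629, 5723272, 7055432, 6771778, 6006914, 4483669, 4756885, 5802393, 6571609, 7512841, 7426825, 6588006, 5786022, 6886754, 5647010, 4478580, 4762036],
    [5032982, 4404009, 4394195, 4403427, 7353132, 8175644, 5453192, 6502984, 5453378, 6502786, 7127125, 6078613, 5539417, 6834585, 7446857, 7492233, 6572646, 5801382, 4791906, 4599202, 5032244, 5031476],
    [5032982, 4404009, 4394195, 4403427, 7353132, 8175644, 5453192, 6502984, 5453378, 6502786, 7127125, 6078613, 6572633, 5801369, 7508297, 7430793, 5539430, 6834598, 4791906, 4599202, 5032244, 5031476],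
    [5033016, 4403996, 4403427, 4984049, 7353102, 8175623, 5321612, 6435660, 6935050, 5693706, 4692049, 4940945, 6440277, 5343893, 5387077, 6370181, 6065250, 7097506, 5408362, 6375850, 7097456, 6065328],
    [5033016, 4403989, 4403434, 4984049, 7353095, 8175630, 5337868, 6468364, 6722122, 5857674, 4921553, 4662481, 6456661, 5327509, 5419781, 6386437, 7113826, 6048930, 6457706, 5326506, 7097456, 6065328],
    [5033016, 4403989, 4403434, 4984049, 7353095, 8175630, 5337868, 6468364, 5874250, 6705546, 4921553, 4662481, 6374997, 5409173, 5419781, 6386437, 7113826, 6048930, 6376042, 5408170, 7097456, 6065328],
    [5033012, 4404012, 4403441, 4984019, 7353099, 8175630, 5591436, 6988364, 7655946, 7921930, 4921553, 4662481, 4392405, 4393685, 4859717, 4529029, 5807650, 6581538, 7391530, 7390762, 6645872, 5936304],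
    [5033012, 4403993, 4403441, 4984038, 7353099, 8175630, 5527308, 6859532, 7918090, 7659786, 4659409, 4924625, 4392405, 4393685, 4860741, 4528005, 5941346, 6640802, 7390762, 7391530, 6924400, 5657776],
    [5033012, 4403993, 4403441, 4984038, 7353099, 8175630, 5527308, 6859532, 7918090, 7659786, 4925649, 4658385, 4393429, 4392661, 4593477, 4795269, 5675106, 6907042, 7391786, 7390506, 6923376, 5658800],
    [5033002, 4403989, 4403448, 4984035, 7353095, 8175644, 5337868, 6468364, 7901770, 7627146, 6691025, 5842129, 6456661, 5327509, 6402821, 5403397, 5131362, 5082274, 5391978, 6392234, 5147760, 5065904],
    [5032986, 4403993, 4403441, 4984038, 7353125, 8175630, 5527308, 6859532, 7655946, 7921930, 4921553, 4662481, 4392405, 4393685, 6922821, 5656965, 6711394, 5870754, 7391530, 7390762, 4599408, 4791728],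
    [4443164, 4404017, 7389994, 4993237, 7353123, 8175630, 5461260, 6531596, 5543494, 6842758, 7102865, 6066769, 5114073, 5047513, 4918349, 4656269, 5417570, 6378914, 5805410, 6580898, 6400624, 5395888],
    [5032988, 4404017, 7389994, 4403413, 7353123, 8175630, 6051084, 7121420, 6597190, 5789062, 5464721, 6525265, 4917465, 4654297, 5114957, 5049485, 5412194, 6384290, 6859106, 5527202, 6395248, 5401264],
    [5033012, 4403993, 4394218, 4403430, 7353099, 8175637, 5600520, 6994440, 5986434, 6792258, 6589013, 5784981, 6587737, 5786265, 5480643, 6508739, 6851174, 5522854, 4863784, 4537128, 6571380, 5802676],
    [5033012, 4403993, 4394218, 4403430, 7353099, 8175637, 5600520, 6994440, 6788226, 5990466, 5523797, 6850197, 5785945, 6588057, 5419785, 6386441, 6851174, 5522854, 4924642, 4659426, 6834804, 5539252],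
    [4443164, 4404012, 7389994, 4993237, 7353123, 8175635, 5461260, 6531596, 5402118, 6397190, 7119441, 6050193, 5048537, 5113049, 4918349, 4656269, 6461026, 5335458, 5805410, 6580898, 6590960, 5792496],
    [4443164, 4404017, 7389994, 4993237, 7353123, 8175630, 5461260, 6531596, 5543494, 6842758, 7119441, 6050193, 5048537, 5113049, 4918349, 4656269, 6461026, 5335458, 5805410, 6580898, 6449584, 5346928],
    [4443164, 4404017, 7389994, 4993237, 7353123, 8175630, 5461260, 6531596, 5544582, 6841670, 7119441, 6050193, 5048537, 5113049, 4918349, 4656269, 6461026, 5335458, 5805410, 6580898, 6448496, 5348016],
    [5032988, 4404017, 7389994, 4403413, 7353123, 8175630, 6051084, 7121420, 5793350, 6592902, 6529617, 5460369, 4655321, 4916441, 5114957, 5049485, 5412194, 6384290, 6854242, 5532066, 6396336, 5400176],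
    [5032988, 4404017, 7389994, 4403413, 7353123, 8175630, 6051084, 7121420, 5794438, 6591814, 6529617, 5460369, 4655321, 4916441, 5114957, 5049485, 5412194, 6384290, 6854242, 5532066, 6395248, 5401264],
    [5033012, 4404024, 4394187, 4403399, 7353130, 8175637, 7696648, 8040968, 4680770, 4955266, 5540437, 6833557, 5524057, 6849945, 4430019, 4416707, 6850150, 5523878, 5911336, 6632232, 6588020, 5786036],
    [5033012, 4403993, 4394218, 4403430, 7353099, 8175637, 5600520, 6994440, 5727298, 7051394, 6589013, 5784981, 5523033, 6850969, 5476547, 6512835, 6851174, 5522854, 4863784, 4537128, 6834612, 5539444],
    [5033012, 4403993, 4394218, 4403430, 7353099, 8175637, 5600520, 6994440, 5727298, 7051394, 6834581, 5539413, 6572633, 5801369, 6525123, 5464259, 5801574, 6572454, 4864808, 4536104, 6589044, 5785012],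
    [5033012, 4403993, 4394218, 4403430, 7353099, 8175637, 5600520, 6994440, 5727298, 7051394, 6834773, 5539221, 6572633, 5801369, 6468361, 5337865, 5801574, 6572454, 4921570, 4662498, 6588852, 5785204],
    [5033012, 4403993, 4394218, 4403430, 7353099, 8175637, 5600520, 6994440, 5727298, 7051394, 6588821, 5785173, 5523033, 6850969, 5419785, 6386441, 6851174, 5522854, 4920546, 4663522, 6834804, 5539252],
    [4443162, 4403993, 7390002, 4993253, 7353126, 8175629, 4404620, 4405836, 7128134, 6080646, 6080593, 7128209, 4525273, 4852953, 4787405, 4590797, 7492386, 7447330, 7901986, 7627554, 4404848, 4405680],
    [5033004, 4403993, 7390002, 4403411, 7353126, 8175629, 6079628, 7129164, 7128134, 6080646, 4405585, 4404881, 4525273, 4852953, 4787405, 4590797, 7492386, 7447330, 7901986, 7627554, 4404848, 4405680],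
    [5032982, 4404009, 4394232, 4403427, 7353095, 8175644, 5453192, 6502984, 5453378, 6502786, 7127125, 6078613, 7618777, 7897305, 7442627, 7495875, 4738854, 4493094, 4857640, 4534056, 5032244, 5031476],
    [5032988, 4404009, 4394226, 4403427, 7353101, 8175638, 5453192, 6502984, 5453378, 6502786, 7127317, 6078997, 7619353, 7897881, 7443209, 7496457, 4738278, 4492518, 4857058, 4533474, 5032052, 5031092]
  ]"

text \<open>
  For each representative a position with a non-zero entry of its matrix \<open>E\<close>, and for each leaf of the
  search the index of a graph and an isomorphism.
\<close>

definition rep_data :: "((nat \<times> nat) \<times> (nat \<times> nat list) list) list" where
  "rep_data = [
    ((0, 0), []), ((0, 2), []), ((2, 1), []), ((0, 2), []), ((0, 0), []), ((0, 1), []), ((0, 2), []), ((2, 3), []),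
    ((0, 1), []), ((0, 3), []), ((2, 1), []), ((1, 3), []), ((0, 0), []), ((0, 0), []), ((0, 0), []), ((0, 3), []),
    ((0, 0), []), ((1, 1), []), ((0, 1), []), ((0, 2), []), ((0, 2), []), ((0, 1), []), ((0, 1), []), ((0, 1), []),
    ((0, 1), []), ((0, 1), []), ((1, 0), []), ((1, 1), []), ((2, 0), []), ((1, 2), []), ((0, 2), []), ((0, 2), []),
    ((0, 0), []), ((2, 2), []), ((1, 2), []), ((1, 0), []), ((0, 0), []), ((0, 0), []), ((1, 0), []), ((1, 0), []),
    ((1, 2), []), ((0, 0), []), ((1, 0), []), ((1, 0), []), ((1, 0), []), ((1, 0), []), ((2, 0), []), ((2, 1), []),
    ((2, 0), []), ((3, 1), []), ((1, 0), []), ((1, 0), []), ((2, 1), []), ((1, 3), []), ((3, 2), []), ((2, 0), []),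
    ((2, 5), []), ((2, 0), []), ((2, 0), []), ((3, 0), []), ((1, 0), []), ((1, 0), []), ((4, 1), []), ((0, 1), []),
    ((0, 0), []), ((1, 0), []), ((1, 0), []), ((4, 0), []), ((0, 0), []), ((1, 0), []), ((4, 0), []), ((0, 2), []),
    ((0, 2), []), ((1, 0), []), ((1, 0), []), ((1, 0), []), ((0, 0), []), ((0, 0), []), ((0, 2), []), ((0, 2), []),
    ((0, 0), []), ((1, 2), []), ((0, 0), []), ((0, 2), []), ((0, 5), []), ((0, 5), []), ((1, 2), []), ((0, 2), []),
    ((0, 2), []), ((0, 2), []), ((0, 0), []), ((1, 0), []), ((2, 0), []), ((1, 2), []), ((0, 2), []), ((1, 0), []),
    ((1, 2), []), ((2, 0), []),
    ((0, 2), [(0, [0, 1, 2, 3, 4, 5, 6, 7, 8, 9, 10, 11, 12, 13, 14, 15, 16, 17, 18, 19, 20, 21])]),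
    ((0, 2), [(1, [0, 1, 2, 3, 4, 5, 6, 7, 8, 9, 10, 11, 12, 13, 14, 15, 16, 17, 18, 19, 20, 21]), (2, [0, 1, 2, 3, 4, 5, 6, 7, 8, 9, 10, 11, 12, 13, 14, 15, 16, 17, 18, 19, 20, 21]), (3, [0, 1, 2, 3, 4, 5, 6, 7, 8, 9, 10, 11, 12, 13, 14, 15, 16, 17, 18, 19, 20, 21]), (4, [0, 1, 2, 3, 4, 5, 6, 7, 8, 9, 10, 11, 12, 13, 14, 15, 16, 17, 18, 19, 20, 21]), (5, [0, 1, 2, 3, 4, 5, 6, 7, 8, 9, 10, 11, 12, 13, 14, 15, 16, 17, 18, 19, 20, 21])]),
    ((0, 2), [(6, [0, 1, 2, 3, 4, 5, 6, 7, 8, 9, 10, 11, 12, 13, 14, 15, 16, 17, 18, 19, 20, 21]), (7, [0, 1, 2, 3, 4, 5, 6, 7, 8, 9, 10, 11, 12, 13, 14, 15, 16, 17, 18, 19, 20, 21]), (8, [0, 1, 2, 3, 4, 5, 6, 7, 8, 9, 10, 11, 12, 13, 14, 15, 16, 17, 18, 19, 20, 21]), (9, [0, 1, 2, 3, 4, 5, 6, 7, 8, 9, 10, 11, 12, 13, 14, 15, 16, 17, 18, 19, 20, 21]), (10, [0, 1, 2, 3, 4, 5, 6, 7, 8, 9, 10, 11, 12, 13, 14, 15, 16, 17, 18, 19, 20, 21]), (11, [0, 1, 2, 3, 4, 5, 6, 7, 8, 9, 10, 11, 12, 13, 14, 15, 16, 17, 18, 19, 20, 21])]),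
    ((1, 3), [(12, [0, 1, 2, 3, 4, 5, 6, 7, 8, 9, 10, 11, 12, 13, 14, 15, 16, 17, 18, 19, 20, 21]), (13, [0, 1, 2, 3, 4, 5, 6, 7, 8, 9, 10, 11, 12, 13, 14, 15, 16, 17, 18, 19, 20, 21])]),
    ((1, 2), [(14, [0, 1, 2, 3, 4, 5, 6, 7, 8, 9, 10, 11, 12, 13, 14, 15, 16, 17, 18, 19, 20, 21]), (15, [0, 1, 2, 3, 4, 5, 6, 7, 8, 9, 10, 11, 12, 13, 14, 15, 16, 17, 18, 19, 20, 21])]),
    ((0, 5), [(16, [0, 1, 2, 3, 4, 5, 6, 7, 8, 9, 10, 11, 12, 13, 14, 15, 16, 17, 18, 19, 20, 21]), (16, [3, 5, 4, 0, 2, 1, 10, 11, 20, 21, 6, 7, 15, 14, 13, 12, 18, 19, 17, 16, 8, 9]), (17, [0, 1, 2, 3, 4, 5, 6, 7, 8, 9, 10, 11, 12, 13, 14, 15, 16, 17, 18, 19, 20, 21]), (17, [3, 5, 4, 0, 2, 1, 10, 11, 20, 21, 6, 7, 15, 14, 13, 12, 18, 19, 17, 16, 8, 9]), (68, [0, 1, 2, 3, 4, 5, 6, 7, 8, 9, 10, 11, 12, 13, 14, 15, 16, 17, 18, 19, 20, 21]), (18, [0, 1, 2, 3, 4, 5, 6, 7, 8, 9, 10, 11, 12, 13, 14, 15, 16, 17, 18, 19, 20, 21]), (69, [0, 1, 2, 3, 4, 5, 6, 7, 8, 9, 10, 11, 12, 13, 14, 15, 16, 17, 18, 19, 20, 21]),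 (64, [0, 1, 2, 3, 4, 5, 6, 7, 8, 9, 10, 11, 12, 13, 14, 15, 16, 17, 18, 19, 20, 21]), (70, [0, 1, 2, 3, 4, 5, 6, 7, 8, 9, 10, 11, 12, 13, 14, 15, 16, 17, 18, 19, 20, 21]), (19, [0, 1, 2, 3, 4, 5, 6, 7, 8, 9, 10, 11, 12, 13, 14, 15, 16, 17, 18, 19, 20, 21]), (20, [0, 1, 2, 3, 4, 5, 6, 7, 8, 9, 10, 11, 12, 13, 14, 15, 16, 17, 18, 19, 20, 21]), (21, [0, 1, 2, 3, 4, 5, 6, 7, 8, 9, 10, 11, 12, 13, 14, 15, 16, 17, 18, 19, 20, 21]), (22, [0, 1, 2, 3, 4, 5, 6, 7, 8, 9, 10, 11, 12, 13, 14, 15, 16, 17, 18, 19, 20, 21]), (18, [3, 5, 4, 0, 2, 1, 10, 11, 21, 20, 6, 7, 15, 14, 13, 12, 18, 19, 16, 17, 9, 8]), (19, [3, 5, 4, 0, 2, 1, 10, 11, 21, 20, 6, 7, 15, 14, 13, 12, 18, 19, 16, 17, 9, 8]), (20, [3, 5, 4, 0, 2, 1, 10, 11, 21, 20, 6, 7, 15, 14, 13, 12, 18, 19, 16, 17, 9, 8]), (22, [3, 5, 4, 0, 2, 1, 10, 11, 20, 21, 6, 7, 15, 14, 12, 13, 19, 18, 16, 17, 9, 8]), (21, [3, 5, 4, 0, 2, 1, 10, 11, 20, 21, 6, 7, 15, 14, 12, 13, 19, 18, 16, 17, 9, 8]), (78, [0, 1, 2, 3, 4, 5, 6, 7, 8,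 9, 10, 11, 12, 13, 14, 15, 16, 17, 18, 19, 20, 21]), (78, [0, 1, 2, 3, 4, 5, 6, 7, 8, 9, 10, 11, 12, 13, 15, 14, 16, 17, 18, 19, 20, 21])]),
    ((4, 0), [(23, [0, 1, 2, 3, 4, 5, 6, 7, 8, 9, 10, 11, 12, 13, 14, 15, 16, 17, 18, 19, 20, 21])]),
    ((4, 0), [(24, [0, 1, 2, 3, 4, 5, 6, 7, 8, 9, 10, 11, 12, 13, 14, 15, 16, 17, 18, 19, 20, 21]), (25, [0, 1, 2, 3, 4, 5, 6, 7, 8, 9, 10, 11, 12, 13, 14, 15, 16, 17, 18, 19, 20, 21]), (26, [0, 1, 2, 3, 4, 5, 6, 7, 8, 9, 10, 11, 12, 13, 14, 15, 16, 17, 18, 19, 20, 21]), (27, [0, 1, 2, 3, 4, 5, 6, 7, 8, 9, 10, 11, 12, 13, 14, 15, 16, 17, 18, 19, 20, 21]), (28, [0, 1, 2, 3, 4, 5, 6, 7, 8, 9, 10, 11, 12, 13, 14, 15, 16, 17, 18, 19, 20, 21])]),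
    ((1, 0), [(29, [0, 1, 2, 3, 4, 5, 6, 7, 8, 9, 10, 11, 12, 13, 14, 15, 16, 17, 18, 19, 20, 21]), (30, [0, 1, 2, 3, 4, 5, 6, 7, 8, 9, 10, 11, 12, 13, 14, 15, 16, 17, 18, 19, 20, 21]), (31, [0, 1, 2, 3, 4, 5, 6, 7, 8, 9, 10, 11, 12, 13, 14, 15, 16, 17, 18, 19, 20, 21]), (32, [0, 1, 2, 3, 4, 5, 6, 7, 8, 9, 10, 11, 12, 13, 14, 15, 16, 17, 18, 19, 20, 21]), (33, [0, 1, 2, 3, 4, 5, 6, 7, 8, 9, 10, 11, 12, 13, 14, 15, 16, 17, 18, 19, 20, 21]), (34, [0, 1, 2, 3, 4, 5, 6, 7, 8, 9, 10, 11, 12, 13, 14, 15, 16, 17, 18, 19, 20, 21])]),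
    ((0, 5), [(79, [0, 1, 2, 3, 4, 5, 6, 7, 8, 9, 10, 11, 12, 13, 14, 15, 16, 17, 18, 19, 20, 21]), (79, [0, 1, 2, 3, 4, 5, 6, 7, 8, 9, 10, 11, 12, 13, 15, 14, 16, 17, 18, 19, 20, 21]), (71, [0, 1, 2, 3, 4, 5, 6, 7, 8, 9, 10, 11, 12, 13, 14, 15, 16, 17, 18, 19, 20, 21]), (65, [0, 1, 2, 3, 4, 5, 6, 7, 8, 9, 10, 11, 12, 13, 14, 15, 16, 17, 18, 19, 20, 21]), (72, [0, 1, 2, 3, 4, 5, 6, 7, 8, 9, 10, 11, 12, 13, 14, 15, 16, 17, 18, 19, 20, 21]), (35, [0, 1, 2, 3, 4, 5, 6, 7, 8, 9, 10, 11, 12, 13, 14, 15, 16, 17, 18, 19, 20, 21]), (36, [0, 1, 2, 3, 4, 5, 6, 7, 8, 9, 10, 11, 12, 13, 14, 15, 16, 17, 18, 19, 20, 21]), (37, [0, 1, 2, 3, 4, 5, 6, 7, 8, 9, 10, 11, 12, 13, 14, 15, 16, 17, 18, 19, 20, 21]), (38, [0, 1, 2, 3, 4, 5, 6, 7, 8, 9, 10, 11, 12, 13, 14, 15, 16, 17, 18, 19, 20, 21]), (39, [0, 1, 2, 3, 4, 5, 6, 7, 8, 9, 10, 11, 12, 13, 14, 15, 16, 17, 18, 19, 20, 21]), (35, [3, 5, 4, 0, 2, 1, 10, 11, 21, 20, 6, 7, 15, 14, 13, 12, 18, 19, 16, 17, 9, 8]), (39, [3, 5, 4, 0, 2, 1,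 10, 11, 21, 20, 6, 7, 15, 14, 13, 12, 18, 19, 16, 17, 9, 8]), (36, [3, 5, 4, 0, 2, 1, 10, 11, 20, 21, 6, 7, 15, 14, 13, 12, 18, 19, 17, 16, 9, 8]), (38, [3, 5, 4, 0, 2, 1, 10, 11, 20, 21, 6, 7, 15, 14, 13, 12, 18, 19, 17, 16, 9, 8]), (37, [3, 5, 4, 0, 2, 1, 10, 11, 20, 21, 6, 7, 15, 14, 13, 12, 18, 19, 17, 16, 9, 8]), (40, [0, 1, 2, 3, 4, 5, 6, 7, 8, 9, 10, 11, 12, 13, 14, 15, 16, 17, 18, 19, 20, 21]), (40, [3, 5, 4, 0, 2, 1, 10, 11, 20, 21, 6, 7, 15, 14, 13, 12, 18, 19, 17, 16, 8, 9]), (41, [0, 1, 2, 3, 4, 5, 6, 7, 8, 9, 10, 11, 12, 13, 14, 15, 16, 17, 18, 19, 20, 21]), (41, [3, 5, 4, 0, 2, 1, 10, 11, 20, 21, 6, 7, 15, 14, 13, 12, 18, 19, 17, 16, 8, 9])]),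
    ((1, 2), []),
    ((4, 0), [(42, [0, 1, 2, 3, 4, 5, 6, 7, 8, 9, 10, 11, 12, 13, 14, 15, 16, 17, 18, 19, 20, 21]), (43, [0, 1, 2, 3, 4, 5, 6, 7, 8, 9, 10, 11, 12, 13, 14, 15, 16, 17, 18, 19, 20, 21]), (73, [0, 1, 2, 3, 4, 5, 6, 7, 8, 9, 10, 11, 12, 13, 14, 15, 16, 17, 18, 19, 20, 21]), (74, [0, 1, 2, 3, 4, 5, 6, 7, 8, 9, 10, 11, 12, 13, 14, 15, 16, 17, 18, 19, 20, 21]), (75, [0, 1, 2, 3, 4, 5, 6, 7, 8, 9, 10, 11, 12, 13, 14, 15, 16, 17, 18, 19, 20, 21]), (66, [0, 1, 2, 3, 4, 5, 6, 7, 8, 9, 10, 11, 12, 13, 14, 15, 16, 17, 18, 19, 20, 21]), (44, [0, 1, 2, 3, 4, 5, 6, 7, 8, 9, 10, 11, 12, 13, 14, 15, 16, 17, 18, 19, 20, 21]), (45, [0, 1, 2, 3, 4, 5, 6, 7, 8, 9, 10, 11, 12, 13, 14, 15, 16, 17, 18, 19, 20, 21]), (46, [0, 1, 2, 3, 4, 5, 6, 7, 8, 9, 10, 11, 12, 13, 14, 15, 16, 17, 18, 19, 20, 21]), (47, [0, 1, 2, 3, 4, 5, 6, 7, 8, 9, 10, 11, 12, 13, 14, 15, 16, 17, 18, 19, 20, 21]), (48, [0, 1, 2, 3, 4, 5, 6, 7, 8, 9, 10, 11, 12, 13, 14, 15, 16, 17, 18, 19, 20, 21]), (47, [5, 3,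 4, 1, 2, 0, 8, 9, 6, 7, 20, 21, 17, 16, 18, 19, 13, 12, 15, 14, 10, 11]), (48, [5, 3, 4, 1, 2, 0, 8, 9, 6, 7, 20, 21, 17, 16, 18, 19, 13, 12, 15, 14, 10, 11]), (44, [5, 3, 4, 1, 2, 0, 8, 9, 6, 7, 20, 21, 17, 16, 18, 19, 13, 12, 14, 15, 10, 11]), (46, [5, 3, 4, 1, 2, 0, 8, 9, 6, 7, 20, 21, 16, 17, 18, 19, 12, 13, 14, 15, 11, 10]), (45, [5, 3, 4, 1, 2, 0, 8, 9, 6, 7, 20, 21, 16, 17, 18, 19, 12, 13, 14, 15, 11, 10]), (42, [5, 3, 4, 1, 2, 0, 8, 9, 6, 7, 21, 20, 17, 16, 18, 19, 13, 12, 14, 15, 11, 10]), (43, [5, 3, 4, 1, 2, 0, 8, 9, 6, 7, 21, 20, 17, 16, 18, 19, 13, 12, 14, 15, 10, 11]), (80, [0, 1, 2, 3, 4, 5, 6, 7, 8, 9, 10, 11, 12, 13, 14, 15, 16, 17, 18, 19, 20, 21])]),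
    ((4, 0), [(49, [0, 1, 2, 3, 4, 5, 6, 7, 8, 9, 10, 11, 12, 13, 14, 15, 16, 17, 18, 19, 20, 21]), (76, [0, 1, 2, 3, 4, 5, 6, 7, 8, 9, 10, 11, 12, 13, 14, 15, 16, 17, 18, 19, 20, 21]), (77, [0, 1, 2, 3, 4, 5, 6, 7, 8, 9, 10, 11, 12, 13, 14, 15, 16, 17, 18, 19, 20, 21]), (67, [0, 1, 2, 3, 4, 5, 6, 7, 8, 9, 10, 11, 12, 13, 14, 15, 16, 17, 18, 19, 20, 21]), (50, [0, 1, 2, 3, 4, 5, 6, 7, 8, 9, 10, 11, 12, 13, 14, 15, 16, 17, 18, 19, 20, 21]), (51, [0, 1, 2, 3, 4, 5, 6, 7, 8, 9, 10, 11, 12, 13, 14, 15, 16, 17, 18, 19, 20, 21]), (52, [0, 1, 2, 3, 4, 5, 6, 7, 8, 9, 10, 11, 12, 13, 14, 15, 16, 17, 18, 19, 20, 21]), (53, [0, 1, 2, 3, 4, 5, 6, 7, 8, 9, 10, 11, 12, 13, 14, 15, 16, 17, 18, 19, 20, 21]), (81, [0, 1, 2, 3, 4, 5, 6, 7, 8, 9, 10, 11, 12, 13, 14, 15, 16, 17, 18, 19, 20, 21]), (53, [5, 3, 4, 1, 2, 0, 8, 9, 6, 7, 20, 21, 16, 17, 18, 19, 13, 12, 14, 15, 11, 10]), (51, [5, 3, 4, 1, 2, 0, 8, 9, 6, 7, 20, 21, 16, 17, 18, 19, 13, 12, 14, 15, 11, 10]), (50, [5, 3, 4, 1, 2, 0,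 8, 9, 6, 7, 20, 21, 17, 16, 18, 19, 13, 12, 14, 15, 10, 11]), (52, [5, 3, 4, 1, 2, 0, 8, 9, 6, 7, 20, 21, 16, 17, 18, 19, 13, 12, 14, 15, 11, 10]), (49, [5, 3, 4, 1, 2, 0, 8, 9, 6, 7, 21, 20, 17, 16, 18, 19, 13, 12, 14, 15, 10, 11]), (54, [0, 1, 2, 3, 4, 5, 6, 7, 8, 9, 10, 11, 12, 13, 14, 15, 16, 17, 18, 19, 20, 21]), (55, [0, 1, 2, 3, 4, 5, 6, 7, 8, 9, 10, 11, 12, 13, 14, 15, 16, 17, 18, 19, 20, 21]), (54, [5, 3, 4, 1, 2, 0, 8, 9, 6, 7, 20, 21, 17, 16, 18, 19, 13, 12, 15, 14, 10, 11]), (55, [5, 3, 4, 1, 2, 0, 8, 9, 6, 7, 20, 21, 17, 16, 18, 19, 13, 12, 15, 14, 10, 11])]),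
    ((0, 0), [(56, [0, 1, 2, 3, 4, 5, 6, 7, 8, 9, 10, 11, 12, 13, 14, 15, 16, 17, 18, 19, 20, 21]), (56, [1, 0, 5, 4, 3, 2, 20, 21, 11, 10, 8, 9, 19, 18, 16, 17, 14, 15, 12, 13, 6, 7]), (56, [1, 0, 5, 4, 3, 2, 20, 21, 11, 10, 9, 8, 19, 18, 16, 17, 14, 15, 12, 13, 6, 7]), (56, [0, 1, 2, 3, 4, 5, 6, 7, 9, 8, 10, 11, 12, 13, 14, 15, 16, 17, 18, 19, 20, 21]), (57, [0, 1, 2, 3, 4, 5, 6, 7, 8, 9, 10, 11, 12, 13, 14, 15, 16, 17, 18, 19, 20, 21]), (57, [0, 1, 2, 3, 4, 5, 6, 7, 8, 9, 11, 10, 12, 13, 14, 15, 16, 17, 18, 19, 20, 21]), (58, [0, 1, 2, 3, 4, 5, 6, 7, 8, 9, 10, 11, 12, 13, 14, 15, 16, 17, 18, 19, 20, 21]), (58, [0, 1, 2, 3, 4, 5, 6, 7, 8, 9, 11, 10, 12, 13, 14, 15, 16, 17, 18, 19, 20, 21]), (59, [0, 1, 2, 3, 4, 5, 6, 7, 8, 9, 10, 11, 12, 13, 14, 15, 16, 17, 18, 19, 20, 21]), (59, [1, 0, 5, 4, 3, 2, 20, 21, 10, 11, 9, 8, 19, 18, 16, 17, 14, 15, 12, 13, 6, 7]), (59, [1, 0, 5, 4, 3, 2, 20, 21, 11, 10, 9, 8, 19, 18, 16, 17, 14, 15, 12, 13, 6, 7]), (59, [0, 1, 2, 3, 4, 5,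 6, 7, 8, 9, 11, 10, 12, 13, 14, 15, 16, 17, 18, 19, 20, 21]), (60, [0, 1, 2, 3, 4, 5, 6, 7, 8, 9, 10, 11, 12, 13, 14, 15, 16, 17, 18, 19, 20, 21]), (61, [0, 1, 2, 3, 4, 5, 6, 7, 8, 9, 10, 11, 12, 13, 14, 15, 16, 17, 18, 19, 20, 21]), (60, [0, 1, 2, 3, 4, 5, 6, 7, 9, 8, 10, 11, 12, 13, 14, 15, 16, 17, 18, 19, 20, 21]), (61, [0, 1, 2, 3, 4, 5, 6, 7, 9, 8, 10, 11, 12, 13, 14, 15, 16, 17, 18, 19, 20, 21]), (56, [0, 1, 4, 5, 2, 3, 20, 21, 17, 16, 15, 14, 13, 12, 10, 11, 8, 9, 18, 19, 6, 7]), (56, [1, 0, 3, 2, 5, 4, 6, 7, 14, 15, 16, 17, 18, 19, 8, 9, 10, 11, 12, 13, 20, 21]), (58, [0, 1, 4, 5, 2, 3, 20, 21, 16, 17, 15, 14, 13, 12, 10, 11, 9, 8, 19, 18, 6, 7]), (57, [0, 1, 4, 5, 2, 3, 20, 21, 17, 16, 15, 14, 13, 12, 10, 11, 9, 8, 19, 18, 6, 7]), (59, [0, 1, 4, 5, 2, 3, 20, 21, 17, 16, 15, 14, 13, 12, 10, 11, 8, 9, 18, 19, 6, 7]), (59, [1, 0, 3, 2, 5, 4, 6, 7, 14, 15, 16, 17, 18, 19, 8, 9, 10, 11, 12, 13, 20, 21]), (60, [0, 1, 4, 5, 2, 3, 20, 21, 17, 16, 15, 14, 13, 12, 11, 10,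 8, 9, 19, 18, 6, 7]), (61, [0, 1, 4, 5, 2, 3, 20, 21, 17, 16, 14, 15, 13, 12, 11, 10, 8, 9, 19, 18, 6, 7]), (58, [1, 0, 3, 2, 5, 4, 6, 7, 14, 15, 17, 16, 18, 19, 8, 9, 10, 11, 12, 13, 20, 21]), (57, [1, 0, 3, 2, 5, 4, 6, 7, 14, 15, 17, 16, 18, 19, 8, 9, 10, 11, 12, 13, 20, 21]), (57, [1, 0, 5, 4, 3, 2, 20, 21, 11, 10, 8, 9, 19, 18, 16, 17, 15, 14, 13, 12, 6, 7]), (58, [1, 0, 5, 4, 3, 2, 20, 21, 10, 11, 8, 9, 19, 18, 16, 17, 15, 14, 13, 12, 6, 7]), (57, [1, 0, 5, 4, 3, 2, 20, 21, 11, 10, 9, 8, 19, 18, 16, 17, 15, 14, 13, 12, 6, 7]), (58, [1, 0, 5, 4, 3, 2, 20, 21, 10, 11, 9, 8, 19, 18, 16, 17, 15, 14, 13, 12, 6, 7]), (62, [0, 1, 2, 3, 4, 5, 6, 7, 8, 9, 10, 11, 12, 13, 14, 15, 16, 17, 18, 19, 20, 21]), (62, [0, 1, 2, 3, 4, 5, 6, 7, 8, 9, 11, 10, 12, 13, 14, 15, 16, 17, 18, 19, 20, 21]), (62, [1, 0, 5, 4, 3, 2, 20, 21, 11, 10, 9, 8, 19, 18, 17, 16, 15, 14, 12, 13, 6, 7]), (62, [1, 0, 5, 4, 3, 2, 20, 21, 10, 11, 9, 8, 19, 18, 17, 16, 15, 14, 12, 13, 6, 7]), (62, [1, 0, 3,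 2, 5, 4, 6, 7, 14, 15, 17, 16, 18, 19, 8, 9, 10, 11, 12, 13, 20, 21]), (62, [0, 1, 4, 5, 2, 3, 20, 21, 16, 17, 15, 14, 13, 12, 11, 10, 9, 8, 18, 19, 6, 7]), (60, [1, 0, 5, 4, 3, 2, 20, 21, 10, 11, 9, 8, 19, 18, 17, 16, 14, 15, 13, 12, 6, 7]), (60, [1, 0, 5, 4, 3, 2, 20, 21, 11, 10, 9, 8, 19, 18, 17, 16, 14, 15, 13, 12, 6, 7]), (61, [1, 0, 5, 4, 3, 2, 20, 21, 10, 11, 8, 9, 19, 18, 17, 16, 14, 15, 13, 12, 6, 7]), (61, [1, 0, 5, 4, 3, 2, 20, 21, 11, 10, 8, 9, 19, 18, 17, 16, 14, 15, 13, 12, 6, 7]), (63, [0, 1, 2, 3, 4, 5, 6, 7, 8, 9, 10, 11, 12, 13, 14, 15, 16, 17, 18, 19, 20, 21]), (63, [1, 0, 5, 4, 3, 2, 20, 21, 11, 10, 9, 8, 19, 18, 17, 16, 15, 14, 12, 13, 6, 7]), (63, [0, 1, 2, 3, 4, 5, 6, 7, 9, 8, 10, 11, 12, 13, 14, 15, 16, 17, 18, 19, 20, 21]), (63, [1, 0, 5, 4, 3, 2, 20, 21, 11, 10, 8, 9, 19, 18, 17, 16, 15, 14, 12, 13, 6, 7]), (61, [1, 0, 3, 2, 5, 4, 6, 7, 15, 14, 16, 17, 18, 19, 8, 9, 10, 11, 12, 13, 20, 21]), (60, [1, 0, 3, 2, 5, 4, 6, 7, 15, 14, 16, 17, 18,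 19, 8, 9, 10, 11, 12, 13, 20, 21]), (63, [1, 0, 3, 2, 5, 4, 6, 7, 15, 14, 16, 17, 18, 19, 8, 9, 10, 11, 12, 13, 20, 21]), (63, [0, 1, 4, 5, 2, 3, 20, 21, 17, 16, 14, 15, 13, 12, 11, 10, 9, 8, 18, 19, 6, 7])])
  ]"

text \<open>For each graph the value of an invariant and two generators of the automorphism group.\<close>

definition graph_data :: "(int \<times> nat list \<times> nat list) list" where
  "graph_data = [
    (11090, [0, 1, 2, 3, 4, 5, 7, 6, 9, 8, 11, 10, 13, 12, 15, 14, 17, 16, 19, 18, 21, 20], [0, 1, 2, 3, 4, 5, 6, 7, 8, 9, 10, 11, 12, 13, 14, 15, 16, 17, 18, 19, 20, 21]),
    (12048, [0, 1, 2, 3, 4, 5, 7, 6, 9, 8, 11, 10, 13, 12, 15, 14, 17, 16, 19, 18, 21, 20], [0, 1, 2, 3, 4, 5, 6, 7, 8, 9, 10, 11, 12, 13, 14, 15, 16, 17, 18, 19, 20, 21]),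
    (7906, [0, 1, 2, 3, 4, 5, 7, 6, 9, 8, 11, 10, 13, 12, 15, 14, 17, 16, 19, 18, 21, 20], [0, 1, 2, 3, 4, 5, 6, 7, 8, 9, 10, 11, 12, 13, 14, 15, 16, 17, 18, 19, 20, 21]),
    (9578, [0, 1, 2, 3, 4, 5, 7, 6, 9, 8, 11, 10, 13, 12, 15, 14, 17, 16, 19, 18, 21, 20], [0, 1, 2, 3, 4, 5, 6, 7, 8, 9, 10, 11, 12, 13, 14, 15, 16, 17, 18, 19, 20, 21]),
    (9986, [0, 1, 2, 3, 4, 5, 7, 6, 9, 8, 11, 10, 13, 12, 15, 14, 17, 16, 19, 18, 21, 20], [0, 1, 2, 3, 4, 5, 6, 7, 8, 9, 10, 11, 12, 13, 14, 15, 16, 17, 18, 19, 20, 21]),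
    (13342, [0, 1, 2, 3, 4, 5, 7, 6, 9, 8, 11, 10, 13, 12, 15, 14, 17, 16, 19, 18, 21, 20], [0, 1, 2, 3, 4, 5, 6, 7, 8, 9, 10, 11, 12, 13, 14, 15, 16, 17, 18, 19, 20, 21]),
    (9144, [0, 1, 2, 3, 4, 5, 7, 6, 9, 8, 11, 10, 13, 12, 15, 14, 17, 16, 19, 18, 21, 20], [0, 1, 2, 3, 4, 5, 6, 7, 8, 9, 10, 11, 12, 13, 14, 15, 16, 17, 18, 19, 20, 21]),
    (9154, [0, 1, 2, 3, 4, 5, 7, 6, 9, 8, 11, 10, 13, 12, 15, 14, 17, 16, 19, 18, 21, 20], [0, 1, 2, 3, 4, 5, 6, 7, 8, 9, 10, 11, 12, 13, 14, 15, 16, 17, 18, 19, 20, 21]),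
    (7956, [0, 1, 2, 3, 4, 5, 7, 6, 9, 8, 11, 10, 13, 12, 15, 14, 17, 16, 19, 18, 21, 20], [0, 1, 2, 3, 4, 5, 6, 7, 8, 9, 10, 11, 12, 13, 14, 15, 16, 17, 18, 19, 20, 21]),
    (10008, [0, 1, 2, 3, 4, 5, 7, 6, 9, 8, 11, 10, 13, 12, 15, 14, 17, 16, 19, 18, 21, 20], [0, 1, 2, 3, 4, 5, 6, 7, 8, 9, 10, 11, 12, 13, 14, 15, 16, 17, 18, 19, 20, 21]),
    (10218, [0, 1, 2, 3, 4, 5, 7, 6, 9, 8, 11, 10, 13, 12, 15, 14, 17, 16, 19, 18, 21, 20], [0, 1, 2, 3, 4, 5, 6, 7, 8, 9, 10, 11, 12, 13, 14, 15, 16, 17, 18, 19, 20, 21]),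
    (9982, [0, 1, 2, 3, 4, 5, 7, 6, 9, 8, 11, 10, 13, 12, 15, 14, 17, 16, 19, 18, 21, 20], [0, 1, 2, 3, 4, 5, 6, 7, 8, 9, 10, 11, 12, 13, 14, 15, 16, 17, 18, 19, 20, 21]),
    (14192, [0, 1, 2, 3, 4, 5, 7, 6, 9, 8, 11, 10, 13, 12, 15, 14, 17, 16, 19, 18, 21, 20], [0, 1, 2, 3, 4, 5, 6, 7, 8, 9, 10, 11, 12, 13, 14, 15, 16, 17, 18, 19, 20, 21]),
    (9334, [0, 1, 2, 3, 4, 5, 7, 6, 9, 8, 11, 10, 13, 12, 15, 14, 17, 16, 19, 18, 21, 20], [0, 1, 2, 3, 4, 5, 6, 7, 8, 9, 10, 11, 12, 13, 14, 15, 16, 17, 18, 19, 20, 21]),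
    (14368, [0, 1, 2, 3, 4, 5, 7, 6, 9, 8, 11, 10, 13, 12, 15, 14, 17, 16, 19, 18, 21, 20], [0, 1, 2, 3, 4, 5, 6, 7, 8, 9, 10, 11, 12, 13, 14, 15, 16, 17, 18, 19, 20, 21]),
    (7350, [0, 1, 2, 3, 4, 5, 7, 6, 9, 8, 11, 10, 13, 12, 15, 14, 17, 16, 19, 18, 21, 20], [0, 1, 2, 3, 4, 5, 6, 7, 8, 9, 10, 11, 12, 13, 14, 15, 16, 17, 18, 19, 20, 21]),
    (15320, [0, 1, 2, 3, 4, 5, 7, 6, 9, 8, 11, 10, 13, 12, 15, 14, 17, 16, 19, 18, 21, 20], [0, 1, 2, 3, 4, 5, 6, 7, 8, 9, 10, 11, 12, 13, 14, 15, 16, 17, 18, 19, 20, 21]),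
    (10612, [0, 1, 2, 3, 4, 5, 7, 6, 9, 8, 11, 10, 13, 12, 15, 14, 17, 16, 19, 18, 21, 20], [0, 1, 2, 3, 4, 5, 6, 7, 8, 9, 10, 11, 12, 13, 14, 15, 16, 17, 18, 19, 20, 21]),
    (10524, [0, 1, 2, 3, 4, 5, 7, 6, 9, 8, 11, 10, 13, 12, 15, 14, 17, 16, 19, 18, 21, 20], [0, 1, 2, 3, 4, 5, 6, 7, 8, 9, 10, 11, 12, 13, 14, 15, 16, 17, 18, 19, 20, 21]),
    (12492, [0, 1, 2, 3, 4, 5, 7, 6, 9, 8, 11, 10, 13, 12, 15, 14, 17, 16, 19, 18, 21, 20], [0, 1, 2, 3, 4, 5, 6, 7, 8, 9, 10, 11, 12, 13, 14, 15, 16, 17, 18, 19, 20, 21]),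
    (14190, [0, 1, 2, 3, 4, 5, 7, 6, 9, 8, 11, 10, 13, 12, 15, 14, 17, 16, 19, 18, 21, 20], [0, 1, 2, 3, 4, 5, 6, 7, 8, 9, 10, 11, 12, 13, 14, 15, 16, 17, 18, 19, 20, 21]),
    (14862, [0, 1, 2, 3, 4, 5, 7, 6, 9, 8, 11, 10, 13, 12, 15, 14, 17, 16, 19, 18, 21, 20], [0, 1, 2, 3, 4, 5, 6, 7, 8, 9, 10, 11, 12, 13, 14, 15, 16, 17, 18, 19, 20, 21]),
    (14178, [0, 1, 2, 3, 4, 5, 7, 6, 9, 8, 11, 10, 13, 12, 15, 14, 17, 16, 19, 18, 21, 20], [0, 1, 2, 3, 4, 5, 6, 7, 8, 9, 10, 11, 12, 13, 14, 15, 16, 17, 18, 19, 20, 21]),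
    (12226, [0, 1, 2, 3, 4, 5, 7, 6, 9, 8, 11, 10, 13, 12, 15, 14, 17, 16, 19, 18, 21, 20], [0, 1, 2, 3, 4, 5, 6, 7, 8, 9, 10, 11, 12, 13, 14, 15, 16, 17, 18, 19, 20, 21]),
    (5538, [0, 1, 2, 3, 4, 5, 7, 6, 9, 8, 11, 10, 13, 12, 15, 14, 17, 16, 19, 18, 21, 20], [0, 1, 2, 3, 4, 5, 6, 7, 8, 9, 10, 11, 12, 13, 14, 15, 16, 17, 18, 19, 20, 21]),
    (14622, [0, 1, 2, 3, 4, 5, 7, 6, 9, 8, 11, 10, 13, 12, 15, 14, 17, 16, 19, 18, 21, 20], [0, 1, 2, 3, 4, 5, 6, 7, 8, 9, 10, 11, 12, 13, 14, 15, 16, 17, 18, 19, 20, 21]),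
    (11234, [0, 1, 2, 3, 4, 5, 7, 6, 9, 8, 11, 10, 13, 12, 15, 14, 17, 16, 19, 18, 21, 20], [0, 1, 2, 3, 4, 5, 6, 7, 8, 9, 10, 11, 12, 13, 14, 15, 16, 17, 18, 19, 20, 21]),
    (13514, [0, 1, 2, 3, 4, 5, 7, 6, 9, 8, 11, 10, 13, 12, 15, 14, 17, 16, 19, 18, 21, 20], [0, 1, 2, 3, 4, 5, 6, 7, 8, 9, 10, 11, 12, 13, 14, 15, 16, 17, 18, 19, 20, 21]),
    (13280, [0, 1, 2, 3, 4, 5, 7, 6, 9, 8, 11, 10, 13, 12, 15, 14, 17, 16, 19, 18, 21, 20], [0, 1, 2, 3, 4, 5, 6, 7, 8, 9, 10, 11, 12, 13, 14, 15, 16, 17, 18, 19, 20, 21]),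
    (9044, [0, 1, 2, 3, 4, 5, 7, 6, 9, 8, 11, 10, 13, 12, 15, 14, 17, 16, 19, 18, 21, 20], [0, 1, 2, 3, 4, 5, 6, 7, 8, 9, 10, 11, 12, 13, 14, 15, 16, 17, 18, 19, 20, 21]),
    (7608, [0, 1, 2, 3, 4, 5, 7, 6, 9, 8, 11, 10, 13, 12, 15, 14, 17, 16, 19, 18, 21, 20], [0, 1, 2, 3, 4, 5, 6, 7, 8, 9, 10, 11, 12, 13, 14, 15, 16, 17, 18, 19, 20, 21]),
    (9928, [0, 1, 2, 3, 4, 5, 7, 6, 9, 8, 11, 10, 13, 12, 15, 14, 17, 16, 19, 18, 21, 20], [0, 1, 2, 3, 4, 5, 6, 7, 8, 9, 10, 11, 12, 13, 14, 15, 16, 17, 18, 19, 20, 21]),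
    (8050, [0, 1, 2, 3, 4, 5, 7, 6, 9, 8, 11, 10, 13, 12, 15, 14, 17, 16, 19, 18, 21, 20], [0, 1, 2, 3, 4, 5, 6, 7, 8, 9, 10, 11, 12, 13, 14, 15, 16, 17, 18, 19, 20, 21]),
    (10154, [0, 1, 2, 3, 4, 5, 7, 6, 9, 8, 11, 10, 13, 12, 15, 14, 17, 16, 19, 18, 21, 20], [0, 1, 2, 3, 4, 5, 6, 7, 8, 9, 10, 11, 12, 13, 14, 15, 16, 17, 18, 19, 20, 21]),
    (8318, [0, 1, 2, 3, 4, 5, 7, 6, 9, 8, 11, 10, 13, 12, 15, 14, 17, 16, 19, 18, 21, 20], [0, 1, 2, 3, 4, 5, 6, 7, 8, 9, 10, 11, 12, 13, 14, 15, 16, 17, 18, 19, 20, 21]),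
    (11598, [0, 1, 2, 3, 4, 5, 7, 6, 9, 8, 11, 10, 13, 12, 15, 14, 17, 16, 19, 18, 21, 20], [0, 1, 2, 3, 4, 5, 6, 7, 8, 9, 10, 11, 12, 13, 14, 15, 16, 17, 18, 19, 20, 21]),
    (10664, [0, 1, 2, 3, 4, 5, 7, 6, 9, 8, 11, 10, 13, 12, 15, 14, 17, 16, 19, 18, 21, 20], [0, 1, 2, 3, 4, 5, 6, 7, 8, 9, 10, 11, 12, 13, 14, 15, 16, 17, 18, 19, 20, 21]),
    (11916, [0, 1, 2, 3, 4, 5, 7, 6, 9, 8, 11, 10, 13, 12, 15, 14, 17, 16, 19, 18, 21, 20], [0, 1, 2, 3, 4, 5, 6, 7, 8, 9, 10, 11, 12, 13, 14, 15, 16, 17, 18, 19, 20, 21]),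
    (11420, [0, 1, 2, 3, 4, 5, 7, 6, 9, 8, 11, 10, 13, 12, 15, 14, 17, 16, 19, 18, 21, 20], [0, 1, 2, 3, 4, 5, 6, 7, 8, 9, 10, 11, 12, 13, 14, 15, 16, 17, 18, 19, 20, 21]),
    (13244, [0, 1, 2, 3, 4, 5, 7, 6, 9, 8, 11, 10, 13, 12, 15, 14, 17, 16, 19, 18, 21, 20], [0, 1, 2, 3, 4, 5, 6, 7, 8, 9, 10, 11, 12, 13, 14, 15, 16, 17, 18, 19, 20, 21]),
    (10880, [0, 1, 2, 3, 4, 5, 7, 6, 9, 8, 11, 10, 13, 12, 15, 14, 17, 16, 19, 18, 21, 20], [0, 1, 2, 3, 4, 5, 6, 7, 8, 9, 10, 11, 12, 13, 14, 15, 16, 17, 18, 19, 20, 21]),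
    (9172, [0, 1, 2, 3, 4, 5, 7, 6, 9, 8, 11, 10, 13, 12, 15, 14, 17, 16, 19, 18, 21, 20], [0, 1, 2, 3, 4, 5, 6, 7, 8, 9, 10, 11, 12, 13, 14, 15, 16, 17, 18, 19, 20, 21]),
    (7836, [0, 1, 2, 3, 4, 5, 7, 6, 9, 8, 11, 10, 13, 12, 15, 14, 17, 16, 19, 18, 21, 20], [0, 1, 2, 3, 4, 5, 6, 7, 8, 9, 10, 11, 12, 13, 14, 15, 16, 17, 18, 19, 20, 21]),
    (11436, [0, 1, 2, 3, 4, 5, 7, 6, 9, 8, 11, 10, 13, 12, 15, 14, 17, 16, 19, 18, 21, 20], [0, 1, 2, 3, 4, 5, 6, 7, 8, 9, 10, 11, 12, 13, 14, 15, 16, 17, 18, 19, 20, 21]),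
    (12926, [0, 1, 2, 3, 4, 5, 7, 6, 9, 8, 11, 10, 13, 12, 15, 14, 17, 16, 19, 18, 21, 20], [0, 1, 2, 3, 4, 5, 6, 7, 8, 9, 10, 11, 12, 13, 14, 15, 16, 17, 18, 19, 20, 21]),
    (14526, [0, 1, 2, 3, 4, 5, 7, 6, 9, 8, 11, 10, 13, 12, 15, 14, 17, 16, 19, 18, 21, 20], [0, 1, 2, 3, 4, 5, 6, 7, 8, 9, 10, 11, 12, 13, 14, 15, 16, 17, 18, 19, 20, 21]),
    (15186, [0, 1, 2, 3, 4, 5, 7, 6, 9, 8, 11, 10, 13, 12, 15, 14, 17, 16, 19, 18, 21, 20], [0, 1, 2, 3, 4, 5, 6, 7, 8, 9, 10, 11, 12, 13, 14, 15, 16, 17, 18, 19, 20, 21]),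
    (11160, [0, 1, 2, 3, 4, 5, 7, 6, 9, 8, 11, 10, 13, 12, 15, 14, 17, 16, 19, 18, 21, 20], [0, 1, 2, 3, 4, 5, 6, 7, 8, 9, 10, 11, 12, 13, 14, 15, 16, 17, 18, 19, 20, 21]),
    (6804, [0, 1, 2, 3, 4, 5, 7, 6, 9, 8, 11, 10, 13, 12, 15, 14, 17, 16, 19, 18, 21, 20], [0, 1, 2, 3, 4, 5, 6, 7, 8, 9, 10, 11, 12, 13, 14, 15, 16, 17, 18, 19, 20, 21]),
    (10414, [0, 1, 2, 3, 4, 5, 7, 6, 9, 8, 11, 10, 13, 12, 15, 14, 17, 16, 19, 18, 21, 20], [0, 1, 2, 3, 4, 5, 6, 7, 8, 9, 10, 11, 12, 13, 14, 15, 16, 17, 18, 19, 20, 21]),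
    (10744, [0, 1, 2, 3, 4, 5, 7, 6, 9, 8, 11, 10, 13, 12, 15, 14, 17, 16, 19, 18, 21, 20], [0, 1, 2, 3, 4, 5, 6, 7, 8, 9, 10, 11, 12, 13, 14, 15, 16, 17, 18, 19, 20, 21]),
    (10460, [0, 1, 2, 3, 4, 5, 7, 6, 9, 8, 11, 10, 13, 12, 15, 14, 17, 16, 19, 18, 21, 20], [0, 1, 2, 3, 4, 5, 6, 7, 8, 9, 10, 11, 12, 13, 14, 15, 16, 17, 18, 19, 20, 21]),
    (11724, [0, 1, 2, 3, 4, 5, 7, 6, 9, 8, 11, 10, 13, 12, 15, 14, 17, 16, 19, 18, 21, 20], [0, 1, 2, 3, 4, 5, 6, 7, 8, 9, 10, 11, 12, 13, 14, 15, 16, 17, 18, 19, 20, 21]),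
    (11052, [0, 1, 2, 3, 4, 5, 7, 6, 9, 8, 11, 10, 13, 12, 15, 14, 17, 16, 19, 18, 21, 20], [0, 1, 2, 3, 4, 5, 6, 7, 8, 9, 10, 11, 12, 13, 14, 15, 16, 17, 18, 19, 20, 21]),
    (6880, [0, 1, 2, 3, 4, 5, 7, 6, 9, 8, 11, 10, 13, 12, 15, 14, 17, 16, 19, 18, 21, 20], [0, 1, 2, 3, 4, 5, 6, 7, 8, 9, 10, 11, 12, 13, 14, 15, 16, 17, 18, 19, 20, 21]),
    (8020, [0, 1, 2, 3, 4, 5, 7, 6, 9, 8, 11, 10, 13, 12, 15, 14, 17, 16, 19, 18, 21, 20], [0, 1, 2, 3, 4, 5, 6, 7, 8, 9, 10, 11, 12, 13, 14, 15, 16, 17, 18, 19, 20, 21]),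
    (8800, [0, 1, 2, 3, 4, 5, 7, 6, 9, 8, 11, 10, 13, 12, 15, 14, 17, 16, 19, 18, 21, 20], [0, 1, 2, 3, 4, 5, 6, 7, 8, 9, 10, 11, 12, 13, 14, 15, 16, 17, 18, 19, 20, 21]),
    (5060, [0, 1, 2, 3, 4, 5, 7, 6, 9, 8, 11, 10, 13, 12, 15, 14, 17, 16, 19, 18, 21, 20], [0, 1, 2, 3, 4, 5, 6, 7, 8, 9, 10, 11, 12, 13, 14, 15, 16, 17, 18, 19, 20, 21]),
    (5564, [0, 1, 2, 3, 4, 5, 7, 6, 9, 8, 11, 10, 13, 12, 15, 14, 17, 16, 19, 18, 21, 20], [0, 1, 2, 3, 4, 5, 6, 7, 8, 9, 10, 11, 12, 13, 14, 15, 16, 17, 18, 19, 20, 21]),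
    (5952, [0, 1, 2, 3, 4, 5, 7, 6, 9, 8, 11, 10, 13, 12, 15, 14, 17, 16, 19, 18, 21, 20], [0, 1, 2, 3, 4, 5, 6, 7, 8, 9, 10, 11, 12, 13, 14, 15, 16, 17, 18, 19, 20, 21]),
    (6900, [0, 1, 2, 3, 4, 5, 7, 6, 9, 8, 11, 10, 13, 12, 15, 14, 17, 16, 19, 18, 21, 20], [0, 1, 2, 3, 4, 5, 6, 7, 8, 9, 10, 11, 12, 13, 14, 15, 16, 17, 18, 19, 20, 21]),
    (6828, [0, 1, 2, 3, 4, 5, 7, 6, 9, 8, 11, 10, 13, 12, 15, 14, 17, 16, 19, 18, 21, 20], [0, 1, 2, 3, 4, 5, 6, 7, 8, 9, 10, 11, 12, 13, 14, 15, 16, 17, 18, 19, 20, 21]),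
    (6388, [0, 1, 2, 3, 4, 5, 7, 6, 9, 8, 11, 10, 13, 12, 15, 14, 17, 16, 19, 18, 21, 20], [0, 1, 2, 3, 4, 5, 6, 7, 8, 9, 10, 11, 12, 13, 14, 15, 16, 17, 18, 19, 20, 21]),
    (8212, [0, 1, 2, 3, 4, 5, 7, 6, 9, 8, 11, 10, 13, 12, 15, 14, 17, 16, 19, 18, 21, 20], [0, 1, 2, 3, 4, 5, 6, 7, 8, 9, 10, 11, 12, 13, 14, 15, 16, 17, 18, 19, 20, 21]),
    (6354, [3, 5, 4, 0, 2, 1, 10, 11, 21, 20, 7, 6, 14, 15, 13, 12, 18, 19, 17, 16, 8, 9], [0, 1, 2, 3, 4, 5, 6, 7, 8, 9, 10, 11, 12, 13, 14, 15, 16, 17, 18, 19, 20, 21]),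
    (4366, [3, 5, 4, 0, 2, 1, 10, 11, 20, 21, 7, 6, 14, 15, 13, 12, 19, 18, 16, 17, 9, 8], [0, 1, 2, 3, 4, 5, 6, 7, 8, 9, 10, 11, 12, 13, 14, 15, 16, 17, 18, 19, 20, 21]),
    (5506, [5, 3, 4, 1, 2, 0, 8, 9, 7, 6, 20, 21, 17, 16, 19, 18, 12, 13, 14, 15, 11, 10], [0, 1, 2, 3, 4, 5, 6, 7, 8, 9, 10, 11, 12, 13, 14, 15, 16, 17, 18, 19, 20, 21]),
    (4542, [5, 3, 4, 1, 2, 0, 8, 9, 7, 6, 21, 20, 17, 16, 18, 19, 12, 13, 15, 14, 10, 11], [0, 1, 2, 3, 4, 5, 6, 7, 8, 9, 10, 11, 12, 13, 14, 15, 16, 17, 18, 19, 20, 21]),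
    (9874, [0, 1, 2, 3, 4, 5, 7, 6, 9, 8, 11, 10, 13, 12, 15, 14, 17, 16, 19, 18, 21, 20], [3, 5, 4, 0, 2, 1, 10, 11, 21, 20, 6, 7, 15, 14, 13, 12, 18, 19, 16, 17, 9, 8]),
    (8098, [0, 1, 2, 3, 4, 5, 7, 6, 9, 8, 11, 10, 13, 12, 15, 14, 17, 16, 19, 18, 21, 20], [3, 5, 4, 0, 2, 1, 10, 11, 21, 20, 6, 7, 15, 14, 13, 12, 18, 19, 16, 17, 9, 8]),
    (13018, [0, 1, 2, 3, 4, 5, 7, 6, 9, 8, 11, 10, 13, 12, 15, 14, 17, 16, 19, 18, 21, 20], [3, 5, 4, 0, 2, 1, 10, 11, 21, 20, 6, 7, 15, 14, 13, 12, 18, 19, 16, 17, 9, 8]),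
    (10510, [0, 1, 2, 3, 4, 5, 7, 6, 9, 8, 11, 10, 13, 12, 15, 14, 17, 16, 19, 18, 21, 20], [3, 5, 4, 0, 2, 1, 10, 11, 21, 20, 6, 7, 15, 14, 13, 12, 18, 19, 16, 17, 9, 8]),
    (6470, [0, 1, 2, 3, 4, 5, 7, 6, 9, 8, 11, 10, 13, 12, 15, 14, 17, 16, 19, 18, 21, 20], [3, 5, 4, 0, 2, 1, 10, 11, 21, 20, 6, 7, 15, 14, 13, 12, 18, 19, 16, 17, 9, 8]),
    (6722, [0, 1, 2, 3, 4, 5, 7, 6, 9, 8, 11, 10, 13, 12, 15, 14, 17, 16, 19, 18, 21, 20], [5, 3, 4, 1, 2, 0, 8, 9, 6, 7, 21, 20, 17, 16, 18, 19, 13, 12, 14, 15, 11, 10]),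
    (3922, [0, 1, 2, 3, 4, 5, 7, 6, 9, 8, 11, 10, 13, 12, 15, 14, 17, 16, 19, 18, 21, 20], [5, 3, 4, 1, 2, 0, 8, 9, 6, 7, 20, 21, 17, 16, 18, 19, 13, 12, 14, 15, 10, 11]),
    (7050, [0, 1, 2, 3, 4, 5, 7, 6, 9, 8, 11, 10, 13, 12, 15, 14, 17, 16, 19, 18, 21, 20], [5, 3, 4, 1, 2, 0, 8, 9, 6, 7, 20, 21, 17, 16, 18, 19, 13, 12, 14, 15, 10, 11]),
    (8766, [0, 1, 2, 3, 4, 5, 7, 6, 9, 8, 11, 10, 13, 12, 15, 14, 17, 16, 19, 18, 21, 20], [5, 3, 4, 1, 2, 0, 8, 9, 6, 7, 20, 21, 17, 16, 18, 19, 13, 12, 14, 15, 10, 11]),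
    (5622, [0, 1, 2, 3, 4, 5, 7, 6, 9, 8, 11, 10, 13, 12, 15, 14, 17, 16, 19, 18, 21, 20], [5, 3, 4, 1, 2, 0, 8, 9, 6, 7, 20, 21, 17, 16, 18, 19, 13, 12, 14, 15, 10, 11]),
    (9976, [3, 5, 4, 0, 2, 1, 10, 11, 20, 21, 6, 7, 14, 15, 13, 12, 19, 18, 16, 17, 8, 9], [0, 1, 2, 3, 4, 5, 7, 6, 9, 8, 11, 10, 12, 13, 14, 15, 16, 17, 18, 19, 21, 20]),
    (4940, [3, 5, 4, 0, 2, 1, 10, 11, 20, 21, 6, 7, 14, 15, 13, 12, 19, 18, 16, 17, 8, 9], [0, 1, 2, 3, 4, 5, 7, 6, 9, 8, 11, 10, 12, 13, 14, 15, 16, 17, 18, 19, 21, 20]),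
    (4088, [5, 3, 4, 1, 2, 0, 8, 9, 6, 7, 20, 21, 16, 17, 19, 18, 13, 12, 14, 15, 10, 11], [0, 1, 2, 3, 4, 5, 7, 6, 9, 8, 11, 10, 12, 13, 14, 15, 16, 17, 18, 19, 21, 20]),
    (3564, [5, 3, 4, 1, 2, 0, 8, 9, 6, 7, 20, 21, 16, 17, 19, 18, 13, 12, 14, 15, 10, 11], [0, 1, 2, 3, 4, 5, 7, 6, 9, 8, 11, 10, 12, 13, 14, 15, 16, 17, 18, 19, 21, 20])
  ]"

section \<open>Checks applied to the stored data\<close>

definition bc_reps :: "num list list" where
  "bc_reps = map (map to_num) bc_rep_codes"

definition graph_mat :: "nat \<Rightarrow> bool list list" where
  "graph_mat k = map bits (graph_codes ! k)"

fun leaf_cert_ok :: "bool list list \<Rightarrow> bool list list \<Rightarrow> leaf list \<Rightarrow> (nat \<times> nat list) list \<Rightarrow> bool" where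
  "leaf_cert_ok bs cs [] qs = True"
| "leaf_cert_ok bs cs (l # ls) [] = False"
| "leaf_cert_ok bs cs (l # ls) ((k, p) # qs) =
     (k < 82 \<and> is_perm 22 p \<and>
      select_rows p (select p (leaf_mat bs cs l)) = graph_mat k \<and> leaf_cert_ok bs cs ls qs)"

fun rep_ok :: "bool list list list \<Rightarrow> num list \<Rightarrow> (nat \<times> nat) \<times> (nat \<times> nat list) list \<Rightarrow> bool" where
  "rep_ok Fs r (pq, qs) = (pivot_ok (e2_cols (b_cols r) (c_rows r)) pq \<and>
     leaf_cert_ok (b_cols r) (c_rows r) (rep_leaves Fs r) qs)"

text \<open>A window of \<open>n\<close> representatives from index \<open>m\<close> on. The windows
  are evaluated separately and joined in \<open>reps_ok_all\<close>.\<close>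

definition reps_ok :: "nat \<Rightarrow> nat \<Rightarrow> bool" where
  "reps_ok m n = list_all2 (rep_ok fixed_parts) (take n (drop m bc_reps)) (take n (drop m rep_data))"

fun perm_pow :: "nat list \<Rightarrow> nat \<Rightarrow> nat list" where
  "perm_pow p 0 = [0, 1, 2, 3, 4, 5, 6, 7, 8, 9, 10, 11, 12, 13, 14, 15, 16, 17, 18, 19, 20, 21]"
| "perm_pow p (Suc n) = select (perm_pow p n) p"

fun perm_products :: "nat list \<Rightarrow> nat list \<Rightarrow> nat \<Rightarrow> nat \<Rightarrow> nat list list" where
  "perm_products a b m n = map (\<lambda>(i, j). select (perm_pow b j) (perm_pow a i)) (List.product [0..<m] [0..<n])"

text \<open>Commuting automorphisms whose \<open>m\<close> times \<open>n\<close> products of powers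
  are distinct generate a product of two cyclic groups, and the bound from the search leaves no room
  for further automorphisms.\<close>

fun aut_ok :: "bool list list \<Rightarrow> nat \<times> nat \<Rightarrow> nat list \<Rightarrow> nat list \<Rightarrow> bool" where
  "aut_ok M (m, n) a b = (is_aut M a \<and> is_aut M b \<and> perm_pow a m = perm_pow a 0 \<and> perm_pow b n = perm_pow b 0 \<and>
     select a b = select b a \<and> distinct (perm_products a b m n) \<and> length (aut_search M) \<le> m * n)"

text \<open>The stored graphs are ordered by their groups: 64, 4, 10 and 4 of them. A cyclic group
  is written with a trivial second factor.\<close>

definition aut_type :: "nat \<Rightarrow> nat \<times> nat" where
  "aut_type k = (if k < 64 then (2, 1) else if k < 68 then (4, 1) else if k < 78 then (2, 2) else (4, 2))"

fun graph_ok :: "bool list list \<Rightarrow> nat \<times> nat \<Rightarrow> int \<times> nat list \<times> nat list \<Rightarrow> bool" where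
  "graph_ok M t (key, a, b) = (mat_ok M \<and> colour_key (colouring M) = key \<and> aut_ok M t a b)"

definition graphs_ok :: "nat \<Rightarrow> nat \<Rightarrow> bool" where
  "graphs_ok m n = list_all (\<lambda>k. graph_ok (graph_mat k) (aut_type k) (graph_data ! k)) [m..<m + n]"


fun sum_rows :: "bool list \<Rightarrow> bool list list \<Rightarrow> nat list" where
  "sum_rows (True # s) (r # rs) = tally r (sum_rows s rs)"
| "sum_rows (False # s) (r # rs) = sum_rows s rs"
| "sum_rows _ _ = [0, 0, 0, 0, 0, 0]"

text \<open>Row by row this is \<open>F^2 + F = 2 J\<close> over the integers.\<close>

fun fixed_square_ok :: "bool list list \<Rightarrow> bool" where
  "fixed_square_ok F = list_all (\<lambda>r. tally r (sum_rows r F) = [2, 2, 2, 2, 2, 2]) F"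

fun sorted_row :: "crow \<Rightarrow> bool" where
  "sorted_row (b, c) = sorted (map (\<lambda>j. (if b ! j then 2 else 0) + (if c ! j then 1 else 0) :: nat) [0..<8])"

subsection \<open>Results of the searches\<close>

lemma fixed_search_eq: "fixed_search = fixed_parts"
  unfolding fixed_search_def by code_simp

text \<open>Idempotence modulo two only says that \<open>F^2 + F\<close> is even. Inspection of all
  candidates sharpens this to \<open>2 J\<close>, and thereby gives \<open>B C\<close> its exact
  value.\<close>

lemma fixed_squares_ok: "list_all fixed_square_ok fixed_parts"
  by code_simp

lemma row0_unique: "sieve sorted_row (sieve (meet_pair 2) (all_pairs (weighted 8 3) (weighted 8 3))) = [row0]"
  by code_simp

lemma bc_leaves_ok: "bc_cert_ok bc_reps bc_leaves bc_witnesses"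
  by code_simp

lemma reps_ok_0: "reps_ok 0 4"
  unfolding reps_ok_def by code_simp

lemma reps_ok_4: "reps_ok 4 11"
  unfolding reps_ok_def by code_simp

lemma reps_ok_15: "reps_ok 15 13"
  unfolding reps_ok_def by code_simp

lemma reps_ok_28: "reps_ok 28 9"
  unfolding reps_ok_def by code_simp

lemma reps_ok_37: "reps_ok 37 9"
  unfolding reps_ok_def by code_simp

lemma reps_ok_46: "reps_ok 46 15"
  unfolding reps_ok_def by code_simp

lemma reps_ok_61: "reps_ok 61 9"
  unfolding reps_ok_def by code_simp

lemma reps_ok_70: "reps_ok 70 6"
  unfolding reps_ok_def by code_simp

lemma reps_ok_76: "reps_ok 76 8"
  unfolding reps_ok_def by code_simp

lemma reps_ok_84: "reps_ok 84 4"
  unfolding reps_ok_def by code_simp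

lemma reps_ok_88: "reps_ok 88 11"
  unfolding reps_ok_def by code_simp

lemma reps_ok_99: "reps_ok 99 2"
  unfolding reps_ok_def by code_simp

lemma reps_ok_101: "reps_ok 101 3"
  unfolding reps_ok_def by code_simp

lemma reps_ok_104: "reps_ok 104 2"
  unfolding reps_ok_def by code_simp

lemma reps_ok_106: "reps_ok 106 2"
  unfolding reps_ok_def by code_simp

lemma reps_ok_108: "reps_ok 108 2"
  unfolding reps_ok_def by code_simp

lemma reps_ok_110: "reps_ok 110 2"
  unfolding reps_ok_def by code_simp

lemma graphs_ok_0: "graphs_ok 0 8"
  unfolding graphs_ok_def by code_simp

lemma graphs_ok_8: "graphs_ok 8 8"
  unfolding graphs_ok_def by code_simp

lemma graphs_ok_16: "graphs_ok 16 9"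
  unfolding graphs_ok_def by code_simp

lemma graphs_ok_25: "graphs_ok 25 8"
  unfolding graphs_ok_def by code_simp

lemma graphs_ok_33: "graphs_ok 33 8"
  unfolding graphs_ok_def by code_simp

lemma graphs_ok_41: "graphs_ok 41 8"
  unfolding graphs_ok_def by code_simp

lemma graphs_ok_49: "graphs_ok 49 8"
  unfolding graphs_ok_def by code_simp

lemma graphs_ok_57: "graphs_ok 57 9"
  unfolding graphs_ok_def by code_simp

lemma graphs_ok_66: "graphs_ok 66 8"
  unfolding graphs_ok_def by code_simp

lemma graphs_ok_74: "graphs_ok 74 8"
  unfolding graphs_ok_def by code_simp

text \<open>The first components are the values of an isomorphism invariant, so no two of the stored
  graphs are isomorphic.\<close>

lemma distinct_keys: "distinct (map fst graph_data)"
  by code_simp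

subsection \<open>Correctness of the list functions\<close>

lemma set_extend_all: "set (extend_all f p ys) = (\<Union>y\<in>set ys. set (f (p @ [y])))"
  by (induction ys) auto

text \<open>A known solution \<open>xs\<close> is followed down the tree: it is reached if each
  entry is a candidate after the entries before it.\<close>

lemma dfs_complete:
  assumes "length xs = length p + n" and "take (length p) xs = p"
    and "\<And>m. length p \<le> m \<Longrightarrow> m < length xs \<Longrightarrow> xs ! m \<in> set (cand (take m xs))"
  shows "xs \<in> set (dfs cand n p)"
  using assms
proof (induction n arbitrary: p)
  case 0
  then show ?case by simp
next
  case (Suc n)
  let ?y = "xs ! length p"
  have t: "take (length (p @ [?y])) xs = p @ [?y]"
    using Suc.prems(1,2) by (simp add: take_Suc_conv_app_nth)
  have "xs \<in> set (dfs cand n (p @ [?y]))"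
    by (rule Suc.IH) (use Suc.prems t in auto)
  moreover have "?y \<in> set (cand p)"
    using Suc.prems(3)[of "length p"] Suc.prems(1,2) by simp
  ultimately show ?case by (auto simp: set_extend_all)
qed

lemma set_cons_if [simp]: "set (cons_if b x xs) = (if b then insert x (set xs) else set xs)"
  by (cases b) auto

lemma set_sieve [simp]: "set (sieve P xs) = {x \<in> set xs. P x}"
  by (induction xs) auto

lemma all_true_if_iff: "all_true_if b P xs \<longleftrightarrow> b \<and> all_true P xs"
  by (cases b) auto

lemma all_true_iff [simp]: "all_true P xs \<longleftrightarrow> (\<forall>x\<in>set xs. P x)"
  by (induction xs) (auto simp: all_true_if_iff)

lemma set_cons_all [simp]: "set (cons_all x yss) = (#) x ` set yss"
  by (induction yss) auto

lemma set_cons_any [simp]: "set (cons_any xs yss) = (\<Union>x\<in>set xs. (#) x ` set yss)"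
  by (induction xs) auto

lemma set_choices: "xs \<in> set (choices xss) \<longleftrightarrow> list_all2 (\<lambda>x ys. x \<in> set ys) xs xss"
  by (induction xss arbitrary: xs) (auto simp: list_all2_Cons2)

lemma meet_eq_sum:
  assumes "length xs = n" "length ys = n"
  shows "meet xs ys = (\<Sum>i<n. of_bool (xs ! i \<and> ys ! i))"
  using assms
proof (induction xs ys arbitrary: n rule: meet.induct)
qed (auto simp: sum.lessThan_Suc_shift simp del: sum.lessThan_Suc sum_of_bool_eq)

lemma set_weighted: "xs \<in> set (weighted n k) \<longleftrightarrow> length xs = n \<and> meet xs xs = k"
proof (induction n k arbitrary: xs rule: weighted.induct)
  case (3 n)
  then show ?case by (cases xs; cases "hd xs") (auto simp: image_iff)
next
  case (4 n k)
  then show ?case by (cases xs; cases "hd xs") (auto simp: image_iff)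
qed auto

lemma set_pair_up [simp]: "set (pair_up x ys) = Pair x ` set ys"
  by (induction ys) auto

lemma set_all_pairs [simp]: "set (all_pairs xs ys) = set xs \<times> set ys"
  by (induction xs) auto

lemma length_select [simp]: "length (select is xs) = length is"
  by (induction "is") auto

lemma nth_select [simp]: "i < length is \<Longrightarrow> select is xs ! i = xs ! (is ! i)"
  by (induction "is" arbitrary: i) (auto simp: nth_Cons split: nat.split)

lemma length_select_rows [simp]: "length (select_rows p rs) = length rs"
  by (induction rs) auto

lemma nth_select_rows [simp]: "i < length rs \<Longrightarrow> select_rows p rs ! i = select p (rs ! i)"
  by (induction rs arbitrary: i) (auto simp: nth_Cons split: nat.split)

lemma nth_all_eq: "nth_all xss i = map (\<lambda>xs. xs ! i) xss"
  by (induction xss) auto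

lemma meets_eq: "meets b fs = map (\<lambda>f. meet f b) fs"
  by (induction fs) auto

lemma to_int_eq [simp]: "to_int n = int n"
  by (induction n) auto

lemma conj_bits_eq: "conj_bits xs ys = map2 (\<and>) xs ys"
  by (induction xs ys rule: conj_bits.induct) auto

subsection \<open>Adjacency matrices of digraphs\<close>

definition dsrg_mat :: "(nat \<Rightarrow> nat \<Rightarrow> bool) \<Rightarrow> bool" where
  "dsrg_mat A \<longleftrightarrow> (\<forall>x<22. \<not> A x x \<and> card {y. y < 22 \<and> A x y} = 9 \<and> card {y. y < 22 \<and> A y x} = 9 \<and>
     (\<forall>y<22. card {z. z < 22 \<and> A x z \<and> A z y} = (if x = y then 6 else if A x y then 3 else 4)))"

definition swap :: "nat \<Rightarrow> nat" where
  "swap x = (if x < 6 then x else if even x then x + 1 else x - 1)"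

definition swap_invariant :: "(nat \<Rightarrow> nat \<Rightarrow> bool) \<Rightarrow> bool" where
  "swap_invariant A \<longleftrightarrow> (\<forall>x<22. \<forall>y<22. A (swap x) (swap y) = A x y)"

text \<open>Graphs over any vertex type are handled through a numbering of the vertices: graphs
  numbered by the same matrix are isomorphic, and invariance of the matrix under \<open>swap\<close>
  yields the required involution.\<close>

definition labels :: "(nat \<Rightarrow> 'a) \<Rightarrow> (nat \<Rightarrow> nat \<Rightarrow> bool) \<Rightarrow> 'a pair_pre_digraph \<Rightarrow> bool" where
  "labels f A G \<longleftrightarrow> bij_betw f {..<22} (pverts G) \<and> (\<forall>x<22. \<forall>y<22. (f x, f y) \<in> parcs G \<longleftrightarrow> A x y)"

lemma labels_bij: "labels f A G \<Longrightarrow> bij_betw f {..<22} (pverts G)"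
  by (simp add: labels_def)

lemma labels_in: "labels f A G \<Longrightarrow> x < 22 \<Longrightarrow> f x \<in> pverts G"
  using bij_betwE labels_bij by blast

lemma labels_arc: "labels f A G \<Longrightarrow> x < 22 \<Longrightarrow> y < 22 \<Longrightarrow> (f x, f y) \<in> parcs G \<longleftrightarrow> A x y"
  by (simp add: labels_def)

lemma labels_obtain:
  assumes "labels f A G" "v \<in> pverts G"
  obtains x where "x < 22" "v = f x"
  using assms labels_bij[OF assms(1)] by (metis bij_betw_def imageE lessThan_iff)

lemma labels_card:
  assumes "labels f A G"
  shows "card {v \<in> pverts G. P v} = card {x. x < 22 \<and> P (f x)}"
proof -
  have "bij_betw f {x. x < 22 \<and> P (f x)} {v \<in> pverts G. P v}"
    using assms by (auto simp: labels_def bij_betw_def inj_on_def)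
  then show ?thesis by (simp add: bij_betw_same_card)
qed

lemma (in pair_digraph) degrees:
  "in_degree (with_proj G) v = card {u \<in> pverts G. (u, v) \<in> parcs G}"
  "out_degree (with_proj G) v = card {u \<in> pverts G. (v, u) \<in> parcs G}"
proof -
  have "in_arcs (with_proj G) v = (\<lambda>u. (u, v)) ` {u \<in> pverts G. (u, v) \<in> parcs G}"
    using in_arcsD1 by (auto simp: in_arcs_def)
  then show "in_degree (with_proj G) v = card {u \<in> pverts G. (u, v) \<in> parcs G}"
    by (simp add: in_degree_def card_image inj_on_def)
  have "out_arcs (with_proj G) v = (\<lambda>u. (v, u)) ` {u \<in> pverts G. (v, u) \<in> parcs G}"
    using in_arcsD2 by (auto simp: out_arcs_def)
  then show "out_degree (with_proj G) v = card {u \<in> pverts G. (v, u) \<in> parcs G}"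
    by (simp add: out_degree_def card_image inj_on_def)
qed

lemma dsrg_mat_of_graph:
  assumes "directed_strongly_regular_graph G 22 9 6 3 4" and l: "labels f A G"
  shows "dsrg_mat A"
proof -
  interpret directed_strongly_regular_graph G 22 9 6 3 4 by fact
  have 1: "\<not> A x x \<and> card {y. y < 22 \<and> A x y} = 9 \<and> card {y. y < 22 \<and> A y x} = 9"
    if x: "x < 22" for x
  proof (intro conjI)
    note fx = labels_in[OF l x]
    show "\<not> A x x" using labels_arc[OF l x x] no_loops by fastforce
    have "card {y. y < 22 \<and> A x y} = card {y. y < 22 \<and> (f x, f y) \<in> parcs G}"
      by (intro arg_cong[where f = card] Collect_cong) (use labels_arc[OF l x] in blast)
    also have "\<dots> = 9" using out_degree[OF fx] by (simp add: degrees labels_card[OF l])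
    finally show "card {y. y < 22 \<and> A x y} = 9" .
    have "card {y. y < 22 \<and> A y x} = card {y. y < 22 \<and> (f y, f x) \<in> parcs G}"
      by (intro arg_cong[where f = card] Collect_cong) (use labels_arc[OF l _ x] in blast)
    also have "\<dots> = 9" using in_degree[OF fx] by (simp add: degrees labels_card[OF l])
    finally show "card {y. y < 22 \<and> A y x} = 9" .
  qed
  have 2: "card {z. z < 22 \<and> A x z \<and> A z y} = (if x = y then 6 else if A x y then 3 else 4)"
    if x: "x < 22" and y: "y < 22" for x y
  proof -
    note fx = labels_in[OF l x] and fy = labels_in[OF l y]
    have "card {z. z < 22 \<and> A x z \<and> A z y} = card {z. z < 22 \<and> (f x, f z) \<in> parcs G \<and> (f z, f y) \<in> parcs G}"
      by (intro arg_cong[where f = card] Collect_cong)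
        (use labels_arc[OF l x] labels_arc[OF l _ y] in blast)
    also have "\<dots> = card {z \<in> pverts G. (f x, z) \<in> parcs G \<and> (z, f y) \<in> parcs G}"
      by (simp add: labels_card[OF l])
    also have "{z \<in> pverts G. (f x, z) \<in> parcs G \<and> (z, f y) \<in> parcs G} =
        {z. (f x, z) \<in> parcs G \<and> (z, f y) \<in> parcs G}"
      using in_arcsD2 by auto
    also have "card \<dots> = (if x = y then 6 else if A x y then 3 else 4)"
    proof (cases "x = y")
      case True
      then show ?thesis using reciprocal[OF fx] by simp
    next
      case False
      then have "f x \<noteq> f y" using labels_bij[OF l] x y by (auto simp: bij_betw_def inj_on_def)
      then show ?thesis
        using False paths_adjacent[of "f x" "f y"] paths_nonadjacent[OF fx fy] labels_arc[OF l x y] by auto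
    qed
    finally show ?thesis .
  qed
  from 1 2 show ?thesis unfolding dsrg_mat_def by blast
qed

lemma graph_of_dsrg_mat:
  assumes A: "dsrg_mat A" and l: "labels f A G" and wf: "parcs G \<subseteq> pverts G \<times> pverts G"
  shows "directed_strongly_regular_graph G 22 9 6 3 4"
proof -
  have fin: "finite (pverts G)" using labels_bij[OF l] bij_betw_finite by blast
  interpret pair_digraph G
  proof
    show "finite (pverts G)" by (rule fin)
    show "finite (parcs G)" using wf fin finite_subset by blast
    show "fst e \<in> pverts G" "snd e \<in> pverts G" if "e \<in> parcs G" for e using that wf by auto
    show "fst e \<noteq> snd e" if e: "e \<in> parcs G" for e
    proof
      assume "fst e = snd e"
      moreover have "fst e \<in> pverts G" using e wf by auto
      then obtain x where "x < 22" "fst e = f x" using labels_obtain[OF l] by blast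
      ultimately have "A x x" using labels_arc[OF l, of x x] e by (metis prod.collapse)
      then show False using A \<open>x < 22\<close> by (auto simp: dsrg_mat_def)
    qed
  qed
  have mid: "card {z. (f x, z) \<in> parcs G \<and> (z, f y) \<in> parcs G} = (if x = y then 6 else if A x y then 3 else 4)"
    if x: "x < 22" and y: "y < 22" for x y
  proof -
    have "{z. (f x, z) \<in> parcs G \<and> (z, f y) \<in> parcs G} =
        {z \<in> pverts G. (f x, z) \<in> parcs G \<and> (z, f y) \<in> parcs G}"
      using wf by auto
    also have "card \<dots> = card {z. z < 22 \<and> (f x, f z) \<in> parcs G \<and> (f z, f y) \<in> parcs G}"
      by (simp add: labels_card[OF l])
    also have "\<dots> = card {z. z < 22 \<and> A x z \<and> A z y}"
      by (intro arg_cong[where f = card] Collect_cong)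
        (use labels_arc[OF l x] labels_arc[OF l _ y] in blast)
    finally show ?thesis using A x y by (simp add: dsrg_mat_def)
  qed
  have deg: "card {y. y < 22 \<and> (f x, f y) \<in> parcs G} = 9" "card {y. y < 22 \<and> (f y, f x) \<in> parcs G} = 9"
    if x: "x < 22" for x
  proof -
    have "{y. y < 22 \<and> (f x, f y) \<in> parcs G} = {y. y < 22 \<and> A x y}"
      "{y. y < 22 \<and> (f y, f x) \<in> parcs G} = {y. y < 22 \<and> A y x}"
      using labels_arc[OF l x] labels_arc[OF l _ x] by blast+
    then show "card {y. y < 22 \<and> (f x, f y) \<in> parcs G} = 9" "card {y. y < 22 \<and> (f y, f x) \<in> parcs G} = 9"
      using A x by (simp_all add: dsrg_mat_def)
  qed
  show ?thesis
  proof
    show "card (pverts G) = 22" using labels_bij[OF l] bij_betw_same_card by fastforce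
    fix v assume v: "v \<in> pverts G"
    then obtain x where x: "x < 22" "v = f x" using labels_obtain[OF l] by blast
    show "in_degree (with_proj G) v = 9" "out_degree (with_proj G) v = 9"
      using deg[OF x(1)] by (simp_all add: degrees labels_card[OF l] x(2))
    show "card {y. (v, y) \<in> parcs G \<and> (y, v) \<in> parcs G} = 6" using mid[OF x(1) x(1)] x by simp
  next
    fix v w assume e: "(v, w) \<in> parcs G"
    obtain x where x: "x < 22" "v = f x" using labels_obtain[OF l] wf e by blast
    obtain y where y: "y < 22" "w = f y" using labels_obtain[OF l] wf e by blast
    have "A x y" using labels_arc[OF l] x y e by simp
    moreover from this have "x \<noteq> y" using A x by (auto simp: dsrg_mat_def)
    ultimately show "card {z. (v, z) \<in> parcs G \<and> (z, w) \<in> parcs G} = 3" using mid x y by simp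
  next
    fix v w assume e: "v \<in> pverts G" "w \<in> pverts G" "v \<noteq> w" "(v, w) \<notin> parcs G"
    obtain x where x: "x < 22" "v = f x" using labels_obtain[OF l] e by blast
    obtain y where y: "y < 22" "w = f y" using labels_obtain[OF l] e by blast
    have "\<not> A x y" "x \<noteq> y" using labels_arc[OF l] x y e by auto
    then show "card {z. (v, z) \<in> parcs G \<and> (z, w) \<in> parcs G} = 4" using mid x y by simp
  qed
qed

lemma labels_comp:
  assumes "labels f A G" "bij_betw p {..<22} {..<22}"
  shows "labels (f \<circ> p) (\<lambda>x y. A (p x) (p y)) G"
proof -
  have "p x < 22" if "x < 22" for x using that assms(2) bij_betwE by fastforce
  then show ?thesis using assms bij_betw_trans[of p _ _ f] by (auto simp: labels_def)
qed

text \<open>Removing one orbit \<open>{v, \<sigma> v}\<close> leaves a smaller set on which \<sigma>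
  still has no fixed point.\<close>

lemma free_involution_pairs:
  assumes "finite W" "\<And>v. v \<in> W \<Longrightarrow> \<sigma> v \<in> W \<and> \<sigma> v \<noteq> v \<and> \<sigma> (\<sigma> v) = v"
  shows "\<exists>(n::nat) g. bij_betw g {..<2 * n} W \<and> (\<forall>j<n. \<sigma> (g (2 * j)) = g (2 * j + 1))"
  using assms
proof (induction W rule: finite_psubset_induct)
  case (psubset W)
  show ?case
  proof (cases "W = {}")
    case True
    then have "bij_betw g {..<2 * 0} W" for g :: "nat \<Rightarrow> 'a" by (simp add: bij_betw_def)
    then show ?thesis by (metis not_less0)
  next
    case False
    then obtain v where v: "v \<in> W" by blast
    note sv = psubset.prems[OF v]
    let ?W = "W - {v, \<sigma> v}"
    have "?W \<subset> W" using v by blast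
    moreover have "\<sigma> u \<in> ?W \<and> \<sigma> u \<noteq> u \<and> \<sigma> (\<sigma> u) = u" if "u \<in> ?W" for u
      using that psubset.prems[of u] sv by auto
    ultimately obtain n :: nat and g where g: "bij_betw g {..<2 * n} ?W" "\<forall>j<n. \<sigma> (g (2 * j)) = g (2 * j + 1)"
      using psubset.IH[of ?W] by blast
    let ?g = "g(2 * n := v, 2 * n + 1 := \<sigma> v)"
    have 1: "bij_betw ?g {..<2 * n} ?W"
      using g(1) by (rule bij_betw_cong[THEN iffD1, rotated]) auto
    have "bij_betw ?g ({..<2 * n} \<union> {2 * n, 2 * n + 1}) (?W \<union> {v, \<sigma> v})"
      by (rule bij_betw_combine[OF 1]) (use sv in \<open>auto simp: bij_betw_def\<close>)
    moreover have "{..<2 * n} \<union> {2 * n, 2 * n + 1} = {..<2 * Suc n}" by auto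
    moreover have "?W \<union> {v, \<sigma> v} = W" using v sv by blast
    moreover have "\<sigma> (?g (2 * j)) = ?g (2 * j + 1)" if "j < Suc n" for j
      using that g(2) by (cases "j = n") auto
    ultimately show ?thesis by metis
  qed
qed

text \<open>The fixed points receive the labels below 6 and the two points of each transposition
  receive \<open>6 + 2 * j\<close> and \<open>7 + 2 * j\<close>. In these labels the automorphism is
  \<open>swap\<close>.\<close>

lemma involution_labelling:
  assumes G: "directed_strongly_regular_graph G 22 9 6 3 4" and inv: "has_involution_fixing 6 G"
  obtains f A where "labels f A G" "swap_invariant A"
proof -
  interpret directed_strongly_regular_graph G 22 9 6 3 4 by fact
  interpret AG: group "digraph_AutoGroup G" by (rule group_digraph_AutoGroup)
  obtain \<sigma> where \<sigma>: "\<sigma> \<in> carrier (digraph_AutoGroup G)" "AG.ord \<sigma> = 2"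
    "card {x \<in> pverts G. \<sigma> x = x} = 6"
    using inv by (auto simp: has_involution_fixing_def)
  have aut: "\<sigma> \<in> digraph_auto G" using \<sigma>(1) by (simp add: digraph_AutoGroup_def)
  then have bij: "bij_betw \<sigma> (pverts G) (pverts G)" by (simp add: digraph_auto_def Bij_def)
  have "\<sigma> [^]\<^bsub>digraph_AutoGroup G\<^esub> (2::nat) = \<one>\<^bsub>digraph_AutoGroup G\<^esub>"
    using AG.pow_ord_eq_1[OF \<sigma>(1)] \<sigma>(2) by simp
  then have "\<sigma> \<otimes>\<^bsub>digraph_AutoGroup G\<^esub> \<sigma> = \<one>\<^bsub>digraph_AutoGroup G\<^esub>"
    using \<sigma>(1) by (simp add: numeral_2_eq_2)
  then have "compose (pverts G) \<sigma> \<sigma> = (\<lambda>x\<in>pverts G. x)"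
    using aut by (simp add: digraph_AutoGroup_def BijGroup_def digraph_auto_def)
  then have \<sigma>\<sigma>: "\<sigma> (\<sigma> v) = v" if "v \<in> pverts G" for v
    using that by (metis compose_eq restrict_apply')
  have \<sigma>V: "\<sigma> v \<in> pverts G" if "v \<in> pverts G" for v using bij that bij_betwE by blast
  let ?F = "{x \<in> pverts G. \<sigma> x = x}" and ?W = "{x \<in> pverts G. \<sigma> x \<noteq> x}"
  have finV: "finite (pverts G)" by simp
  have "card ?F + card ?W = 22"
  proof -
    have "card (?F \<union> ?W) = card ?F + card ?W" by (rule card_Un_disjoint) (use finV in auto)
    moreover have "?F \<union> ?W = pverts G" by blast
    ultimately show ?thesis using order by simp
  qed
  then have cW: "card ?W = 16" using \<sigma>(3) by simp
  obtain h where h: "bij_betw h {..<6::nat} ?F"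
    using ex_bij_betw_nat_finite[of ?F] finV \<sigma>(3) by (auto simp: atLeast0LessThan)
  have "\<exists>(n::nat) g. bij_betw g {..<2 * n} ?W \<and> (\<forall>j<n. \<sigma> (g (2 * j)) = g (2 * j + 1))"
    by (rule free_involution_pairs) (use finV \<sigma>V \<sigma>\<sigma> in auto)
  then obtain n :: nat and g where g: "bij_betw g {..<2 * n} ?W" "\<forall>j<n. \<sigma> (g (2 * j)) = g (2 * j + 1)"
    by blast
  have n: "n = 8" using bij_betw_same_card[OF g(1)] cW by simp
  define f where "f x = (if x < 6 then h x else g (x - 6))" for x
  have "bij_betw f {..<6} ?F" using h by (rule bij_betw_cong[THEN iffD1, rotated]) (simp add: f_def)
  moreover have "bij_betw f {6..<22} ?W"
  proof -
    have "bij_betw (\<lambda>x. x - 6) {6..<22} {..<2 * n}"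
      unfolding n by (rule bij_betw_byWitness[where f' = "\<lambda>x. x + 6"]) auto
    from bij_betw_trans[OF this g(1)] show ?thesis
      by (rule bij_betw_cong[THEN iffD1, rotated]) (simp add: f_def)
  qed
  ultimately have "bij_betw f ({..<6} \<union> {6..<22}) (?F \<union> ?W)" by (rule bij_betw_combine) auto
  moreover have "{..<6} \<union> {6..<22} = {..<22::nat}" by auto
  moreover have "?F \<union> ?W = pverts G" by blast
  ultimately have f: "bij_betw f {..<22} (pverts G)" by simp
  define A where "A x y \<longleftrightarrow> (f x, f y) \<in> parcs G" for x y
  have l: "labels f A G" using f by (simp add: labels_def A_def)
  have fs: "f (swap x) = \<sigma> (f x)" if x: "x < 22" for x
  proof (cases "x < 6")
    case True
    then have "h x \<in> ?F" using h bij_betwE by blast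
    then show ?thesis using True by (simp add: f_def swap_def)
  next
    case False
    define j where "j = (x - 6) div 2"
    have j: "j < n" using x n False by (simp add: j_def)
    show ?thesis
    proof (cases "even x")
      case True
      then have x: "x = 6 + 2 * j" using False by (simp add: j_def)
      then show ?thesis using g(2) j by (simp add: f_def swap_def)
    next
      case odd: False
      then have x: "x = 6 + 2 * j + 1" using False unfolding j_def by presburger
      have "g (2 * j) \<in> ?W" using g(1) j by (auto dest!: bij_betwE)
      then have "\<sigma> (\<sigma> (g (2 * j))) = g (2 * j)" using \<sigma>\<sigma> by blast
      moreover have "\<sigma> (g (2 * j)) = g (2 * j + 1)" using g(2) j by blast
      ultimately show ?thesis using x by (simp add: f_def swap_def)
    qed
  qed
  have "A (swap x) (swap y) = A x y" if "x < 22" "y < 22" for x y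
    using aut fs that labels_in[OF l] unfolding A_def digraph_auto_def by auto
  then have "swap_invariant A" by (simp add: swap_invariant_def)
  with l show ?thesis using that by blast
qed

subsection \<open>Automorphism groups\<close>

text \<open>The isomorphism is conjugation by \<open>f\<close>. The restrictions keep the conjugates
  extensional, as membership in \<open>Bij\<close> demands.\<close>

lemma digraph_AutoGroup_iso:
  assumes f: "bij_betw f (pverts H) (pverts G)"
    and arcs: "\<And>x y. x \<in> pverts H \<Longrightarrow> y \<in> pverts H \<Longrightarrow> (f x, f y) \<in> parcs G \<longleftrightarrow> (x, y) \<in> parcs H"
  shows "digraph_AutoGroup H \<cong> digraph_AutoGroup G"
proof -
  let ?V = "pverts H" and ?W = "pverts G"
  define g where "g = inv_into ?V f"
  have gf: "g (f x) = x" if "x \<in> ?V" for x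
    using f that by (simp add: g_def bij_betw_inv_into_left)
  have fg: "f (g x) = x" if "x \<in> ?W" for x
    using f that by (simp add: g_def bij_betw_inv_into_right)
  have gb: "bij_betw g ?W ?V" unfolding g_def by (rule bij_betw_inv_into[OF f])
  have fV: "f x \<in> ?W" if "x \<in> ?V" for x using f that bij_betwE by blast
  have gW: "g x \<in> ?V" if "x \<in> ?W" for x using gb that bij_betwE by blast
  define h where "h \<sigma> = (\<lambda>x\<in>?W. f (\<sigma> (g x)))" for \<sigma> :: "'a \<Rightarrow> 'a"
  define k where "k \<tau> = (\<lambda>x\<in>?V. g (\<tau> (f x)))" for \<tau> :: "'b \<Rightarrow> 'b"
  have in_V: "\<sigma> x \<in> ?V" if "\<sigma> \<in> digraph_auto H" "x \<in> ?V" for \<sigma> x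
    using that by (auto simp: digraph_auto_def Bij_def bij_betw_def)
  have in_W: "\<tau> x \<in> ?W" if "\<tau> \<in> digraph_auto G" "x \<in> ?W" for \<tau> x
    using that by (auto simp: digraph_auto_def Bij_def bij_betw_def)
  have h_in: "h \<sigma> \<in> digraph_auto G" if \<sigma>: "\<sigma> \<in> digraph_auto H" for \<sigma>
  proof -
    have "bij_betw \<sigma> ?V ?V" using \<sigma> by (simp add: digraph_auto_def Bij_def)
    then have "bij_betw (f \<circ> (\<sigma> \<circ> g)) ?W ?W" using gb f by (blast intro: bij_betw_trans)
    then have "bij_betw (h \<sigma>) ?W ?W" by (rule bij_betw_cong[THEN iffD1, rotated]) (simp add: h_def)
    moreover have "(x, y) \<in> parcs G \<longleftrightarrow> (h \<sigma> x, h \<sigma> y) \<in> parcs G" if "x \<in> ?W" "y \<in> ?W" for x y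
    proof -
      have "(x, y) \<in> parcs G \<longleftrightarrow> (g x, g y) \<in> parcs H" using arcs[of "g x" "g y"] gW fg that by simp
      also have "\<dots> \<longleftrightarrow> (\<sigma> (g x), \<sigma> (g y)) \<in> parcs H" using \<sigma> gW that by (auto simp: digraph_auto_def)
      also have "\<dots> \<longleftrightarrow> (h \<sigma> x, h \<sigma> y) \<in> parcs G" using arcs in_V[OF \<sigma>] gW that by (simp add: h_def)
      finally show ?thesis .
    qed
    moreover have "h \<sigma> \<in> extensional ?W" by (simp add: h_def)
    ultimately show ?thesis by (simp add: digraph_auto_def Bij_def)
  qed
  have k_in: "k \<tau> \<in> digraph_auto H" if \<tau>: "\<tau> \<in> digraph_auto G" for \<tau>
  proof -
    have "bij_betw \<tau> ?W ?W" using \<tau> by (simp add: digraph_auto_def Bij_def)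
    then have "bij_betw (g \<circ> (\<tau> \<circ> f)) ?V ?V" using gb f by (blast intro: bij_betw_trans)
    then have "bij_betw (k \<tau>) ?V ?V" by (rule bij_betw_cong[THEN iffD1, rotated]) (simp add: k_def)
    moreover have "(x, y) \<in> parcs H \<longleftrightarrow> (k \<tau> x, k \<tau> y) \<in> parcs H" if "x \<in> ?V" "y \<in> ?V" for x y
    proof -
      have "(x, y) \<in> parcs H \<longleftrightarrow> (f x, f y) \<in> parcs G" using arcs that by simp
      also have "\<dots> \<longleftrightarrow> (\<tau> (f x), \<tau> (f y)) \<in> parcs G" using \<tau> fV that by (auto simp: digraph_auto_def)
      also have "\<dots> \<longleftrightarrow> (k \<tau> x, k \<tau> y) \<in> parcs H"
        using arcs[of "g (\<tau> (f x))" "g (\<tau> (f y))"] in_W[OF \<tau>] gW fV fg that by (simp add: k_def)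
      finally show ?thesis .
    qed
    moreover have "k \<tau> \<in> extensional ?V" by (simp add: k_def)
    ultimately show ?thesis by (simp add: digraph_auto_def Bij_def)
  qed
  have "k (h \<sigma>) = \<sigma>" if \<sigma>: "\<sigma> \<in> digraph_auto H" for \<sigma>
  proof (rule extensionalityI[of _ ?V])
    show "\<sigma> \<in> extensional ?V" using \<sigma> by (simp add: digraph_auto_def Bij_def)
  qed (use gf fV in_V[OF \<sigma>] in \<open>auto simp: k_def h_def\<close>)
  moreover have "h (k \<tau>) = \<tau>" if \<tau>: "\<tau> \<in> digraph_auto G" for \<tau>
  proof (rule extensionalityI[of _ ?W])
    show "\<tau> \<in> extensional ?W" using \<tau> by (simp add: digraph_auto_def Bij_def)
  qed (use fg gW in_W[OF \<tau>] in \<open>auto simp: k_def h_def\<close>)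
  ultimately have "bij_betw h (digraph_auto H) (digraph_auto G)"
    using h_in k_in by (intro bij_betw_byWitness[where f' = k]) auto
  moreover have "h (compose ?V \<sigma> \<sigma>') = compose ?W (h \<sigma>) (h \<sigma>')"
    if "\<sigma> \<in> digraph_auto H" "\<sigma>' \<in> digraph_auto H" for \<sigma> \<sigma>'
    using gf gW fV in_V that by (auto simp: h_def compose_def fun_eq_iff)
  ultimately have "h \<in> iso (digraph_AutoGroup H) (digraph_AutoGroup G)"
    using h_in by (auto simp: iso_def hom_def digraph_AutoGroup_def BijGroup_def digraph_auto_def)
  then show ?thesis by (rule is_isoI)
qed

text \<open>The map from \<open>(i, j)\<close> to the product of the powers of \<open>a\<close> and
  \<open>b\<close> is well defined modulo \<open>m\<close> and \<open>n\<close>, respects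
  multiplication because \<open>a\<close> and \<open>b\<close> commute, and is onto by
  counting.\<close>

lemma iso_two_cyclic_factors:
  fixes G (structure) and m n :: nat
  assumes "group G" "finite (carrier G)" "0 < m" "0 < n"
    and a: "a \<in> carrier G" "a [^]\<^bsub>G\<^esub> m = \<one>\<^bsub>G\<^esub>"
    and b: "b \<in> carrier G" "b [^]\<^bsub>G\<^esub> n = \<one>\<^bsub>G\<^esub>"
    and ab: "a \<otimes>\<^bsub>G\<^esub> b = b \<otimes>\<^bsub>G\<^esub> a"
    and inj: "inj_on (\<lambda>(i, j). a [^]\<^bsub>G\<^esub> i \<otimes>\<^bsub>G\<^esub> b [^]\<^bsub>G\<^esub> j) ({..<m} \<times> {..<n})"
    and card: "card (carrier G) \<le> m * n"
  shows "integer_mod_group m \<times>\<times> integer_mod_group n \<cong> G"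
proof -
  interpret group G by fact
  define h where "h = (\<lambda>(i, j). a [^] (nat i) \<otimes> b [^] (nat j))"
  have pow_mod: "c [^] nat ((i + j) mod int k) = c [^] nat i \<otimes> c [^] nat j"
    if c: "c \<in> carrier G" "c [^] k = \<one>" and ij: "0 \<le> i" "0 \<le> j" and k: "0 < k" for c i j and k :: nat
  proof -
    define s where "s = nat i + nat j"
    have "nat ((i + j) mod int k) = s mod k" using ij by (simp add: s_def nat_mod_distrib nat_add_distrib)
    moreover have "c [^] (k * (s div k)) \<otimes> c [^] (s mod k) = c [^] s" using c by (simp add: nat_pow_mult)
    moreover have "c [^] (k * (s div k)) = \<one>" using c by (simp flip: nat_pow_pow)
    ultimately have "c [^] nat ((i + j) mod int k) = c [^] s" using c by simp
    then show ?thesis using c by (simp add: s_def nat_pow_mult)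
  qed
  have comm: "b [^] j \<otimes> a [^] i = a [^] i \<otimes> b [^] j" for i j :: nat
  proof -
    have "a [^] i \<otimes> b = b \<otimes> a [^] i" using a b ab by (intro group_commutes_pow) auto
    then show ?thesis using a b by (intro group_commutes_pow) auto
  qed
  let ?Z = "integer_mod_group m \<times>\<times> integer_mod_group n"
  have carr: "carrier ?Z = {0..<int m} \<times> {0..<int n}"
    using assms(3,4) by (simp add: DirProd_def integer_mod_group_def)
  have h_in: "h x \<in> carrier G" for x using a b by (cases x) (simp add: h_def)
  have "h (x \<otimes>\<^bsub>?Z\<^esub> y) = h x \<otimes> h y" if "x \<in> carrier ?Z" "y \<in> carrier ?Z" for x y
  proof -
    obtain i j i' j' where xy: "x = (i, j)" "y = (i', j')" by (metis surj_pair)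
    have ij: "0 \<le> i" "0 \<le> j" "0 \<le> i'" "0 \<le> j'" using that unfolding carr xy by auto
    have "h (x \<otimes>\<^bsub>?Z\<^esub> y) = (a [^] nat i \<otimes> a [^] nat i') \<otimes> (b [^] nat j \<otimes> b [^] nat j')"
      using pow_mod[OF a ij(1,3) assms(3)] pow_mod[OF b ij(2,4) assms(4)] by (simp add: h_def xy DirProd_def)
    also have "\<dots> = a [^] nat i \<otimes> (a [^] nat i' \<otimes> b [^] nat j) \<otimes> b [^] nat j'"
      using a b by (simp add: m_assoc)
    also have "\<dots> = a [^] nat i \<otimes> (b [^] nat j \<otimes> a [^] nat i') \<otimes> b [^] nat j'"
      by (simp only: comm)
    also have "\<dots> = h x \<otimes> h y"
      using a b by (simp add: h_def xy m_assoc)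
    finally show ?thesis .
  qed
  then have "h \<in> hom ?Z G" using h_in by (auto simp: hom_def)
  moreover have inj_h: "inj_on h (carrier ?Z)"
  proof (rule inj_onI)
    fix x y assume xy: "x \<in> carrier ?Z" "y \<in> carrier ?Z" "h x = h y"
    have "(nat (fst x), nat (snd x)) = (nat (fst y), nat (snd y))"
      by (rule inj_onD[OF inj]) (use xy[unfolded carr] in \<open>auto simp: h_def split_beta\<close>)
    then show "x = y" using xy(1,2) unfolding carr by (auto simp: prod_eq_iff)
  qed
  moreover have "h ` carrier ?Z = carrier G"
  proof (rule card_seteq)
    show "h ` carrier ?Z \<subseteq> carrier G" using h_in by blast
    have "card (h ` carrier ?Z) = m * n" using card_image[OF inj_h] unfolding carr by simp
    then show "card (carrier G) \<le> card (h ` carrier ?Z)" using card by simp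
  qed (use assms(2) in auto)
  ultimately have "h \<in> iso ?Z G" by (auto simp: iso_def bij_betw_def)
  then show ?thesis by (rule is_isoI)
qed

lemma trivial_factor_iso: "integer_mod_group m \<times>\<times> integer_mod_group 1 \<cong> integer_mod_group m"
proof (rule is_isoI)
  have "inj_on fst (carrier (integer_mod_group m \<times>\<times> integer_mod_group 1))"
    by (auto simp: inj_on_def DirProd_def carrier_integer_mod_group)
  moreover have "fst ` carrier (integer_mod_group m \<times>\<times> integer_mod_group 1) = carrier (integer_mod_group m)"
    by (auto simp: DirProd_def carrier_integer_mod_group image_iff)
  moreover have "fst \<in> hom (integer_mod_group m \<times>\<times> integer_mod_group 1) (integer_mod_group m)"
    by (auto simp: hom_def DirProd_def)
  ultimately show "fst \<in> iso (integer_mod_group m \<times>\<times> integer_mod_group 1) (integer_mod_group m)"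
    by (simp only: iso_def bij_betw_def mem_Collect_eq)
qed

lemma card_integer_mod_group: "0 < n \<Longrightarrow> card (carrier (integer_mod_group n)) = n"
  by (simp add: carrier_integer_mod_group)

text \<open>The orders 2, 4, 4 and 8 separate these pairs.\<close>

lemma integer_mod_groups_not_iso:
  "\<not> integer_mod_group 2 \<cong> integer_mod_group 4"
  "\<not> integer_mod_group 2 \<cong> integer_mod_group 2 \<times>\<times> integer_mod_group 2"
  "\<not> integer_mod_group 2 \<cong> integer_mod_group 4 \<times>\<times> integer_mod_group 2"
  "\<not> integer_mod_group 4 \<cong> integer_mod_group 4 \<times>\<times> integer_mod_group 2"
  "\<not> integer_mod_group 2 \<times>\<times> integer_mod_group 2 \<cong> integer_mod_group 4 \<times>\<times> integer_mod_group 2"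
  by (rule notI, drule iso_same_card, simp add: card_integer_mod_group card_cartesian_product)+

text \<open>Every square in the product is trivial, so an isomorphism would send both 0 = 0 + 0 and
  2 = 1 + 1 to the neutral element.\<close>

lemma integer_mod_group_4_not_iso: "\<not> integer_mod_group 4 \<cong> integer_mod_group 2 \<times>\<times> integer_mod_group 2"
proof
  let ?V = "integer_mod_group 2 \<times>\<times> integer_mod_group 2"
  assume "integer_mod_group 4 \<cong> ?V"
  then obtain h where h: "h \<in> iso (integer_mod_group 4) ?V" by (auto simp: is_iso_def)
  have c: "carrier (integer_mod_group 4) = {0..<4}" by (simp add: carrier_integer_mod_group)
  have hom: "h ((x + y) mod 4) = h x \<otimes>\<^bsub>?V\<^esub> h y" if "x \<in> {0..<4}" "y \<in> {0..<4}" for x y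
    using h that by (auto simp: iso_def hom_def c)
  have sq: "v \<otimes>\<^bsub>?V\<^esub> v = (0, 0)" if "v \<in> carrier ?V" for v
    using that by (auto simp: DirProd_def carrier_integer_mod_group simp flip: mult_2)
  have hc: "h x \<in> carrier ?V" if "x \<in> {0..<4}" for x using h that by (auto simp: iso_def hom_def c Pi_iff)
  have "h 2 = (0, 0)" using hom[of 1 1] sq[OF hc[of 1]] by simp
  moreover have "h 0 = (0, 0)" using hom[of 0 0] sq[OF hc[of 0]] by simp
  moreover have "inj_on h {0..<4}" using h by (simp add: iso_def bij_betw_def c)
  ultimately show False by (auto dest: inj_onD[of _ _ 0 2])
qed

subsection \<open>Automorphisms of matrices\<close>

definition mat_graph :: "(nat \<Rightarrow> nat \<Rightarrow> bool) \<Rightarrow> nat pair_pre_digraph" where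
  "mat_graph A = \<lparr>pverts = {..<22}, parcs = {(x, y). x < 22 \<and> y < 22 \<and> A x y}\<rparr>"

definition mat_fun :: "'a list list \<Rightarrow> nat \<Rightarrow> nat \<Rightarrow> 'a" where
  "mat_fun M x y = M ! x ! y"

definition square22 :: "bool list list \<Rightarrow> bool" where
  "square22 M \<longleftrightarrow> length M = 22 \<and> (\<forall>r\<in>set M. length r = 22)"

definition colour :: "(nat \<Rightarrow> nat \<Rightarrow> bool) \<Rightarrow> nat \<Rightarrow> nat \<times> nat" where
  "colour A v = (card {i. i < 22 \<and> card {z. z < 22 \<and> A v z \<and> A i z} = 4},
     card {i. i < 22 \<and> card {z. z < 22 \<and> A z v \<and> A z i} = 4})"

definition invariant :: "(nat \<Rightarrow> nat \<Rightarrow> bool) \<Rightarrow> int" where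
  "invariant A = (\<Sum>v<22. (3 * int (fst (colour A v)) + int (snd (colour A v)))\<^sup>2)"

lemma card_permuted:
  assumes "bij_betw p {..<n} {..<n}"
  shows "card {i. i < n \<and> P (p i)} = card {i. i < n \<and> P i}"
proof -
  have "bij_betw p {i. i < n \<and> P (p i)} {i. i < n \<and> P i}"
    using assms by (auto simp: bij_betw_def inj_on_def image_iff)
  then show ?thesis by (rule bij_betw_same_card)
qed

lemma colour_permuted:
  assumes p: "bij_betw p {..<22} {..<22}" and A: "\<And>x y. x < 22 \<Longrightarrow> y < 22 \<Longrightarrow> A' (p x) (p y) = A x y" and v: "v < 22"
  shows "colour A' (p v) = colour A v"
proof -
  have "card {z. z < 22 \<and> A' (p v) z \<and> A' (p i) z} = card {z. z < 22 \<and> A v z \<and> A i z}"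
    "card {z. z < 22 \<and> A' z (p v) \<and> A' z (p i)} = card {z. z < 22 \<and> A z v \<and> A z i}" if "i < 22" for i
    using card_permuted[OF p, of "\<lambda>z. A' (p v) z \<and> A' (p i) z"] card_permuted[OF p, of "\<lambda>z. A' z (p v) \<and> A' z (p i)"]
      A v that by (simp_all cong: conj_cong)
  then show ?thesis
    using card_permuted[OF p, of "\<lambda>i. card {z. z < 22 \<and> A' (p v) z \<and> A' i z} = 4"]
      card_permuted[OF p, of "\<lambda>i. card {z. z < 22 \<and> A' z (p v) \<and> A' z i} = 4"]
    by (simp add: colour_def cong: conj_cong)
qed

lemma invariant_permuted:
  assumes p: "bij_betw p {..<22} {..<22}" and A: "\<And>x y. x < 22 \<Longrightarrow> y < 22 \<Longrightarrow> A' (p x) (p y) = A x y"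
  shows "invariant A' = invariant A"
  unfolding invariant_def using colour_permuted[where A' = A' and A = A, OF p A]
  by (subst sum.reindex_bij_betw[OF p, symmetric]) simp

lemma card_less_Suc_shift: "card {j. j < Suc n \<and> P j} = of_bool (P 0) + card {j. j < n \<and> P (Suc j)}"
proof -
  have "{j. j < Suc n \<and> P j} = {j. j = 0 \<and> P 0} \<union> Suc ` {j. j < n \<and> P (Suc j)}"
    by (auto simp: less_Suc_eq_0_disj)
  also have "card \<dots> = of_bool (P 0) + card {j. j < n \<and> P (Suc j)}"
    by (subst card_Un_disjoint) (auto simp: card_image)
  finally show ?thesis .
qed

lemma meet_eq_card:
  assumes "length xs = n" "length ys = n"
  shows "meet xs ys = card {i. i < n \<and> xs ! i \<and> ys ! i}"
proof -
  have "{..<n} \<inter> {i. xs ! i \<and> ys ! i} = {i. i < n \<and> xs ! i \<and> ys ! i}" by auto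
  then show ?thesis by (simp add: meet_eq_sum[OF assms])
qed

lemma count_meet_eq: "count_meet n r ss = card {i. i < length ss \<and> meet r (ss ! i) = n}"
proof (induction ss)
  case (Cons s ss)
  show ?case by (simp add: Cons card_less_Suc_shift)
qed simp

lemma colours_eq:
  "length rs = length cs \<Longrightarrow> colours P Q rs cs = map2 (\<lambda>r c. (count_meet 4 r P, count_meet 4 c Q)) rs cs"
  by (induction P Q rs cs rule: colours.induct) auto

lemma colour_key_eq: "colour_key cs = (\<Sum>v<length cs. (3 * int (fst (cs ! v)) + int (snd (cs ! v)))\<^sup>2)"
  by (induction cs rule: colour_key.induct) (simp_all add: sum.lessThan_Suc_shift del: sum.lessThan_Suc)

lemma consistent_if_iff: "consistent_if b r c r' c' p \<longleftrightarrow> b \<and> consistent r c r' c' p"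
  by (cases b) auto

lemma consistentI:
  assumes "length p \<le> length r" "length p \<le> length c" "\<And>j. j < length p \<Longrightarrow> r ! j = r' ! (p ! j) \<and> c ! j = c' ! (p ! j)"
  shows "consistent r c r' c' p"
  using assms
proof (induction p arbitrary: r c)
  case (Cons q p)
  obtain a r1 b c1 where rc: "r = a # r1" "c = b # c1" using Cons.prems(1,2) by (cases r; cases c) auto
  have "consistent r1 c1 r' c' p"
  proof (rule Cons.IH)
    fix j assume "j < length p"
    then show "r1 ! j = r' ! (p ! j) \<and> c1 ! j = c' ! (p ! j)" using Cons.prems(3)[of "Suc j"] rc by simp
  qed (use Cons.prems(1,2) rc in auto)
  moreover have "a = r' ! q" "b = c' ! q" using Cons.prems(3)[of 0] rc by auto
  ultimately show ?case by (simp add: rc consistent_if_iff)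
qed simp

lemma aut_filterI:
  assumes "i < length rs" "length cs = length rs" "length ks = length rs" "k = ks ! i" "consistent r c (rs ! i) (cs ! i) p"
  shows "y + i \<in> set (aut_filter r c k p y rs cs ks)"
  using assms
proof (induction r c k p y rs cs ks arbitrary: i rule: aut_filter.induct)
  case (1 r c k p y r' rs c' cs k' ks)
  show ?case
  proof (cases i)
    case 0
    then show ?thesis using 1 by (simp add: consistent_if_iff)
  next
    case (Suc j)
    then show ?thesis using "1.IH"[of j] "1.prems" by auto
  qed
qed auto

definition perm_fun :: "nat list \<Rightarrow> nat \<Rightarrow> nat" where
  "perm_fun p = (\<lambda>i\<in>{..<22}. p ! i)"

lemma is_perm_bij:
  assumes "is_perm n p"
  shows "bij_betw ((!) p) {..<n} {..<n}"
proof (rule bij_betw_imageI)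
  have p: "length p = n" "distinct p" "list_all (\<lambda>i. i < n) p" using assms by auto
  show inj: "inj_on ((!) p) {..<n}" using p(1,2) by (simp add: inj_on_nth)
  show "(!) p ` {..<n} = {..<n}"
    by (rule card_subset_eq) (use p inj in \<open>auto simp: list_all_length card_image\<close>)
qed

text \<open>\<open>select q p\<close> reads \<open>p\<close> at the entries of \<open>q\<close>,
  which applies \<open>q\<close> first; hence the reversed order.\<close>

lemma perm_fun_mult:
  assumes "length p = 22" "length q = 22" "list_all (\<lambda>i. i < 22) q"
  shows "compose {..<22} (perm_fun p) (perm_fun q) = perm_fun (select q p)"
  using assms by (auto simp: compose_def perm_fun_def fun_eq_iff list_all_length)

lemma perm_fun_inject:
  assumes "length p = 22" "length q = 22" "perm_fun p = perm_fun q"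
  shows "p = q"
proof (rule nth_equalityI)
  fix i assume "i < length p"
  then show "p ! i = q ! i" using fun_cong[OF assms(3), of i] assms(1) by (simp add: perm_fun_def)
qed (use assms in auto)

lemma perm_pow_0: "perm_pow p 0 = [0..<22]"
  by (simp add: upt_rec)

context
  fixes M :: "bool list list"
  assumes M: "square22 M"
begin

lemma length_M: "length M = 22"
  using M by (simp add: square22_def)

lemma length_row: "i < 22 \<Longrightarrow> length (M ! i) = 22"
  using M by (simp add: square22_def)

lemma length_cols_of: "length (cols_of M) = 22"
  by (simp add: cols_of_def)

lemma nth_cols_of: "j < 22 \<Longrightarrow> cols_of M ! j = map (\<lambda>r. r ! j) M"
  by (simp add: cols_of_def nth_all_eq)

lemma length_col: "j < 22 \<Longrightarrow> length (cols_of M ! j) = 22"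
  by (simp add: nth_cols_of length_M)

lemma nth_col: "i < 22 \<Longrightarrow> j < 22 \<Longrightarrow> cols_of M ! j ! i = M ! i ! j"
  by (simp add: nth_cols_of length_M)

lemma length_colouring: "length (colouring M) = 22"
  by (simp add: colouring_def colours_eq length_M length_cols_of)

lemma nth_colouring:
  assumes v: "v < 22"
  shows "colouring M ! v = colour (mat_fun M) v"
proof -
  have "count_meet 4 (M ! v) M = card {i. i < 22 \<and> card {z. z < 22 \<and> mat_fun M v z \<and> mat_fun M i z} = 4}"
    using v by (simp add: count_meet_eq length_M meet_eq_card[OF length_row length_row] mat_fun_def cong: conj_cong)
  moreover have "count_meet 4 (cols_of M ! v) (cols_of M) =
      card {i. i < 22 \<and> card {z. z < 22 \<and> mat_fun M z v \<and> mat_fun M z i} = 4}"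
    using v by (simp add: count_meet_eq length_cols_of meet_eq_card[OF length_col length_col] nth_col mat_fun_def cong: conj_cong)
  ultimately show ?thesis
    using v by (simp add: colouring_def colours_eq length_M length_cols_of colour_def)
qed

lemma colour_key_invariant: "colour_key (colouring M) = invariant (mat_fun M)"
  by (simp add: colour_key_eq invariant_def length_colouring nth_colouring)

text \<open>An automorphism preserves the colours and the adjacency with all earlier vertices in
  both directions, so its list of images passes every filter.\<close>

lemma aut_search_complete:
  assumes p: "bij_betw p {..<22} {..<22}" and inv: "\<And>x y. x < 22 \<Longrightarrow> y < 22 \<Longrightarrow> mat_fun M (p x) (p y) = mat_fun M x y"
  shows "map p [0..<22] \<in> set (aut_search M)"
  unfolding aut_search_def
proof (rule dfs_complete)
  fix m assume "m < length (map p [0..<22])"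
  then have m: "m < 22" by simp
  have less: "p x < 22" if "x < 22" for x using p that bij_betwE by fastforce
  have take: "take m (map p [0..<22]) = map p [0..<m]" using m by (simp add: take_map)
  \<comment> \<open>The summand 0 is the index at which \<open>aut_filter\<close> starts to count,
    as \<open>aut_filterI\<close> expects.\<close>
  have "0 + p m \<in> set (aut_filter (M ! m) (cols_of M ! m) (colouring M ! m) (map p [0..<m]) 0 M (cols_of M) (colouring M))"
  proof (rule aut_filterI)
    show "colouring M ! m = colouring M ! p m"
      using colour_permuted[of p "mat_fun M" "mat_fun M", OF p inv m] m less by (simp add: nth_colouring)
    show "consistent (M ! m) (cols_of M ! m) (M ! p m) (cols_of M ! p m) (map p [0..<m])"
    proof (rule consistentI)
      fix j assume "j < length (map p [0..<m])"
      then have j: "j < m" by simp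
      then show "M ! m ! j = M ! p m ! (map p [0..<m] ! j) \<and> cols_of M ! m ! j = cols_of M ! p m ! (map p [0..<m] ! j)"
        using inv[of m j] inv[of j m] m less by (simp add: nth_col mat_fun_def)
    qed (use m in \<open>auto simp: length_row length_col\<close>)
  qed (use less m in \<open>auto simp: length_M length_cols_of length_colouring\<close>)
  then show "map p [0..<22] ! m \<in> set (aut_cand M (cols_of M) (colouring M) (take m (map p [0..<22])))"
    using m by (simp add: take)
qed simp_all

lemma digraph_auto_mat:
  assumes "p \<in> digraph_auto (mat_graph (mat_fun M))"
  shows "bij_betw p {..<22} {..<22}" "x < 22 \<Longrightarrow> y < 22 \<Longrightarrow> mat_fun M (p x) (p y) = mat_fun M x y"
proof -
  show b: "bij_betw p {..<22} {..<22}" using assms by (simp add: digraph_auto_def Bij_def mat_graph_def)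
  show "mat_fun M (p x) (p y) = mat_fun M x y" if "x < 22" "y < 22"
  proof -
    have "p x < 22" "p y < 22" using b that bij_betwE by fastforce+
    then show ?thesis using assms that by (auto simp: digraph_auto_def mat_graph_def)
  qed
qed

lemma card_digraph_auto:
  "finite (digraph_auto (mat_graph (mat_fun M)))" "card (digraph_auto (mat_graph (mat_fun M))) \<le> length (aut_search M)"
proof -
  let ?S = "digraph_auto (mat_graph (mat_fun M))" and ?h = "\<lambda>p. map p [0..<22]"
  have sub: "?h ` ?S \<subseteq> set (aut_search M)" using digraph_auto_mat aut_search_complete by blast
  have inj: "inj_on ?h ?S"
  proof (rule inj_onI)
    fix p q assume pq: "p \<in> ?S" "q \<in> ?S" "?h p = ?h q"
    have "p x = q x" if "x < 22" for x using pq(3) that by (simp add: map_eq_conv)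
    then show "p = q" using pq(1,2)
      by (intro extensionalityI[of p "{..<22}" q]) (auto simp: digraph_auto_def Bij_def mat_graph_def)
  qed
  show "finite ?S" using sub inj finite_imageD finite_subset by blast
  have "card ?S = card (?h ` ?S)" by (simp add: card_image[OF inj])
  also have "\<dots> \<le> card (set (aut_search M))" by (rule card_mono[OF _ sub]) simp
  also have "\<dots> \<le> length (aut_search M)" by (rule card_length)
  finally show "card ?S \<le> length (aut_search M)" .
qed

lemma perm_fun_auto:
  assumes "is_aut M p"
  shows "perm_fun p \<in> digraph_auto (mat_graph (mat_fun M))"
proof -
  have p: "length p = 22" "distinct p" "list_all (\<lambda>i. i < 22) p" "select_rows p (select p M) = M"
    using assms by auto
  have "bij_betw (perm_fun p) {..<22} {..<22}"
    using is_perm_bij[of 22 p] p(1-3) by (subst bij_betw_cong[of _ "perm_fun p" "(!) p"]) (simp_all add: perm_fun_def)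
  moreover have "M ! (p ! x) ! (p ! y) = M ! x ! y" if "x < 22" "y < 22" for x y
    using that p(1) by (subst (2) p(4)[symmetric]) simp
  ultimately show ?thesis using p(1,3)
    by (auto simp: digraph_auto_def Bij_def mat_graph_def mat_fun_def perm_fun_def list_all_length)
qed

lemma aut_ok_iso:
  assumes ok: "aut_ok M (m, n) a b" and mn: "0 < m" "0 < n"
  shows "integer_mod_group m \<times>\<times> integer_mod_group n \<cong> digraph_AutoGroup (mat_graph (mat_fun M))"
proof -
  let ?G = "digraph_AutoGroup (mat_graph (mat_fun M))"
  interpret group ?G by (rule group_digraph_AutoGroup)
  have ab: "is_aut M a" "is_aut M b" "perm_pow a m = perm_pow a 0" "perm_pow b n = perm_pow b 0"
    "select a b = select b a" "distinct (perm_products a b m n)" "length (aut_search M) \<le> m * n"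
    using ok by auto
  have carr: "carrier ?G = digraph_auto (mat_graph (mat_fun M))" by (simp add: digraph_AutoGroup_def)
  have mult: "f \<otimes>\<^bsub>?G\<^esub> g = compose {..<22} f g" if "f \<in> carrier ?G" "g \<in> carrier ?G" for f g
    using that by (simp add: carr, simp add: digraph_AutoGroup_def BijGroup_def digraph_auto_def mat_graph_def)
  have one: "\<one>\<^bsub>?G\<^esub> = perm_fun [0..<22]"
    by (auto simp: digraph_AutoGroup_def BijGroup_def mat_graph_def perm_fun_def fun_eq_iff)
  have pow: "perm_fun p [^]\<^bsub>?G\<^esub> i = perm_fun (perm_pow p i) \<and> length (perm_pow p i) = 22 \<and> list_all (\<lambda>i. i < 22) (perm_pow p i)"
    if p: "is_aut M p" for p and i :: nat
  proof (induction i)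
    case 0
    show ?case by (simp only: perm_pow_0) (simp add: one list_all_iff)
  next
    case (Suc i)
    have pG: "perm_fun p \<in> carrier ?G" using perm_fun_auto[OF p] by (simp add: carr)
    \<comment> \<open>\<open>perm_pow\<close> adds the new factor on the left, whereas the power in
      the group adds it on the right.\<close>
    have "perm_fun p [^]\<^bsub>?G\<^esub> Suc i = perm_fun p \<otimes>\<^bsub>?G\<^esub> perm_fun p [^]\<^bsub>?G\<^esub> i"
      using pG by (rule nat_pow_Suc2)
    also have "\<dots> = perm_fun (perm_pow p (Suc i))"
      using Suc p pG nat_pow_closed[OF pG, of i] by (simp add: mult perm_fun_mult)
    finally show ?case using Suc p by (auto simp: list_all_length)
  qed
  show ?thesis
  proof (rule iso_two_cyclic_factors[OF is_group _ mn])
    show "finite (carrier ?G)" by (simp add: carr card_digraph_auto)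
    show aG: "perm_fun a \<in> carrier ?G" and bG: "perm_fun b \<in> carrier ?G"
      using perm_fun_auto ab(1,2) by (simp_all add: carr)
    show "perm_fun a [^]\<^bsub>?G\<^esub> m = \<one>\<^bsub>?G\<^esub>" "perm_fun b [^]\<^bsub>?G\<^esub> n = \<one>\<^bsub>?G\<^esub>"
      using pow ab(1-4) by (simp_all add: one perm_pow_0 del: perm_pow.simps)
    show "perm_fun a \<otimes>\<^bsub>?G\<^esub> perm_fun b = perm_fun b \<otimes>\<^bsub>?G\<^esub> perm_fun a"
      using ab(1,2,5) aG bG by (simp add: mult perm_fun_mult)
    show "card (carrier ?G) \<le> m * n" using card_digraph_auto(2) ab(7) by (simp add: carr)
    let ?q = "\<lambda>(i, j). select (perm_pow b j) (perm_pow a i)"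
    have "inj_on ?q (set (List.product [0..<m] [0..<n]))"
      using ab(6) by (simp add: perm_products.simps distinct_map)
    then have inj: "inj_on ?q ({..<m} \<times> {..<n})" by (simp add: atLeast0LessThan)
    have prod: "perm_fun a [^]\<^bsub>?G\<^esub> i \<otimes>\<^bsub>?G\<^esub> perm_fun b [^]\<^bsub>?G\<^esub> j = perm_fun (?q (i, j))" for i j :: nat
      using pow[OF ab(1), of i] pow[OF ab(2), of j] nat_pow_closed[OF aG, of i] nat_pow_closed[OF bG, of j]
      by (simp add: mult perm_fun_mult)
    show "inj_on (\<lambda>(i, j). perm_fun a [^]\<^bsub>?G\<^esub> i \<otimes>\<^bsub>?G\<^esub> perm_fun b [^]\<^bsub>?G\<^esub> j) ({..<m} \<times> {..<n})"
    proof (rule inj_onI)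
      fix x y assume xy: "x \<in> {..<m} \<times> {..<n}" "y \<in> {..<m} \<times> {..<n}"
        and eq: "(case x of (i, j) \<Rightarrow> perm_fun a [^]\<^bsub>?G\<^esub> i \<otimes>\<^bsub>?G\<^esub> perm_fun b [^]\<^bsub>?G\<^esub> j) =
          (case y of (i, j) \<Rightarrow> perm_fun a [^]\<^bsub>?G\<^esub> i \<otimes>\<^bsub>?G\<^esub> perm_fun b [^]\<^bsub>?G\<^esub> j)"
      have "length (?q x) = 22" "length (?q y) = 22" using pow[OF ab(2)] by (simp_all add: split_beta)
      moreover have "perm_fun (?q x) = perm_fun (?q y)" using eq by (simp only: prod split_beta prod.case prod.sel)
      ultimately have "?q x = ?q y" by (rule perm_fun_inject)
      then show "x = y" using inj xy by (blast dest: inj_onD)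
    qed
  qed
qed

end

subsection \<open>The orbit matrices\<close>

lemma sum_orbits:
  "(\<Sum>z<22. h z) = (\<Sum>z<6. h z) + (\<Sum>j<8. h (6 + 2 * j) + h (7 + 2 * j))" for h :: "nat \<Rightarrow> 'a::comm_monoid_add"
  by (simp add: eval_nat_numeral ac_simps)

lemma int_card_less: "int (card {z. z < n \<and> P z}) = (\<Sum>z<n. of_bool (P z))" for n :: nat
proof -
  have "{z. z < n \<and> P z} = {..<n} \<inter> {z. P z}" by auto
  then show ?thesis by simp
qed

locale swap_dsrg =
  fixes A :: "nat \<Rightarrow> nat \<Rightarrow> bool"
  assumes dsrg: "dsrg_mat A" and inv: "swap_invariant A"
begin

definition a :: "nat \<Rightarrow> nat \<Rightarrow> int" where
  "a x y = of_bool (A x y)"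

definition B :: "nat \<Rightarrow> nat \<Rightarrow> int" where
  "B i j = a i (6 + 2 * j)"

definition C :: "nat \<Rightarrow> nat \<Rightarrow> int" where
  "C j i = a (6 + 2 * j) i"

definition S :: "nat \<Rightarrow> nat \<Rightarrow> int" where
  "S j l = a (6 + 2 * j) (6 + 2 * l) + a (6 + 2 * j) (7 + 2 * l)"

definition T :: "nat \<Rightarrow> nat \<Rightarrow> int" where
  "T j l = a (6 + 2 * j) (6 + 2 * l) - a (6 + 2 * j) (7 + 2 * l)"

text \<open>The path counts 6, 3 and 4 are the entries of \<open>4 J - A + 2 I\<close>, since the
  diagonal of \<open>A\<close> is zero.\<close>

lemma paths:
  assumes "x < 22" "y < 22"
  shows "(\<Sum>z<22. a x z * a z y) = 4 - a x y + (if x = y then 2 else 0)"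
proof -
  have "(\<Sum>z<22. a x z * a z y) = int (card {z. z < 22 \<and> A x z \<and> A z y})"
    unfolding int_card_less by (simp add: a_def of_bool_conj)
  then show ?thesis using dsrg assms by (auto simp: dsrg_mat_def a_def)
qed

lemma out_sum: "x < 22 \<Longrightarrow> (\<Sum>z<22. a x z) = 9"
  using int_card_less[of 22 "A x"] dsrg by (simp add: dsrg_mat_def a_def)

lemma in_sum: "x < 22 \<Longrightarrow> (\<Sum>z<22. a z x) = 9"
  using int_card_less[of 22 "\<lambda>z. A z x"] dsrg by (simp add: dsrg_mat_def a_def)

lemma a_swap: "x < 22 \<Longrightarrow> y < 22 \<Longrightarrow> a (swap x) (swap y) = a x y"
  using inv by (simp add: swap_invariant_def a_def)

lemma swap_values: "swap (6 + 2 * j) = 7 + 2 * j" "swap (7 + 2 * j) = 6 + 2 * j" "i < 6 \<Longrightarrow> swap i = i"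
  by (simp_all add: swap_def)

text \<open>Invariance under \<open>swap\<close> expresses the second point of a pair through the
  first, so each pair can be represented by its even label.\<close>

lemma a_pairs:
  assumes "j < 8"
  shows "k < 6 \<Longrightarrow> a (7 + 2 * j) k = C j k" "k < 6 \<Longrightarrow> a k (7 + 2 * j) = B k j"
    "l < 8 \<Longrightarrow> a (7 + 2 * j) (7 + 2 * l) = a (6 + 2 * j) (6 + 2 * l)"
    "l < 8 \<Longrightarrow> a (7 + 2 * j) (6 + 2 * l) = a (6 + 2 * j) (7 + 2 * l)"
  using assms a_swap[of "6 + 2 * j" k] a_swap[of k "6 + 2 * j"] a_swap[of "6 + 2 * j" "6 + 2 * l"]
    a_swap[of "6 + 2 * j" "7 + 2 * l"] by (simp_all add: swap_values B_def C_def)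

text \<open>Both points of a transposed pair contribute the same paths between fixed points, hence
  the factor 2.\<close>

lemma fixed_paths:
  assumes "i < 6" "k < 6"
  shows "(\<Sum>z<6. a i z * a z k) + 2 * (\<Sum>j<8. B i j * C j k) = 4 - a i k + (if i = k then 2 else 0)"
proof -
  have "(\<Sum>j<8. a i (6 + 2 * j) * a (6 + 2 * j) k + a i (7 + 2 * j) * a (7 + 2 * j) k) = (\<Sum>j<8. 2 * (B i j * C j k))"
    by (rule sum.cong) (use assms in \<open>auto simp: a_pairs B_def C_def\<close>)
  then show ?thesis using paths[of i k] assms by (simp add: sum_orbits sum_distrib_left)
qed

lemma fixed_pair_paths:
  assumes "i < 6" "l < 8"
  shows "(\<Sum>z<6. a i z * B z l) + (\<Sum>j<8. B i j * S j l) = 4 - B i l"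
proof -
  have "(\<Sum>j<8. a i (6 + 2 * j) * a (6 + 2 * j) (6 + 2 * l) + a i (7 + 2 * j) * a (7 + 2 * j) (6 + 2 * l)) =
      (\<Sum>j<8. B i j * S j l)"
    by (rule sum.cong) (use assms in \<open>auto simp: a_pairs B_def S_def distrib_left distrib_right\<close>)
  then show ?thesis using paths[of i "6 + 2 * l"] assms by (simp add: sum_orbits B_def)
qed

lemma pair_fixed_paths:
  assumes "j < 8" "k < 6"
  shows "(\<Sum>z<6. C j z * a z k) + (\<Sum>m<8. S j m * C m k) = 4 - C j k"
proof -
  have "(\<Sum>m<8. a (6 + 2 * j) (6 + 2 * m) * a (6 + 2 * m) k + a (6 + 2 * j) (7 + 2 * m) * a (7 + 2 * m) k) =
      (\<Sum>m<8. S j m * C m k)"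
    by (rule sum.cong) (use assms in \<open>auto simp: a_pairs C_def S_def distrib_left distrib_right\<close>)
  then show ?thesis using paths[of "6 + 2 * j" k] assms by (simp add: sum_orbits C_def)
qed

text \<open>Writing the circulant blocks as \<open>(X, Y)\<close>, the path equation determines
  \<open>X X + Y Y\<close> and \<open>X Y + Y X\<close>. Their sum and difference are the squares of
  \<open>S = X + Y\<close> and \<open>T = X - Y\<close>; the constant 4 and the paths through fixed
  points cancel in the difference.\<close>

lemma pair_paths:
  assumes "j < 8" "l < 8"
  shows "2 * (\<Sum>z<6. C j z * B z l) + (\<Sum>m<8. S j m * S m l) = 8 - S j l + (if j = l then 2 else 0)" (is ?S)
    and "(\<Sum>m<8. T j m * T m l) = - T j l + (if j = l then 2 else 0)" (is ?T)
proof -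
  define X where "X u v = a (6 + 2 * u) (6 + 2 * v)" for u v
  define Y where "Y u v = a (6 + 2 * u) (7 + 2 * v)" for u v
  have "(\<Sum>m<8. a (6 + 2 * j) (6 + 2 * m) * a (6 + 2 * m) (6 + 2 * l) + a (6 + 2 * j) (7 + 2 * m) * a (7 + 2 * m) (6 + 2 * l)) =
      (\<Sum>m<8. X j m * X m l + Y j m * Y m l)"
    by (rule sum.cong) (use assms in \<open>auto simp: a_pairs X_def Y_def\<close>)
  then have 1: "(\<Sum>z<6. C j z * B z l) + (\<Sum>m<8. X j m * X m l + Y j m * Y m l) = 4 - X j l + (if j = l then 2 else 0)"
    using paths[of "6 + 2 * j" "6 + 2 * l"] assms by (simp add: sum_orbits B_def C_def X_def)
  have "(\<Sum>m<8. a (6 + 2 * j) (6 + 2 * m) * a (6 + 2 * m) (7 + 2 * l) + a (6 + 2 * j) (7 + 2 * m) * a (7 + 2 * m) (7 + 2 * l)) =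
      (\<Sum>m<8. X j m * Y m l + Y j m * X m l)"
    by (rule sum.cong) (use assms in \<open>auto simp: a_pairs X_def Y_def\<close>)
  moreover have "(\<Sum>z<6. a (6 + 2 * j) z * a z (7 + 2 * l)) = (\<Sum>z<6. C j z * B z l)"
    by (rule sum.cong) (use assms in \<open>auto simp: a_pairs C_def\<close>)
  \<comment> \<open>The second entry of a block never lies on the diagonal of \<open>A\<close>, so
    the summand 2 is absent.\<close>
  moreover have "6 + 2 * j \<noteq> 7 + 2 * l" by presburger
  ultimately have 2: "(\<Sum>z<6. C j z * B z l) + (\<Sum>m<8. X j m * Y m l + Y j m * X m l) = 4 - Y j l"
    using paths[of "6 + 2 * j" "7 + 2 * l"] assms by (simp add: sum_orbits Y_def)
  have st: "S u v = X u v + Y u v" "T u v = X u v - Y u v" for u v by (simp_all add: S_def T_def X_def Y_def)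
  have "(\<Sum>m<8. S j m * S m l) = (\<Sum>m<8. X j m * X m l + Y j m * Y m l) + (\<Sum>m<8. X j m * Y m l + Y j m * X m l)"
    "(\<Sum>m<8. T j m * T m l) = (\<Sum>m<8. X j m * X m l + Y j m * Y m l) - (\<Sum>m<8. X j m * Y m l + Y j m * X m l)"
    unfolding st by (simp_all add: algebra_simps flip: sum.distrib sum_subtractf)
  then show ?S ?T using 1 2 by (simp_all add: st)
qed

lemma degree_sums:
  "i < 6 \<Longrightarrow> (\<Sum>z<6. a i z) + 2 * (\<Sum>j<8. B i j) = 9"
  "i < 6 \<Longrightarrow> (\<Sum>z<6. a z i) + 2 * (\<Sum>j<8. C j i) = 9"
  "j < 8 \<Longrightarrow> (\<Sum>z<6. C j z) + (\<Sum>l<8. S j l) = 9"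
  "l < 8 \<Longrightarrow> (\<Sum>z<6. B z l) + (\<Sum>j<8. S j l) = 9"
proof -
  show "(\<Sum>z<6. a i z) + 2 * (\<Sum>j<8. B i j) = 9" if "i < 6"
  proof -
    have "(\<Sum>j<8. a i (6 + 2 * j) + a i (7 + 2 * j)) = (\<Sum>j<8. 2 * B i j)"
      by (rule sum.cong) (use that in \<open>auto simp: a_pairs B_def\<close>)
    then show ?thesis using out_sum[of i] that by (simp add: sum_orbits sum_distrib_left)
  qed
  show "(\<Sum>z<6. a z i) + 2 * (\<Sum>j<8. C j i) = 9" if "i < 6"
  proof -
    have "(\<Sum>j<8. a (6 + 2 * j) i + a (7 + 2 * j) i) = (\<Sum>j<8. 2 * C j i)"
      by (rule sum.cong) (use that in \<open>auto simp: a_pairs C_def\<close>)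
    then show ?thesis using in_sum[of i] that by (simp add: sum_orbits sum_distrib_left)
  qed
  show "(\<Sum>z<6. C j z) + (\<Sum>l<8. S j l) = 9" if "j < 8"
    using out_sum[of "6 + 2 * j"] that by (simp add: sum_orbits C_def S_def)
  show "(\<Sum>z<6. B z l) + (\<Sum>j<8. S j l) = 9" if "l < 8"
  proof -
    have "(\<Sum>j<8. a (6 + 2 * j) (6 + 2 * l) + a (7 + 2 * j) (6 + 2 * l)) = (\<Sum>j<8. S j l)"
      by (rule sum.cong) (use that in \<open>auto simp: a_pairs S_def\<close>)
    then show ?thesis using in_sum[of "6 + 2 * l"] that by (simp add: sum_orbits B_def)
  qed
qed

end

subsection \<open>Classification of the fixed part\<close>

text \<open>The weight is odd and at most 5. If \<open>z\<close> were the only out-neighbour of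
  \<open>i\<close>, there would be no path of length two from \<open>i\<close> to \<open>z\<close>,
  against the parity at the arc. With weight 5 the paths from \<open>i\<close> back to
  \<open>i\<close> would be all arcs into \<open>i\<close>, an odd number, while there is no
  loop.\<close>

lemma weight_three:
  fixes f :: "nat \<Rightarrow> nat \<Rightarrow> bool"
  assumes diag: "\<And>i. i < 6 \<Longrightarrow> \<not> f i i"
    and row: "\<And>i. i < 6 \<Longrightarrow> odd (card {k. k < 6 \<and> f i k})"
    and col: "\<And>k. k < 6 \<Longrightarrow> odd (card {i. i < 6 \<and> f i k})"
    and par: "\<And>i k. i < 6 \<Longrightarrow> k < 6 \<Longrightarrow> even (card {z. z < 6 \<and> f i z \<and> f z k} + of_bool (f i k))"
    and i: "i < 6"
  shows "card {k. k < 6 \<and> f i k} = 3"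
proof -
  let ?N = "{k. k < 6 \<and> f i k}"
  have sub: "?N \<subseteq> {..<6} - {i}" using diag i by auto
  have "card ({..<6} - {i}) = 5" using i by simp
  then have "card ?N \<le> 5" using card_mono[OF _ sub] by simp
  moreover have "card ?N \<noteq> 1"
  proof
    assume "card ?N = 1"
    then obtain z where z: "?N = {z}" by (auto simp: card_1_singleton_iff)
    then have "z < 6" "f i z" by blast+
    have "y = z" if "y < 6" "f i y" for y using z that by blast
    then have "{y. y < 6 \<and> f i y \<and> f y z} = {}" using diag[OF \<open>z < 6\<close>] by auto
    then have "card {y. y < 6 \<and> f i y \<and> f y z} = 0" by (simp only: card.empty)
    then show False using par[OF i \<open>z < 6\<close>] \<open>f i z\<close> by (simp only:) simp
  qed
  moreover have "card ?N \<noteq> 5"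
  proof
    assume "card ?N = 5"
    then have "?N = {..<6} - {i}" using sub i by (intro card_subset_eq) auto
    then have "{z. z < 6 \<and> f i z \<and> f z i} = {z. z < 6 \<and> f z i}" using diag by auto
    then show False using par[OF i i] col[OF i] diag[OF i] by simp
  qed
  ultimately show ?thesis using row[OF i] by presburger
qed

lemma nth_tally: "j < length r \<Longrightarrow> j < length ns \<Longrightarrow> tally r ns ! j = of_bool (r ! j) + ns ! j"
  by (induction r ns arbitrary: j rule: tally.induct) (auto simp: nth_Cons split: nat.splits)

lemma length_tally [simp]: "length (tally r ns) = min (length r) (length ns)"
  by (induction r ns rule: tally.induct) auto

lemma nth_zeros: "j < 6 \<Longrightarrow> [c, c, c, c, c, c] ! j = c"
  by (auto simp: eval_nat_numeral less_Suc_eq)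

lemma tallies:
  assumes "\<forall>r\<in>set rs. length r = 6"
  shows "length (tallies rs) = 6" "j < 6 \<Longrightarrow> tallies rs ! j = length (filter (\<lambda>r. r ! j) rs)"
proof -
  show *: "length (tallies rs) = 6" using assms by (induction rs) auto
  show "tallies rs ! j = length (filter (\<lambda>r. r ! j) rs)" if "j < 6"
    using assms
  proof (induction rs)
    case (Cons r rs)
    have "length (tallies rs) = 6" using Cons.prems by (induction rs) auto
    then show ?case using Cons that by (simp add: nth_tally)
  qed (use that in \<open>simp add: nth_zeros\<close>)
qed

lemma length_at_least_three [simp]: "length (at_least_three ns) = length ns"
  by (induction ns rule: at_least_three.induct) auto

lemma nth_at_least_three: "j < length ns \<Longrightarrow> at_least_three ns ! j \<longleftrightarrow> 3 \<le> ns ! j"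
  by (induction ns arbitrary: j rule: at_least_three.induct) (auto simp: nth_Cons split: nat.splits)

lemma flip_rows_eq: "flip_rows rs = map (map Not) rs"
proof -
  have "flip_bits r = map Not r" for r by (induction r) auto
  then show ?thesis by (induction rs) auto
qed

lemma fitsI:
  assumes "length s = length r" "length t = length r" "\<And>j. j < length r \<Longrightarrow> (r ! j \<longrightarrow> \<not> s ! j) \<and> (\<not> r ! j \<longrightarrow> \<not> t ! j)"
  shows "fits s t r"
  using assms
proof (induction r arbitrary: s t)
  case (Cons x r)
  obtain y s' z t' where st: "s = y # s'" "t = z # t'" using Cons.prems(1,2) by (cases s; cases t) auto
  have "fits s' t' r"
  proof (rule Cons.IH)
    fix j assume "j < length r"
    then show "(r ! j \<longrightarrow> \<not> s' ! j) \<and> (\<not> r ! j \<longrightarrow> \<not> t' ! j)" using Cons.prems(3)[of "Suc j"] st by simp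
  qed (use Cons.prems(1,2) st in auto)
  moreover have "(x \<longrightarrow> \<not> y) \<and> (\<not> x \<longrightarrow> \<not> z)" using Cons.prems(3)[of 0] st by simp
  ultimately show ?case by (cases x; cases y; cases z) (auto simp: st)
qed simp

lemma length_xor [simp]: "length (xor xs ys) = min (length xs) (length ys)"
  by (induction xs ys rule: xor.induct) auto

lemma nth_xor: "j < length xs \<Longrightarrow> j < length ys \<Longrightarrow> xor xs ys ! j = (xs ! j \<noteq> ys ! j)"
  by (induction xs ys arbitrary: j rule: xor.induct) (auto simp: nth_Cons split: nat.splits)

lemma xor_rows:
  assumes "length rs \<le> length s" "\<forall>r\<in>set rs. length r = length a"
  shows "length (xor_rows s rs a) = length a \<and> (\<forall>k<length a. xor_rows s rs a ! k \<longleftrightarrow>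
    odd (of_bool (a ! k) + card {j. j < length rs \<and> s ! j \<and> rs ! j ! k}))"
  using assms
proof (induction rs arbitrary: s a)
  case (Cons r rs)
  obtain x s' where s: "s = x # s'" using Cons.prems(1) by (cases s) auto
  show ?case
  proof (cases x)
    case True
    then show ?thesis
      using Cons.IH[of s' "xor r a"] Cons.prems by (auto simp: s card_less_Suc_shift nth_xor)
  next
    case False
    then show ?thesis using Cons.IH[of s' a] Cons.prems by (auto simp: s card_less_Suc_shift)
  qed
qed simp

lemma decided_iff: "length rs \<le> length s \<Longrightarrow> decided s rs \<longleftrightarrow> (\<forall>j<length s. length rs \<le> j \<longrightarrow> \<not> s ! j)"
proof (induction s rs rule: decided.induct)
  case (1 x s r rs)
  then show ?case by (auto simp: nth_Cons split: nat.splits)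
next
  case (3 s)
  then show ?case by (auto simp: nth_Cons split: nat.splits)
qed auto

lemma xor_ok_if_iff: "xor_ok_if b r rs \<longleftrightarrow> (b \<longrightarrow> xor_rows r rs r = [False, False, False, False, False, False])"
  by (cases b) auto

lemma sum_rows:
  assumes "length rs \<le> length s" "\<forall>r\<in>set rs. length r = 6"
  shows "length (sum_rows s rs) = 6 \<and> (\<forall>k<6. sum_rows s rs ! k = card {j. j < length rs \<and> s ! j \<and> rs ! j ! k})"
  using assms
proof (induction rs arbitrary: s)
  case (Cons r rs)
  obtain x s' where s: "s = x # s'" using Cons.prems(1) by (cases s) auto
  show ?case using Cons.IH[of s'] Cons.prems by (cases x) (auto simp: s card_less_Suc_shift nth_tally)
qed (simp add: nth_zeros)

definition f_rows :: "(nat \<Rightarrow> nat \<Rightarrow> bool) \<Rightarrow> bool list list" where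
  "f_rows f = map (\<lambda>i. map (f i) [0..<6]) [0..<6]"

lemma f_rows [simp]: "length (f_rows f) = 6" "i < 6 \<Longrightarrow> f_rows f ! i = map (f i) [0..<6]"
  by (simp_all add: f_rows_def)

lemma card_less_eq:
  "card {i. i < n \<and> P i} = card {i. i < m \<and> P i} + card {i. m < i \<and> i < n \<and> P i} + of_bool (P m)" if "m < n" for n m :: nat
proof -
  have "{i. i < n \<and> P i} = ({i. i < m \<and> P i} \<union> {i. m < i \<and> i < n \<and> P i}) \<union> {i. i = m \<and> P m}"
    using that by (auto, metis linorder_neqE_nat)
  also have "card \<dots> = card {i. i < m \<and> P i} + card {i. m < i \<and> i < n \<and> P i} + of_bool (P m)"
    by (subst card_Un_disjoint, auto)+
  finally show ?thesis .
qed

context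
  fixes f :: "nat \<Rightarrow> nat \<Rightarrow> bool"
  assumes diag: "\<And>i. i < 6 \<Longrightarrow> \<not> f i i"
    and row: "\<And>i. i < 6 \<Longrightarrow> card {k. k < 6 \<and> f i k} = 3"
    and col: "\<And>k. k < 6 \<Longrightarrow> card {i. i < 6 \<and> f i k} = 3"
    and par: "\<And>i k. i < 6 \<Longrightarrow> k < 6 \<Longrightarrow> even (card {z. z < 6 \<and> f i z \<and> f z k} + of_bool (f i k))"
begin


lemma f_rows_in_search: "f_rows f \<in> set fixed_search"
  unfolding fixed_search_def
proof (rule dfs_complete)
  fix m assume "m < length (f_rows f)"
  then have m: "m < 6" by simp
  define q where "q = map (\<lambda>i. map (f i) [0..<6]) [0..<m]"
  let ?r = "map (f m) [0..<6]"
  have q: "take m (f_rows f) = q" using m by (simp add: q_def f_rows_def take_map)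
  have qr: "q @ [?r] = map (\<lambda>i. map (f i) [0..<6]) [0..<Suc m]" by (simp add: q_def)
  have len: "length q = m" "\<forall>r\<in>set q. length r = 6" by (auto simp: q_def)
  have "{k. k < 6 \<and> ?r ! k \<and> ?r ! k} = {k. k < 6 \<and> f m k}" by auto
  then have "meet ?r ?r = 3" using row[OF m] meet_eq_card[of ?r 6 ?r] by simp
  then have "?r \<in> set (weighted 6 3)" by (simp add: set_weighted)
  moreover have "fits ((at_least_three (tallies q))[length q := True]) (at_least_three (tallies (flip_rows q))) ?r"
  proof (rule fitsI)
    fix j assume "j < length ?r"
    then have j: "j < 6" by simp
    have "length (filter (\<lambda>r. r ! j) q) = card {i. i < m \<and> f i j}"
      using j by (simp add: length_filter_conv_card q_def cong: conj_cong)
    then have 1: "tallies q ! j = card {i. i < m \<and> f i j}" using tallies(2)[OF len(2) j] by simp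
    have "length (filter (\<lambda>r. r ! j) (flip_rows q)) = card {i. i < m \<and> \<not> f i j}"
      using j by (simp add: length_filter_conv_card q_def flip_rows_eq cong: conj_cong)
    moreover have l2: "\<forall>r\<in>set (flip_rows q). length r = 6" using len(2) by (auto simp: flip_rows_eq)
    ultimately have 2: "tallies (flip_rows q) ! j = card {i. i < m \<and> \<not> f i j}"
      using tallies(2)[OF l2 j] by simp
    have "card {i. i < 6 \<and> \<not> f i j} = 3"
    proof -
      have "card ({i. i < 6 \<and> f i j} \<union> {i. i < 6 \<and> \<not> f i j}) = card {i. i < 6 \<and> f i j} + card {i. i < 6 \<and> \<not> f i j}"
        by (rule card_Un_disjoint) auto
      moreover have "{i. i < 6 \<and> f i j} \<union> {i. i < 6 \<and> \<not> f i j} = {..<6}" by auto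
      ultimately show ?thesis using col[OF j] by simp
    qed
    \<comment> \<open>Row \<open>m\<close> itself takes one of the three ones or of the three zeros
      in column \<open>j\<close>.\<close>
    then have "\<not> f m j \<Longrightarrow> card {i. i < m \<and> \<not> f i j} < 3" "f m j \<Longrightarrow> card {i. i < m \<and> f i j} < 3"
      using card_less_eq[OF m, of "\<lambda>i. \<not> f i j"] card_less_eq[OF m, of "\<lambda>i. f i j"] col[OF j] by simp_all
    then show "(?r ! j \<longrightarrow> \<not> (at_least_three (tallies q))[length q := True] ! j) \<and>
        (\<not> ?r ! j \<longrightarrow> \<not> at_least_three (tallies (flip_rows q)) ! j)"
      using 1 2 j diag[OF m] tallies(1)[OF len(2)] tallies(1)[OF l2]
      by (cases "j = m") (auto simp: nth_list_update nth_at_least_three len)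
  qed (use tallies(1)[OF len(2)] tallies(1)[of "flip_rows q"] len(2) in \<open>auto simp: flip_rows_eq\<close>)
  moreover have "all_xor_ok q ?r"
  proof -
    have "xor_ok (q @ [?r]) r'" if r': "r' \<in> set (q @ [?r])" for r'
    proof -
      obtain i where i: "i < Suc m" "r' = map (f i) [0..<6]" using r' unfolding qr by (auto simp del: upt_Suc)
      have "xor_rows r' (q @ [?r]) r' = [False, False, False, False, False, False]" if d: "decided r' (q @ [?r])"
      proof (rule nth_equalityI)
        have x: "length (xor_rows r' (q @ [?r]) r') = 6 \<and> (\<forall>k<6. xor_rows r' (q @ [?r]) r' ! k \<longleftrightarrow>
            odd (of_bool (r' ! k) + card {j. j < Suc m \<and> r' ! j \<and> (q @ [?r]) ! j ! k}))"
          using xor_rows[of "q @ [?r]" r' r'] m len i(2) by auto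
        then show "length (xor_rows r' (q @ [?r]) r') = length [False, False, False, False, False, False]" by simp
        fix k assume "k < length (xor_rows r' (q @ [?r]) r')"
        then have k: "k < 6" using x by simp
        \<comment> \<open>All ones of a decided row point to known rows, so the sum over the known
          rows is the full matrix product.\<close>
        have none: "\<not> f i j" if "Suc m \<le> j" "j < 6" for j
          using d decided_iff[of "q @ [?r]" r'] that m len i(2) by auto
        have "{j. j < Suc m \<and> r' ! j \<and> (q @ [?r]) ! j ! k} = {z. z < 6 \<and> f i z \<and> f z k}"
        proof (rule Collect_cong)
          fix j
          show "(j < Suc m \<and> r' ! j \<and> (q @ [?r]) ! j ! k) = (j < 6 \<and> f i j \<and> f j k)"
          proof (cases "j < Suc m")
            case True
            then have "(q @ [?r]) ! j = map (f j) [0..<6]" unfolding qr by (subst nth_map) (simp_all del: upt_Suc)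
            then show ?thesis using True m k i(2) by simp
          next
            case False
            then show ?thesis using none[of j] by auto
          qed
        qed
        then show "xor_rows r' (q @ [?r]) r' ! k = [False, False, False, False, False, False] ! k"
          using x k par[of i k] i m by (simp add: nth_zeros add.commute)
      qed
      then show ?thesis by (simp add: xor_ok_if_iff)
    qed
    then show ?thesis by simp
  qed
  ultimately show "f_rows f ! m \<in> set (fixed_cand (weighted 6 3) (take m (f_rows f)))"
    using m by (simp add: q)
qed (simp_all)

lemma f_rows_in_parts: "f_rows f \<in> set fixed_parts"
  using f_rows_in_search fixed_search_eq by simp

lemma f_square:
  assumes "i < 6" "k < 6"
  shows "card {z. z < 6 \<and> f i z \<and> f z k} + of_bool (f i k) = 2"
proof -
  have "fixed_square_ok (f_rows f)" using fixed_squares_ok f_rows_in_parts by (simp add: list_all_iff)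
  then have "tally (f_rows f ! i) (sum_rows (f_rows f ! i) (f_rows f)) = [2, 2, 2, 2, 2, 2]"
    using assms(1) by (simp add: list_all_length)
  moreover have "length (sum_rows (f_rows f ! i) (f_rows f)) = 6 \<and>
      (\<forall>k<6. sum_rows (f_rows f ! i) (f_rows f) ! k = card {j. j < 6 \<and> f_rows f ! i ! j \<and> f_rows f ! j ! k})"
    using sum_rows[of "f_rows f" "f_rows f ! i"] assms(1) by (auto simp: f_rows_def)
  moreover have "{j. j < 6 \<and> f_rows f ! i ! j \<and> f_rows f ! j ! k} = {z. z < 6 \<and> f i z \<and> f z k}"
    using assms by auto
  ultimately show ?thesis
    using assms nth_tally[of k "f_rows f ! i" "sum_rows (f_rows f ! i) (f_rows f)"] by (simp add: nth_zeros add.commute)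
qed

end

subsection \<open>Classification of the blocks between fixed points and pairs\<close>

lemma cliques_complete:
  assumes "X \<subseteq> set cs" "finite X" "card X = n" "\<And>x y. x \<in> X \<Longrightarrow> y \<in> X \<Longrightarrow> x \<noteq> y \<Longrightarrow> compat_tau m x y"
  shows "\<exists>l\<in>set (cliques m n cs). set l = X \<and> length l = n"
  using assms
proof (induction m n cs arbitrary: X rule: cliques.induct)
  case (3 m n x cs)
  show ?case
  proof (cases "x \<in> X")
    case True
    have "\<exists>l\<in>set (cliques m n (sieve (compat_tau m x) cs)). set l = X - {x} \<and> length l = n"
    proof (rule "3.IH"(1))
      show "X - {x} \<subseteq> set (sieve (compat_tau m x) cs)"
      proof
        fix y assume y: "y \<in> X - {x}"
        then have "y \<in> set cs" using "3.prems"(1) by auto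
        moreover have "compat_tau m x y" using "3.prems"(4)[OF True, of y] y by blast
        ultimately show "y \<in> set (sieve (compat_tau m x) cs)" by (simp del: compat_tau.simps)
      qed
      show "card (X - {x}) = n" using "3.prems"(2,3) True by simp
      show "finite (X - {x})" using "3.prems"(2) by simp
      show "compat_tau m y z" if "y \<in> X - {x}" "z \<in> X - {x}" "y \<noteq> z" for y z
        using "3.prems"(4)[of y z] that by blast
    qed
    then obtain l where "l \<in> set (cliques m n (sieve (compat_tau m x) cs))" "set l = X - {x}" "length l = n" by blast
    then have "x # l \<in> set (cliques m (Suc n) (x # cs))" "set (x # l) = X" "length (x # l) = Suc n"
      using True by auto
    then show ?thesis by blast
  next
    case False
    then have "X \<subseteq> set cs" using "3.prems"(1) by auto
    from "3.IH"(2)[OF this "3.prems"(2-4)] show ?thesis by auto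
  qed
qed auto

lemma mset_insert_num: "mset (insert_num x ys) = add_mset x (mset ys)"
proof (induction ys)
  case (Cons y ys)
  then show ?case by (cases "x \<le> y") auto
qed simp

lemma mset_sort_nums: "mset (sort_nums xs) = mset xs"
  by (induction xs) (auto simp: mset_insert_num)

lemma num_bits_bit_num [simp]: "num_bits (bit_num b n) = b # num_bits n"
  by (cases b) auto

lemma push_row:
  assumes "length b = length c" "length ns = length c"
  shows "length (push_row b c ns) = length c \<and>
    (\<forall>j<length c. num_bits (push_row b c ns ! j) = b ! j # c ! j # num_bits (ns ! j))"
  using assms
proof (induction b c ns rule: push_row.induct)
  case (1 b bs c cs n ns)
  then show ?case by (auto simp: nth_Cons split: nat.splits)
qed auto

lemma col_codes:
  assumes "\<forall>(b, c)\<in>set rs. length b = 8 \<and> length c = 8"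
  shows "length (col_codes rs) = 8 \<and> (\<forall>j<8. evens (num_bits (col_codes rs ! j)) = map (\<lambda>r. fst r ! j) rs \<and>
    odds (num_bits (col_codes rs ! j)) = map (\<lambda>r. snd r ! j) rs)"
  using assms
proof (induction rs)
  case Nil
  have "\<forall>j<8. [num.One, num.One, num.One, num.One, num.One, num.One, num.One, num.One] ! j = num.One"
    by (auto simp: eval_nat_numeral less_Suc_eq)
  then show ?case by simp
next
  case (Cons r rs)
  obtain b c where r: "r = (b, c)" by (cases r)
  show ?case using Cons push_row[of b c "col_codes rs"] by (auto simp: r)
qed

lemma bc_cert_ok_if_iff: "bc_cert_ok_if t reps ls cs \<longleftrightarrow> t \<and> bc_cert_ok reps ls cs"
  by (cases t) auto

text \<open>The multiset of column codes is what the certificate compares: equality of multisets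
  leaves a permutation of the pairs.\<close>

lemma bc_cert_okD:
  assumes "bc_cert_ok reps ls cs" "l \<in> set ls"
  shows "\<exists>k<112. \<exists>p. is_perm 6 p \<and> mset (col_codes (select p l)) = mset (reps ! k)"
  using assms
proof (induction ls arbitrary: cs)
  case (Cons l' ls)
  obtain k p cs' where cs: "cs = (k, p) # cs'" using Cons.prems(1) by (cases cs) auto
  have 1: "k < 112" "is_perm 6 (octal (bits p))" "sort_nums (col_codes (select (octal (bits p)) l')) = reps ! k"
    "bc_cert_ok reps ls cs'"
    using Cons.prems(1) by (auto simp: cs bc_cert_ok_if_iff)
  show ?case
  proof (cases "l = l'")
    case True
    have "mset (col_codes (select (octal (bits p)) l')) = mset (reps ! k)"
      by (simp only: 1(3)[symmetric] mset_sort_nums)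
    then show ?thesis using 1(1,2) True by blast
  next
    case False
    then show ?thesis using Cons.IH[OF 1(4)] Cons.prems(2) by simp
  qed
qed simp

lemma col_keys_map:
  "length bs = n \<Longrightarrow> length cs = n \<Longrightarrow> length ds = n \<Longrightarrow> length es = n \<Longrightarrow>
   col_keys bs cs ds es = map (\<lambda>j. col_key (bs ! j) (cs ! j) (ds ! j) (es ! j)) [0..<n]"
proof (induction bs cs ds es arbitrary: n rule: col_keys.induct)
  case (1 x xs y ys z zs w ws)
  then obtain n' where n: "n = Suc n'" by auto
  have "map (\<lambda>j. col_key ((x # xs) ! j) ((y # ys) ! j) ((z # zs) ! j) ((w # ws) ! j)) [0..<Suc n'] =
      col_key x y z w # map (\<lambda>j. col_key (xs ! j) (ys ! j) (zs ! j) (ws ! j)) [0..<n']"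
    by (simp only: upt_conv_Cons[OF zero_less_Suc] map_Suc_upt[symmetric] list.map map_map o_def nth_Cons_0 nth_Cons_Suc)
  then show ?case using 1 n by simp
qed auto

lemma length_b_cols [simp]: "length (b_cols ns) = length ns" "length (c_rows ns) = length ns"
  by (induction ns) auto

lemma nth_b_cols: "j < length ns \<Longrightarrow> b_cols ns ! j = evens (num_bits (ns ! j))"
  "j < length ns \<Longrightarrow> c_rows ns ! j = odds (num_bits (ns ! j))"
  by (induction ns arbitrary: j) (auto simp: nth_Cons split: nat.splits)

lemma set_bc_search: "set (bc_search cs rs) = (\<Union>r\<in>set rs. set (bc_completions cs r (tau row0 r)))"
  by (induction rs) auto

text \<open>Two fixed points with maximal \<open>tau\<close> are put first and the pairs are sorted
  by the keys of these two. Then the first point is \<open>row0\<close>, the second is one of the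
  sorted candidates, and the other four are a clique under the bound given by this maximum, so the
  arrangement occurs among the leaves.\<close>

lemma bc_classification:
  fixes b c :: "nat \<Rightarrow> nat \<Rightarrow> bool"
  assumes b3: "\<And>i. i < 6 \<Longrightarrow> card {j. j < 8 \<and> b i j} = 3"
    and c3: "\<And>i. i < 6 \<Longrightarrow> card {j. j < 8 \<and> c i j} = 3"
    and bc: "\<And>i k. i < 6 \<Longrightarrow> k < 6 \<Longrightarrow> card {j. j < 8 \<and> b i j \<and> c k j} = (if i = k then 2 else 1)"
  shows "\<exists>k<112. \<exists>p q. bij_betw p {..<6} {..<6} \<and> bij_betw q {..<8} {..<8} \<and> length (bc_reps ! k) = 8 \<and>
    (\<forall>j<8. b_cols (bc_reps ! k) ! j = map (\<lambda>i. b (p i) (q j)) [0..<6] \<and>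
      c_rows (bc_reps ! k) ! j = map (\<lambda>i. c (p i) (q j)) [0..<6])"
proof -
  define t where "t i k = card {j. j < 8 \<and> b i j \<and> b k j} + card {j. j < 8 \<and> c i j \<and> c k j} +
    card {j. j < 8 \<and> (b i j \<and> c i j) \<and> (b k j \<and> c k j)}" for i k
  define D where "D = {(i, k). i < 6 \<and> k < 6 \<and> i \<noteq> (k::nat)}"
  have "D \<subseteq> {..<6} \<times> {..<6}" by (auto simp: D_def)
  then have "finite D" using finite_subset by blast
  moreover have "(0, 1) \<in> D" by (simp add: D_def)
  ultimately obtain z where z: "z \<in> D" "\<forall>x\<in>D. (case x of (i, k) \<Rightarrow> t i k) \<le> (case z of (i, k) \<Rightarrow> t i k)"
    using Max_in[of "(\<lambda>(i, k). t i k) ` D"] Max_ge[of "(\<lambda>(i, k). t i k) ` D"] by fastforce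
  obtain i0 i1 where "z = (i0, i1)" by (cases z)
  then have i01: "i0 < 6" "i1 < 6" "i0 \<noteq> i1" and tmax: "\<And>i k. i < 6 \<Longrightarrow> k < 6 \<Longrightarrow> i \<noteq> k \<Longrightarrow> t i k \<le> t i0 i1"
    using z by (auto simp: D_def)
  define key where "key j = col_key (b i0 j) (c i0 j) (b i1 j) (c i1 j)" for j
  define ql where "ql = sort_key key [0..<8]"
  define q where "q j = ql ! j" for j
  have ql: "length ql = 8" "distinct ql" "set ql = {..<8}" "sorted (map key ql)"
    by (auto simp: ql_def)
  have "is_perm 8 ql" using ql by (auto simp: list_all_iff)
  then have q: "bij_betw q {..<8} {..<8}" using is_perm_bij unfolding q_def by blast
  have q8: "q j < 8" if "j < 8" for j using q that bij_betwE by fastforce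
  define rb where "rb i = map (\<lambda>j. b i (q j)) [0..<8]" for i
  define rc where "rc i = map (\<lambda>j. c i (q j)) [0..<8]" for i
  define R where "R i = (rb i, rc i)" for i
  have len: "length (rb i) = 8" "length (rc i) = 8" for i by (simp_all add: rb_def rc_def)
  have permuted: "card {j. j < 8 \<and> P (q j)} = card {j. j < 8 \<and> P j}" for P by (rule card_permuted[OF q])
  have meet_bb: "meet (rb i) (rb k) = card {j. j < 8 \<and> b i j \<and> b k j}" for i k
    using permuted[of "\<lambda>j. b i j \<and> b k j"] unfolding meet_eq_card[OF len(1) len(1)] by (simp add: rb_def cong: conj_cong)
  have meet_cc: "meet (rc i) (rc k) = card {j. j < 8 \<and> c i j \<and> c k j}" for i k
    using permuted[of "\<lambda>j. c i j \<and> c k j"] unfolding meet_eq_card[OF len(2) len(2)] by (simp add: rc_def cong: conj_cong)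
  have meet_bc: "meet (rb i) (rc k) = card {j. j < 8 \<and> b i j \<and> c k j}" for i k
    using permuted[of "\<lambda>j. b i j \<and> c k j"] unfolding meet_eq_card[OF len] by (simp add: rb_def rc_def cong: conj_cong)
  have meet_cb: "meet (rc k) (rb i) = meet (rb i) (rc k)" for i k
    unfolding meet_eq_card[OF len] meet_eq_card[OF len(2) len(1)] by (simp add: conj_commute)
  have tau: "tau (R i) (R k) = t i k" for i k
  proof -
    have l: "length (conj_bits (rb i) (rc i)) = 8" for i by (simp add: conj_bits_eq len)
    have "meet (conj_bits (rb i) (rc i)) (conj_bits (rb k) (rc k)) = card {j. j < 8 \<and> (b i j \<and> c i j) \<and> (b k j \<and> c k j)}"
      using permuted[of "\<lambda>j. (b i j \<and> c i j) \<and> (b k j \<and> c k j)"] unfolding meet_eq_card[OF l l]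
      by (simp add: conj_bits_eq len rb_def rc_def cong: conj_cong)
    then show ?thesis by (simp add: R_def t_def meet_bb meet_cc)
  qed
  have w: "rb i \<in> set (weighted 8 3)" "rc i \<in> set (weighted 8 3)" if "i < 6" for i
    using b3[OF that] c3[OF that] by (simp_all add: set_weighted len meet_bb meet_cc)
  have m2: "meet (rb i) (rc i) = 2" if "i < 6" for i using bc[OF that that] by (simp add: meet_bc)
  have m1: "meet (rb i) (rc k) = 1" if "i < 6" "k < 6" "i \<noteq> k" for i k using bc[OF that(1,2)] that(3) by (simp add: meet_bc)
  have sorted: "sorted (map (\<lambda>j. key (q j)) [0..<8])"
  proof -
    have "map (\<lambda>j. key (q j)) [0..<8] = map key (map (\<lambda>j. ql ! j) [0..<8])" by (simp add: q_def)
    also have "map (\<lambda>j. ql ! j) [0..<8] = ql" using map_nth[of ql] ql(1) by simp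
    finally show ?thesis using ql(4) by simp
  qed
  have R0: "R i0 = row0"
  proof -
    \<comment> \<open>Division by 4 leaves the two bits of the first point in the key.\<close>
    have "sorted (map (\<lambda>j. key (q j) div 4) [0..<8])"
      using sorted by (auto simp: sorted_iff_nth_mono div_le_mono)
    moreover have "map (\<lambda>j. key (q j) div 4) [0..<8] =
        map (\<lambda>j. (if rb i0 ! j then 2 else 0) + (if rc i0 ! j then 1 else 0) :: nat) [0..<8]"
      by (rule map_cong) (auto simp: key_def rb_def rc_def)
    ultimately have "sorted_row (R i0)" by (simp add: R_def)
    then have "R i0 \<in> set (sieve sorted_row (sieve (meet_pair 2) (all_pairs (weighted 8 3) (weighted 8 3))))"
      using w[OF i01(1)] m2[OF i01(1)] by (simp add: R_def)
    then show ?thesis by (simp only: row0_unique) simp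
  qed
  have row0: "fst row0 = rb i0" "snd row0 = rc i0" using R0 by (simp_all add: R_def flip: R0)
  have cand: "R i \<in> set row_cands" if "i < 6" "i \<noteq> i0" for i
    using w[OF that(1)] m2[OF that(1)] m1[OF that(1) i01(1)] m1[OF i01(1) that(1)] that(2)
    by (auto simp: row_cands_def row0 R_def meet_cb)
  have ct: "compat_tau (t i0 i1) (R i) (R k)" if "i < 6" "k < 6" "i \<noteq> k" for i k
    using m1 tmax[OF that] that by (simp add: tau[symmetric] del: tau.simps) (auto simp: R_def)
  have inj: "inj_on R {..<6}"
  proof (rule inj_onI, rule ccontr)
    fix i k assume ik: "i \<in> {..<6::nat}" "k \<in> {..<6}" "R i = R k" "i \<noteq> k"
    \<comment> \<open>Equal rows would give the diagonal value 2 of \<open>B C\<close> at an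
      off-diagonal position, where it is 1.\<close>
    then have "meet (rb i) (rc k) = 2" using m2[of i] by (simp add: R_def)
    then show False using m1[of i k] ik by simp
  qed
  define X where "X = R ` ({..<6} - {i0, i1})"
  have "card ({..<6} - {i0, i1}) = 4" using i01 by (simp add: card_Diff_subset)
  then have "card X = 4" unfolding X_def by (subst card_image[OF inj_on_subset[OF inj]]) auto
  moreover have "X \<subseteq> set (sieve (compat_tau (t i0 i1) (R i1)) (sieve (compat_tau (t i0 i1) row0) row_cands))"
    using cand ct[OF i01(2)] ct[OF i01(1)] by (auto simp: X_def simp flip: R0 simp del: compat_tau.simps)
  moreover have "compat_tau (t i0 i1) x y" if "x \<in> X" "y \<in> X" "x \<noteq> y" for x y
    using that ct unfolding X_def by blast
  ultimately obtain l where l: "l \<in> set (cliques (t i0 i1) 4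
      (sieve (compat_tau (t i0 i1) (R i1)) (sieve (compat_tau (t i0 i1) row0) row_cands)))" "set l = X" "length l = 4"
    using cliques_complete[of X _ 4] by (metis finite_Diff finite_imageI finite_lessThan X_def)
  let ?L = "row0 # R i1 # l"
  have c1: "?L \<in> set (bc_completions row_cands (R i1) (t i0 i1))" using l(1) by (simp add: bc_completions_def)
  have c2: "R i1 \<in> set (sieve (sorted_cols row0) row_cands)"
  proof -
    have "col_keys (rb i0) (rc i0) (rb i1) (rc i1) = map (\<lambda>j. key (q j)) [0..<8]"
      by (simp add: col_keys_map[of _ 8] len) (simp add: key_def rb_def rc_def)
    then have "sorted_cols (R i0) (R i1)" using sorted by (simp add: R_def)
    then show ?thesis using cand[OF i01(2)] i01(3) by (simp add: R0 del: sorted_cols.simps)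
  qed
  have c3: "tau row0 (R i1) = t i0 i1" using tau[of i0 i1] R0 by simp
  have L: "?L \<in> set bc_leaves"
    unfolding bc_leaves_def set_bc_search by (rule UN_I[OF c2]) (simp only: c1 c3)
  have setL: "set ?L = R ` {..<6}" using l(2) i01 by (auto simp: X_def R0[symmetric])
  have lenL: "length ?L = 6" using l(3) by simp
  have "distinct ?L" by (rule card_distinct) (simp only: setL lenL card_image[OF inj] card_lessThan)
  \<comment> \<open>The clique lists the points in an unknown order; \<open>g\<close> reads off
    which fixed point belongs to an entry.\<close>
  define g where "g = inv_into {..<6} R"
  have bg: "bij_betw (\<lambda>i. g (?L ! i)) {..<6} {..<6}"
  proof -
    have "bij_betw ((!) ?L) {..<6} (R ` {..<6})"
      using bij_betw_nth[OF \<open>distinct ?L\<close>, of "{..<6}" "R ` {..<6}"] lenL setL by simp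
    moreover have "bij_betw g (R ` {..<6}) {..<6}"
      unfolding g_def by (rule bij_betw_inv_into) (simp add: inj inj_on_imp_bij_betw)
    ultimately show ?thesis by (auto dest: bij_betw_trans simp: o_def)
  qed
  have Rg: "R (g (?L ! i)) = ?L ! i" if "i < 6" for i
  proof -
    have "?L ! i \<in> R ` {..<6}" unfolding setL[symmetric] by (rule nth_mem) (use that lenL in simp)
    then show ?thesis unfolding g_def by (rule f_inv_into_f)
  qed
  obtain k p where k: "k < 112" and p: "is_perm 6 p" and ms: "mset (col_codes (select p ?L)) = mset (bc_reps ! k)"
    using bc_cert_okD[OF bc_leaves_ok L] by blast
  have p6: "p ! i < 6" "length p = 6" if "i < 6" for i using p that by (auto simp: list_all_length)
  let ?s = "select p ?L"
  have s: "?s ! i = R (g (?L ! (p ! i)))" if "i < 6" for i using that p p6 Rg by simp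
  have lens: "\<forall>(b, c)\<in>set ?s. length b = 8 \<and> length c = 8"
  proof -
    have "length (fst (?s ! i)) = 8 \<and> length (snd (?s ! i)) = 8" if "i < 6" for i using s[OF that] len by (simp add: R_def)
    then show ?thesis using p by (auto simp: in_set_conv_nth simp del: select.simps) (metis fst_conv snd_conv)+
  qed
  note cc = col_codes[OF lens]
  obtain q' where q': "q' permutes {..<length (col_codes ?s)}" "permute_list q' (col_codes ?s) = bc_reps ! k"
    using mset_eq_permutation[OF ms[symmetric]] by blast
  have q'8: "bij_betw q' {..<8} {..<8}" using q'(1) cc permutes_imp_bij by metis
  have q'less: "q' j < 8" if "j < 8" for j using q'8 that bij_betwE by fastforce
  have lrep: "length (bc_reps ! k) = 8" using q'(2) cc by (metis length_permute_list)
  have code: "bc_reps ! k ! j = col_codes ?s ! q' j" if "j < 8" for j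
    using permute_list_nth[OF q'(1), of j] cc that q'(2) by simp
  define P where "P i = g (?L ! (p ! i))" for i
  have "bij_betw (\<lambda>i. p ! i) {..<6} {..<6}" using is_perm_bij[OF p] by simp
  from bij_betw_trans[OF this bg] have bP: "bij_betw P {..<6} {..<6}" by (simp add: P_def[abs_def] o_def)
  have bQ: "bij_betw (\<lambda>j. q (q' j)) {..<8} {..<8}" using bij_betw_trans[OF q'8 q] by (simp add: o_def)
  have smap: "?s = map (\<lambda>i. R (P i)) [0..<6]"
    by (rule nth_equalityI) (use p s in \<open>auto simp: P_def\<close>)
  have "b_cols (bc_reps ! k) ! j = map (\<lambda>i. b (P i) (q (q' j))) [0..<6] \<and>
      c_rows (bc_reps ! k) ! j = map (\<lambda>i. c (P i) (q (q' j))) [0..<6]" if j: "j < 8" for j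
  proof -
    have e: "evens (num_bits (col_codes ?s ! q' j)) = map (\<lambda>r. fst r ! q' j) ?s"
      "odds (num_bits (col_codes ?s ! q' j)) = map (\<lambda>r. snd r ! q' j) ?s"
      using cc q'less[OF j] by blast+
    have jl: "j < length (bc_reps ! k)" using j lrep by simp
    have "b_cols (bc_reps ! k) ! j = map (\<lambda>r. fst r ! q' j) ?s"
      unfolding nth_b_cols(1)[OF jl] code[OF j] by (rule e(1))
    also have "\<dots> = map (\<lambda>i. b (P i) (q (q' j))) [0..<6]"
      unfolding smap using q'less[OF j] by (simp add: R_def rb_def)
    finally have 1: "b_cols (bc_reps ! k) ! j = map (\<lambda>i. b (P i) (q (q' j))) [0..<6]" .
    have "c_rows (bc_reps ! k) ! j = map (\<lambda>r. snd r ! q' j) ?s"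
      unfolding nth_b_cols(2)[OF jl] code[OF j] by (rule e(2))
    also have "\<dots> = map (\<lambda>i. c (P i) (q (q' j))) [0..<6]"
      unfolding smap using q'less[OF j] by (simp add: R_def rc_def)
    finally show ?thesis using 1 by blast
  qed
  then show ?thesis using k bP bQ lrep by blast
qed

subsection \<open>The symmetric part of the blocks between pairs\<close>

text \<open>Associativity of the matrix product, entry by entry.\<close>

lemma sum_triple:
  "(\<Sum>v\<in>V. x v * (\<Sum>i\<in>I. y v i * w i)) = (\<Sum>i\<in>I. (\<Sum>v\<in>V. x v * y v i) * w i)" for x :: "'a \<Rightarrow> 'c::comm_semiring_0"
  unfolding sum_distrib_left sum_distrib_right by (subst sum.swap) (simp add: mult.assoc)

lemma sum_delta_mult:
  fixes f :: "nat \<Rightarrow> int"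
  assumes "l < n"
  shows "(\<Sum>v<n. f v * (if v = l then c else 0)) = f l * c" "(\<Sum>v<n. (if l = v then c else 0) * f v) = c * f l"
proof -
  have "(\<Sum>v<n. f v * (if v = l then c else 0)) = (\<Sum>v<n. if v = l then f l * c else 0)"
    by (rule sum.cong) auto
  then show "(\<Sum>v<n. f v * (if v = l then c else 0)) = f l * c" using assms by simp
  have "(\<Sum>v<n. (if l = v then c else 0) * f v) = (\<Sum>v<n. if l = v then c * f l else 0)"
    by (rule sum.cong) auto
  then show "(\<Sum>v<n. (if l = v then c else 0) * f v) = c * f l" using assms by simp
qed

context swap_dsrg
begin

lemma block_bool:
  "a x y = of_bool (A x y)" "B i j = of_bool (A i (6 + 2 * j))" "C j i = of_bool (A (6 + 2 * j) i)"
  by (simp_all add: a_def B_def C_def)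

lemma fixed_diag: "i < 6 \<Longrightarrow> \<not> A i i"
  using dsrg by (simp add: dsrg_mat_def)

lemma fixed_row_odd: "i < 6 \<Longrightarrow> odd (card {k. k < 6 \<and> A i k})"
proof -
  assume "i < 6"
  then have "int (card {k. k < 6 \<and> A i k}) + 2 * (\<Sum>j<8. B i j) = 9"
    using degree_sums(1) unfolding int_card_less by (simp add: a_def)
  then show ?thesis by presburger
qed

lemma fixed_col_odd: "i < 6 \<Longrightarrow> odd (card {k. k < 6 \<and> A k i})"
proof -
  assume "i < 6"
  then have "int (card {k. k < 6 \<and> A k i}) + 2 * (\<Sum>j<8. C j i) = 9"
    using degree_sums(2) unfolding int_card_less by (simp add: a_def)
  then show ?thesis by presburger
qed

lemma fixed_square: "int (card {z. z < 6 \<and> A i z \<and> A z k} + of_bool (A i k)) = (\<Sum>z<6. a i z * a z k) + a i k"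
  unfolding of_nat_add int_card_less by (simp add: a_def of_bool_conj)

text \<open>In \<open>fixed_paths\<close> all terms other than those of \<open>F^2 + F\<close> are
  even.\<close>

lemma fixed_parity: "i < 6 \<Longrightarrow> k < 6 \<Longrightarrow> even (card {z. z < 6 \<and> A i z \<and> A z k} + of_bool (A i k))"
proof -
  assume "i < 6" "k < 6"
  then have "(\<Sum>z<6. a i z * a z k) + a i k = 2 * (2 + (if i = k then 1 else 0) - (\<Sum>j<8. B i j * C j k))"
    using fixed_paths[of i k] by (cases "i = k") auto
  then have "even (int (card {z. z < 6 \<and> A i z \<and> A z k} + of_bool (A i k)))"
    unfolding fixed_square by (simp only:) (rule dvd_triv_left)
  then show ?thesis by (simp only: even_of_nat)
qed

lemma fixed_row_weight: "i < 6 \<Longrightarrow> card {k. k < 6 \<and> A i k} = 3"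
  by (rule weight_three[where f = A]) (use fixed_diag fixed_row_odd fixed_col_odd fixed_parity in auto)

text \<open>Idempotence modulo two and odd weights pass to the transpose, so the argument for rows
  applies to columns.\<close>

lemma fixed_col_weight: "i < 6 \<Longrightarrow> card {k. k < 6 \<and> A k i} = 3"
proof (rule weight_three[where f = "\<lambda>x y. A y x"])
  show "even (card {z. z < 6 \<and> A z i \<and> A k z} + of_bool (A k i))" if "i < 6" "k < 6" for i k
    using fixed_parity[OF that(2,1)] by (simp add: conj_commute)
qed (use fixed_diag fixed_row_odd fixed_col_odd in auto)

lemma fixed_part_in: "map (\<lambda>i. map (A i) [0..<6]) [0..<6] \<in> set fixed_parts"
  using f_rows_in_parts[of A, OF fixed_diag fixed_row_weight fixed_col_weight fixed_parity]
  by (simp only: f_rows_def)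

lemma fixed_square_plus: "i < 6 \<Longrightarrow> k < 6 \<Longrightarrow> (\<Sum>z<6. a i z * a z k) + a i k = 2"
  using f_square[of A i k, OF fixed_diag fixed_row_weight fixed_col_weight fixed_parity]
  unfolding fixed_square[symmetric] by simp

lemma row_sum3: "i < 6 \<Longrightarrow> (\<Sum>k<6. a i k) = 3"
  using fixed_row_weight int_card_less[of 6 "A i"] by (simp add: a_def)

lemma col_sum3: "i < 6 \<Longrightarrow> (\<Sum>k<6. a k i) = 3"
  using fixed_col_weight int_card_less[of 6 "\<lambda>k. A k i"] by (simp add: a_def)

text \<open>Subtracting \<open>F^2 + F = 2 J\<close> from the fixed block of the path equation and
  halving.\<close>

lemma BC: "i < 6 \<Longrightarrow> k < 6 \<Longrightarrow> (\<Sum>j<8. B i j * C j k) = 1 + (if i = k then 1 else 0)"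
  using fixed_paths[of i k] fixed_square_plus[of i k] by (simp split: if_splits)

lemma B_row_sum: "i < 6 \<Longrightarrow> (\<Sum>j<8. B i j) = 3"
  using degree_sums(1)[of i] row_sum3[of i] by simp

lemma C_col_sum: "i < 6 \<Longrightarrow> (\<Sum>j<8. C j i) = 3"
  using degree_sums(2)[of i] col_sum3[of i] by simp

definition g :: "nat \<Rightarrow> int" where
  "g j = (\<Sum>i<6. C j i)"

definition h :: "nat \<Rightarrow> int" where
  "h l = (\<Sum>i<6. B i l)"

definition cb :: "nat \<Rightarrow> nat \<Rightarrow> int" where
  "cb j l = (\<Sum>i<6. C j i * B i l)"

definition cfb :: "nat \<Rightarrow> nat \<Rightarrow> int" where
  "cfb j l = (\<Sum>i<6. C j i * (\<Sum>k<6. a i k * B k l))"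

text \<open>Let \<open>M\<close> be \<open>B\<close> with an added row of ones and \<open>N\<close>
  be \<open>C\<close> with an added column of ones. By the weights 3 and \<open>B C = I + J\<close>,
  the product \<open>M N\<close> has the blocks \<open>I + J\<close>, 3, 3, 8; its inverse has the
  blocks \<open>I + J/2\<close>, -3/2, -3/2, 7/2. Then \<open>I - N (M N)^-1 M\<close> projects onto
  the kernel of \<open>M\<close> and has rank 8 - 7 = 1. \<open>E\<close> is twice this projection,
  which clears the denominators.\<close>

definition E :: "nat \<Rightarrow> nat \<Rightarrow> int" where
  "E j l = (if j = l then 2 else 0) - 2 * cb j l - 7 + 3 * g j + 3 * h l - g j * h l"

text \<open>The common value of \<open>S E\<close> and \<open>E S\<close> after inserting the known
  products of \<open>S\<close>; the only occurrence of \<open>S\<close> that remains is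
  linear.\<close>

definition Z :: "nat \<Rightarrow> nat \<Rightarrow> int" where
  "Z j l = 2 * S j l + 2 * cfb j l + 2 * cb j l + 9 - 5 * g j - 5 * h l + g j * h l"

lemma SC: "j < 8 \<Longrightarrow> i < 6 \<Longrightarrow> (\<Sum>v<8. S j v * C v i) = 4 - C j i - (\<Sum>z<6. C j z * a z i)"
  using pair_fixed_paths[of j i] by simp

lemma BS: "l < 8 \<Longrightarrow> i < 6 \<Longrightarrow> (\<Sum>v<8. B i v * S v l) = 4 - B i l - (\<Sum>z<6. a i z * B z l)"
  using fixed_pair_paths[of i l] by simp

lemma cfb_eq: "cfb j l = (\<Sum>k<6. (\<Sum>i<6. C j i * a i k) * B k l)"
  unfolding cfb_def by (rule sum_triple)

lemma E_mult_right: "(\<Sum>v<8. f v * E v l) = 2 * f l - 2 * (\<Sum>v<8. f v * cb v l) - 7 * (\<Sum>v<8. f v) +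
    3 * (\<Sum>v<8. f v * g v) + 3 * h l * (\<Sum>v<8. f v) - h l * (\<Sum>v<8. f v * g v)" if "l < 8"
proof -
  have "f v * E v l = f v * (if v = l then 2 else 0) - 2 * (f v * cb v l) - 7 * f v + 3 * (f v * g v) + 3 * h l * f v - h l * (f v * g v)" for v
    by (simp add: E_def algebra_simps)
  then show ?thesis
    using sum_delta_mult(1)[OF that, of f 2] by (simp add: sum.distrib sum_subtractf flip: sum_distrib_left)
qed

lemma E_mult_left: "(\<Sum>v<8. E j v * f v) = 2 * f j - 2 * (\<Sum>v<8. cb j v * f v) - 7 * (\<Sum>v<8. f v) +
    3 * g j * (\<Sum>v<8. f v) + 3 * (\<Sum>v<8. h v * f v) - g j * (\<Sum>v<8. h v * f v)" if "j < 8"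
proof -
  have "E j v * f v = (if j = v then 2 else 0) * f v - 2 * (cb j v * f v) - 7 * f v + 3 * g j * f v + 3 * (h v * f v) - g j * (h v * f v)" for v
    by (simp add: E_def algebra_simps)
  then show ?thesis
    using sum_delta_mult(2)[OF that, of 2 f] by (simp add: sum.distrib sum_subtractf flip: sum_distrib_left)
qed

text \<open>The path equation gives \<open>S C = 4 J - C - C F\<close> and the degrees give
  \<open>S 1 = 9 - g\<close>. Since \<open>g = C 1\<close> and the rows of \<open>F\<close> sum to
  3, also \<open>S g = 24 - 4 g\<close>. Only the term \<open>2 S\<close> of the product is left
  unresolved.\<close>

lemma SE:
  assumes "j < 8" "l < 8"
  shows "(\<Sum>v<8. S j v * E v l) = Z j l"
proof -
  have "(\<Sum>v<8. S j v * cb v l) = (\<Sum>i<6. (\<Sum>v<8. S j v * C v i) * B i l)"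
    unfolding cb_def by (rule sum_triple)
  also have "\<dots> = (\<Sum>i<6. 4 * B i l - C j i * B i l - (\<Sum>z<6. C j z * a z i) * B i l)"
    by (rule sum.cong) (simp_all add: SC[OF assms(1)] left_diff_distrib)
  also have "\<dots> = 4 * h l - cb j l - cfb j l"
    by (simp add: sum_subtractf h_def cb_def cfb_eq flip: sum_distrib_left)
  finally have 1: "(\<Sum>v<8. S j v * cb v l) = 4 * h l - cb j l - cfb j l" .
  have 2: "(\<Sum>v<8. S j v) = 9 - g j" using degree_sums(3)[OF assms(1)] by (simp add: g_def)
  have "(\<Sum>v<8. S j v * g v) = (\<Sum>v<8. S j v * (\<Sum>i<6. C v i * 1))" by (simp add: g_def)
  also have "\<dots> = (\<Sum>i<6. (\<Sum>v<8. S j v * C v i) * 1)" by (rule sum_triple)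
  also have "\<dots> = (\<Sum>i<6. 4 - C j i - (\<Sum>z<6. C j z * a z i))"
    by (rule sum.cong) (simp_all add: SC[OF assms(1)])
  also have "\<dots> = 24 - g j - (\<Sum>i<6. \<Sum>z<6. C j z * a z i)"
    by (simp add: sum_subtractf g_def)
  also have "(\<Sum>i<6. \<Sum>z<6. C j z * a z i) = (\<Sum>z<6. C j z * (\<Sum>i<6. a z i))"
    by (subst sum.swap) (simp add: sum_distrib_left)
  also have "\<dots> = (\<Sum>z<6. C j z * 3)" by (rule sum.cong) (simp_all add: row_sum3)
  also have "\<dots> = 3 * g j" by (simp add: g_def sum_distrib_left mult.commute)
  finally have 3: "(\<Sum>v<8. S j v * g v) = 24 - 4 * g j" by simp
  show ?thesis unfolding E_mult_right[OF assms(2)] 1 2 3 Z_def by (simp add: algebra_simps)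
qed

text \<open>The computation of \<open>SE\<close> from the other side, with \<open>B S\<close> and
  the in-degrees. Both products equal \<open>Z\<close>, so \<open>S\<close> commutes with
  \<open>E\<close>.\<close>

lemma ES:
  assumes "j < 8" "l < 8"
  shows "(\<Sum>v<8. E j v * S v l) = Z j l"
proof -
  have "(\<Sum>v<8. cb j v * S v l) = (\<Sum>i<6. C j i * (\<Sum>v<8. B i v * S v l))"
    unfolding cb_def by (rule sum_triple[symmetric])
  also have "\<dots> = (\<Sum>i<6. 4 * C j i - C j i * B i l - C j i * (\<Sum>z<6. a i z * B z l))"
    by (rule sum.cong) (simp_all add: BS[OF assms(2)] right_diff_distrib mult.commute[of _ 4])
  also have "\<dots> = 4 * g j - cb j l - cfb j l"
    by (simp add: sum_subtractf g_def cb_def cfb_def flip: sum_distrib_left)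
  finally have 1: "(\<Sum>v<8. cb j v * S v l) = 4 * g j - cb j l - cfb j l" .
  have 2: "(\<Sum>v<8. S v l) = 9 - h l" using degree_sums(4)[OF assms(2)] by (simp add: h_def)
  have "(\<Sum>v<8. h v * S v l) = (\<Sum>v<8. (\<Sum>i<6. 1 * B i v) * S v l)" by (simp add: h_def)
  also have "\<dots> = (\<Sum>i<6. 1 * (\<Sum>v<8. B i v * S v l))" by (rule sum_triple[symmetric])
  also have "\<dots> = (\<Sum>i<6. 4 - B i l - (\<Sum>z<6. a i z * B z l))"
    by (rule sum.cong) (simp_all add: BS[OF assms(2)])
  also have "\<dots> = 24 - h l - (\<Sum>i<6. \<Sum>z<6. a i z * B z l)"
    by (simp add: sum_subtractf h_def)
  also have "(\<Sum>i<6. \<Sum>z<6. a i z * B z l) = (\<Sum>z<6. (\<Sum>i<6. a i z) * B z l)"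
    by (subst sum.swap) (simp add: sum_distrib_right)
  also have "\<dots> = (\<Sum>z<6. 3 * B z l)" by (rule sum.cong) (simp_all add: col_sum3)
  also have "\<dots> = 3 * h l" by (simp add: h_def sum_distrib_left)
  finally have 3: "(\<Sum>v<8. h v * S v l) = 24 - 4 * h l" by simp
  show ?thesis unfolding E_mult_left[OF assms(1)] 1 2 3 Z_def by (simp add: algebra_simps)
qed

lemma sum_g: "(\<Sum>v<8. g v) = 18"
  unfolding g_def by (subst sum.swap) (simp add: C_col_sum)

text \<open>Together with \<open>col_E\<close> this places the columns of \<open>E\<close> in the
  common kernel of \<open>B\<close> and the all one vector. It rests on
  \<open>B C B = J B + B\<close> and the row weights 3.\<close>

lemma BE:
  assumes "i < 6" "l < 8"
  shows "(\<Sum>v<8. B i v * E v l) = 0"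
proof -
  have "(\<Sum>v<8. B i v * cb v l) = (\<Sum>k<6. (\<Sum>v<8. B i v * C v k) * B k l)"
    unfolding cb_def by (rule sum_triple)
  also have "\<dots> = (\<Sum>k<6. B k l + (if i = k then 1 else 0) * B k l)"
    by (rule sum.cong) (simp_all add: BC[OF assms(1)])
  also have "\<dots> = h l + B i l" by (simp only: sum.distrib h_def sum_delta_mult(2)[OF assms(1)] mult_1)
  finally have 1: "(\<Sum>v<8. B i v * cb v l) = h l + B i l" .
  have "(\<Sum>v<8. B i v * g v) = (\<Sum>k<6. \<Sum>v<8. B i v * C v k)"
    unfolding g_def sum_distrib_left by (rule sum.swap)
  also have "\<dots> = (\<Sum>k<6. 1 + (if i = k then 1 else 0))" by (rule sum.cong) (simp_all add: BC[OF assms(1)])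
  also have "\<dots> = 7" using assms(1) by (simp add: sum.distrib)
  finally have 2: "(\<Sum>v<8. B i v * g v) = 7" .
  show ?thesis unfolding E_mult_right[OF assms(2)] 1 2 B_row_sum[OF assms(1)] by simp
qed

lemma col_E:
  assumes "l < 8"
  shows "(\<Sum>v<8. E v l) = 0"
proof -
  have "(\<Sum>v<8. cb v l) = (\<Sum>i<6. (\<Sum>v<8. C v i) * B i l)"
    unfolding cb_def by (subst sum.swap) (simp add: sum_distrib_right)
  also have "\<dots> = (\<Sum>i<6. 3 * B i l)" by (rule sum.cong) (simp_all add: C_col_sum)
  also have "\<dots> = 3 * h l" by (simp add: h_def sum_distrib_left)
  finally show ?thesis using E_mult_right[OF assms, of "\<lambda>_. 1"] by (simp add: sum_g)
qed

lemma cb_E: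
  assumes "j < 8" "l < 8"
  shows "(\<Sum>v<8. cb j v * E v l) = 0"
proof -
  have "(\<Sum>v<8. cb j v * E v l) = (\<Sum>i<6. C j i * (\<Sum>v<8. B i v * E v l))"
    unfolding cb_def by (rule sum_triple[symmetric])
  also have "\<dots> = 0" by (rule sum.neutral) (simp add: BE[OF _ assms(2)])
  finally show ?thesis .
qed

text \<open>By \<open>pair_paths\<close>, \<open>S^2 + S = 8 J + 2 I - 2 C B\<close>. Both
  \<open>J\<close> and \<open>B\<close> annihilate \<open>E\<close>, which leaves
  \<open>(S^2 + S) E = 2 E\<close>.\<close>

lemma SZ:
  assumes "j < 8" "l < 8"
  shows "(\<Sum>v<8. S j v * Z v l) + Z j l = 2 * E j l"
proof -
  have "(\<Sum>v<8. S j v * Z v l) = (\<Sum>v<8. S j v * (\<Sum>w<8. S v w * E w l))"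
    by (rule sum.cong) (simp_all add: SE[OF _ assms(2)])
  also have "\<dots> = (\<Sum>w<8. (\<Sum>v<8. S j v * S v w) * E w l)" by (rule sum_triple)
  also have "\<dots> = (\<Sum>w<8. 8 * E w l - S j w * E w l + (if j = w then 2 else 0) * E w l - 2 * (cb j w * E w l))"
  proof (rule sum.cong)
    fix w :: nat assume "w \<in> {..<8}"
    then have "(\<Sum>v<8. S j v * S v w) = 8 - S j w + (if j = w then 2 else 0) - 2 * cb j w"
      using pair_paths(1)[OF assms(1), of w] by (simp add: cb_def)
    then show "(\<Sum>v<8. S j v * S v w) * E w l = 8 * E w l - S j w * E w l + (if j = w then 2 else 0) * E w l - 2 * (cb j w * E w l)"
      by (simp only:) (simp add: algebra_simps)
  qed simp
  also have "\<dots> = 8 * (\<Sum>w<8. E w l) - Z j l + 2 * E j l - 2 * (\<Sum>w<8. cb j w * E w l)"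
    by (simp only: sum.distrib sum_subtractf SE[OF assms] sum_delta_mult(2)[OF assms(1)] flip: sum_distrib_left)
  finally show ?thesis by (simp add: col_E[OF assms(2)] cb_E[OF assms])
qed

text \<open>
  The rank one matrix \<open>E\<close> is twice the projection to the common kernel of \<open>B\<close> and the all one vector,
  which \<open>S\<close> commutes with. Hence \<open>S E\<close> is a multiple of \<open>E\<close>, and the quadratic equation for \<open>S\<close> leaves two factors.
\<close>

lemma Z_multiple:
  assumes pq: "p < 8" "q < 8" and e: "E p q \<noteq> 0"
    and rank: "\<And>j l. j < 8 \<Longrightarrow> l < 8 \<Longrightarrow> E j l * E p q = E j q * E p l"
  shows "\<exists>th\<in>{1, -2}. \<forall>j<8. \<forall>l<8. Z j l = th * E j l"
proof -
  \<comment> \<open>The rows of \<open>E\<close> are proportional, and \<open>Z = E S\<close>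
    inherits the factors.\<close>
  have 1: "Z j q * E p q = E j q * Z p q" if j: "j < 8" for j
  proof -
    have "Z j q * E p q = (\<Sum>v<8. E j v * S v q * E p q)"
      by (simp only: ES[OF j pq(2), symmetric] sum_distrib_right)
    also have "\<dots> = (\<Sum>v<8. E j q * (E p v * S v q))"
    proof (rule sum.cong)
      fix v :: nat assume "v \<in> {..<8}"
      then have "E j v * E p q = E j q * E p v" using rank[OF j] by simp
      then show "E j v * S v q * E p q = E j q * (E p v * S v q)" by (metis mult.assoc mult.commute)
    qed simp
    also have "\<dots> = E j q * Z p q" by (simp only: ES[OF pq, symmetric] sum_distrib_left)
    finally show ?thesis .
  qed
  \<comment> \<open>Now \<open>Z = S E\<close> inherits the proportional columns, which carries the
    multiple from column \<open>q\<close> to all columns. Multiplying by the pivot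
    \<open>E p q\<close> replaces a division.\<close>
  have 2: "Z j l * E p q = Z p q * E j l" if j: "j < 8" and l: "l < 8" for j l
  proof -
    have "Z j l * E p q = (\<Sum>v<8. S j v * (E v l * E p q))"
      by (simp only: SE[OF j l, symmetric] sum_distrib_right mult.assoc)
    also have "\<dots> = (\<Sum>v<8. S j v * E v q * E p l)" by (rule sum.cong) (simp_all add: rank[OF _ l])
    also have "\<dots> = Z j q * E p l" by (simp only: SE[OF j pq(2), symmetric] sum_distrib_right)
    finally have "Z j l * E p q * E p q = Z j q * E p q * E p l" by simp
    also have "\<dots> = Z p q * (E j l * E p q)" by (simp add: 1[OF j] rank[OF j l])
    finally show ?thesis using e by simp
  qed
  have "(\<Sum>v<8. S p v * Z v q) * E p q = (\<Sum>v<8. S p v * (Z v q * E p q))"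
    by (simp add: sum_distrib_right mult.assoc)
  also have "\<dots> = (\<Sum>v<8. S p v * (E v q * Z p q))" by (rule sum.cong) (simp_all add: 1)
  also have "\<dots> = Z p q * Z p q" by (simp only: SE[OF pq, symmetric] sum_distrib_right mult.assoc)
  finally have "Z p q * Z p q + Z p q * E p q = 2 * E p q * E p q"
    using SZ[OF pq] by (metis distrib_right)
  \<comment> \<open>With \<open>Z p q = c * E p q\<close> this is \<open>c^2 + c = 2\<close>, whose
    roots are 1 and -2.\<close>
  then have "(Z p q - E p q) * (Z p q - (-2) * E p q) = 0" by (simp add: algebra_simps)
  then have "Z p q = 1 * E p q \<or> Z p q = (-2) * E p q" by (metis mult_1 mult_eq_0_iff right_minus_eq)
  then obtain th where th: "th \<in> {1, -2}" "Z p q = th * E p q" by blast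
  have "Z j l = th * E j l" if "j < 8" "l < 8" for j l
    using 2[OF that] th(2) e by (simp add: mult_ac)
  then show ?thesis using th(1) by blast
qed

text \<open>The equation for \<open>Z\<close> is solved for \<open>S\<close>. The terms
  \<open>C B\<close> and \<open>g h\<close> of \<open>Z\<close> are those of \<open>E\<close> up to
  sign and factor, which absorbs them into one more copy of \<open>E\<close> and turns
  \<open>th\<close> into \<open>th + 1\<close>.\<close>

lemma S_formula:
  assumes "\<forall>j<8. \<forall>l<8. Z j l = th * E j l" "j < 8" "l < 8"
  shows "2 * S j l = (th + 1) * E j l + 2 * (- cfb j l - (if j = l then 1 else 0) - 1 + g j + h l)"
proof -
  have "Z j l = th * E j l" using assms by blast
  then show ?thesis by (cases "j = l") (simp_all add: Z_def E_def algebra_simps)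
qed

end

subsection \<open>Completeness of the search\<close>

fun trit_int :: "trit \<Rightarrow> int" where
  "trit_int Zer = 0"
| "trit_int Pls = 1"
| "trit_int Mns = -1"

lemma bal_iff:
  assumes "length xs = n" "length ys = n"
  shows "bal xs ys p m \<longleftrightarrow> int p + (\<Sum>i<n. trit_int (xs ! i) * trit_int (ys ! i)) = int m"
  using assms
proof (induction xs ys p m arbitrary: n rule: bal.induct)
qed (auto simp: sum.lessThan_Suc_shift simp del: sum.lessThan_Suc)

lemma t_eq_iff:
  assumes "length r = n" "length c = n"
  shows "t_eq d r c t \<longleftrightarrow> (\<Sum>i<n. trit_int (r ! i) * trit_int (c ! i)) + trit_int t = int d"
  by (cases t) (auto simp: bal_iff[OF assms])

lemma row_ok_if_iff: "row_ok_if b p ts r \<longleftrightarrow> b \<and> row_ok p ts r"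
  by (cases b) auto

lemma row_okI:
  "length p \<le> length ts \<Longrightarrow> (\<And>i. i < length p \<Longrightarrow> t_eq 0 r (snd (p ! i)) (ts ! i)) \<Longrightarrow> row_ok p ts r"
proof (induction p arbitrary: ts)
  case (Cons x p)
  obtain t ts' where ts: "ts = t # ts'" using Cons.prems(1) by (cases ts) auto
  have "row_ok p ts' r"
  proof (rule Cons.IH)
    fix i assume "i < length p"
    then show "t_eq 0 r (snd (p ! i)) (ts' ! i)" using Cons.prems(2)[of "Suc i"] ts by simp
  qed (use Cons.prems(1) ts in auto)
  then show ?case using Cons.prems(2)[of 0] ts by (cases x) (simp add: row_ok_if_iff)
qed simp

lemma col_ok_if_iff: "col_ok_if b p ts c \<longleftrightarrow> b \<and> col_ok p ts c"
  by (cases b) auto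

lemma col_okI:
  "length p \<le> length ts \<Longrightarrow> (\<And>i. i < length p \<Longrightarrow> t_eq 0 (fst (p ! i)) c (ts ! i)) \<Longrightarrow> col_ok p ts c"
proof (induction p arbitrary: ts)
  case (Cons x p)
  obtain t ts' where ts: "ts = t # ts'" using Cons.prems(1) by (cases ts) auto
  have "col_ok p ts' c"
  proof (rule Cons.IH)
    fix i assume "i < length p"
    then show "t_eq 0 (fst (p ! i)) c (ts' ! i)" using Cons.prems(2)[of "Suc i"] ts by simp
  qed (use Cons.prems(1) ts in auto)
  then show ?case using Cons.prems(2)[of 0] ts by (cases x) (simp add: col_ok_if_iff)
qed simp

lemma heads_at_eq: "heads_at k p = map (\<lambda>x. [snd x ! k]) p"
  by (induction p) auto

lemma tails_at_eq: "tails_at k p = map (\<lambda>x. [fst x ! k]) p"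
  by (induction p) auto

lemma set_cross:
  "set (cross p k cc rs) = (\<Union>r\<in>set rs. Pair r ` {c \<in> set (choices (tails_at k p @ [r ! k] # cc)). col_good p r (r ! k) c})"
  by (induction rs) (auto simp del: col_good.simps choices.simps)

lemma small_diff_add: "s \<le> 2 \<Longrightarrow> small_diff (s + n) n = Some s"
proof (induction n)
  case 0
  then have "s = 0 \<or> s = Suc 0 \<or> s = Suc (Suc 0)" by arith
  then show ?case by auto
qed auto

lemma sum_where_eq:
  assumes "length c = n" "length ns = n"
  shows "sum_where c ns = (\<Sum>i<n. of_bool (c ! i) * ns ! i)"
  using assms
proof (induction c ns arbitrary: n rule: sum_where.induct)
qed (auto simp: sum.lessThan_Suc_shift simp del: sum.lessThan_Suc sum_of_bool_mult_eq)

lemma s_colI: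
  "length ws = length cs \<Longrightarrow> length ss = length cs \<Longrightarrow>
   (\<And>j. j < length cs \<Longrightarrow> small_diff (ws ! j) (sum_where (cs ! j) fb) = Some (ss ! j)) \<Longrightarrow> s_col ws cs fb = Some ss"
proof (induction cs arbitrary: ws ss)
  case (Cons c cs)
  obtain w ws' s ss' where ws: "ws = w # ws'" "ss = s # ss'"
    using Cons.prems(1,2) by (cases ws; cases ss) auto
  have "s_col ws' cs fb = Some ss'"
  proof (rule Cons.IH)
    fix j assume "j < length cs"
    then show "small_diff (ws' ! j) (sum_where (cs ! j) fb) = Some (ss' ! j)"
      using Cons.prems(3)[of "Suc j"] ws by simp
  qed (use Cons.prems(1,2) ws in auto)
  moreover have "small_diff w (sum_where c fb) = Some s" using Cons.prems(3)[of 0] ws by simp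
  ultimately show ?case using ws by simp
qed simp

lemma s_colsI:
  "length ws = length bs \<Longrightarrow> length ss = length bs \<Longrightarrow>
   (\<And>l. l < length bs \<Longrightarrow> s_col (ws ! l) cs (meets (bs ! l) F) = Some (ss ! l)) \<Longrightarrow> s_cols ws cs bs F = Some ss"
proof (induction bs arbitrary: ws ss)
  case (Cons b bs)
  obtain w ws' s ss' where ws: "ws = w # ws'" "ss = s # ss'"
    using Cons.prems(1,2) by (cases ws; cases ss) auto
  have "s_cols ws' cs bs F = Some ss'"
  proof (rule Cons.IH)
    fix j assume "j < length bs"
    then show "s_col (ws' ! j) cs (meets (bs ! j) F) = Some (ss' ! j)"
      using Cons.prems(3)[of "Suc j"] ws by simp
  qed (use Cons.prems(1,2) ws in auto)
  moreover have "s_col w cs (meets b F) = Some s" using Cons.prems(3)[of 0] ws by simp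
  ultimately show ?case using ws by simp
qed simp

lemma all_some_map: "(\<And>x. x \<in> set xs \<Longrightarrow> f x = Some (g x)) \<Longrightarrow> all_some (map f xs) = Some (map g xs)"
  by (induction xs) auto

lemma proportionalD:
  "proportional a b xs ys \<Longrightarrow> j < length xs \<Longrightarrow> j < length ys \<Longrightarrow> xs ! j * b = a * ys ! j"
  by (induction a b xs ys arbitrary: j rule: proportional.induct) (auto simp: nth_Cons split: nat.splits)

lemma set_t_extend: "set (t_extend F S Ts) = (\<lambda>T. (F, S, T)) ` set Ts"
  by (induction Ts) auto

lemma set_f_extend: "set (f_extend w cs bs Fs) = (\<Union>F\<in>set Fs. set (s_extend F (s_cols w cs bs F)))"
  by (induction Fs) auto

section \<open>Reassembling the adjacency matrix from its blocks\<close>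

lemma length_doubled [simp]: "length (doubled xs) = 2 * length xs"
  by (induction xs) auto

lemma nth_doubled: "x < 2 * length xs \<Longrightarrow> doubled xs ! x = xs ! (x div 2)"
proof (induction xs arbitrary: x)
  case (Cons y xs)
  show ?case
  proof (cases "x < 2")
    case True
    then have "x = 0 \<or> x = 1" by arith
    then show ?thesis by auto
  next
    case False
    then obtain z where "x = Suc (Suc z)" by (metis One_nat_def Suc_1 less_2_cases_iff not0_implies_Suc)
    then show ?thesis using Cons by simp
  qed
qed simp

lemma pair_row:
  assumes "length ss = length ts"
  shows "length (pair_row ss ts) = 2 * length ts \<and> length (pair_row' ss ts) = 2 * length ts \<and>
    (\<forall>y<2 * length ts. pair_row ss ts ! y = (if even y then same_bit else diff_bit) (ss ! (y div 2)) (ts ! (y div 2)) \<and>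
      pair_row' ss ts ! y = (if even y then diff_bit else same_bit) (ss ! (y div 2)) (ts ! (y div 2)))"
  using assms
proof (induction ts arbitrary: ss)
  case (Cons t ts)
  obtain s ss' where ss: "ss = s # ss'" using Cons.prems by (cases ss) auto
  note IH = Cons.IH[of ss']
  have "pair_row ss (t # ts) ! y = (if even y then same_bit else diff_bit) (ss ! (y div 2)) ((t # ts) ! (y div 2)) \<and>
      pair_row' ss (t # ts) ! y = (if even y then diff_bit else same_bit) (ss ! (y div 2)) ((t # ts) ! (y div 2))"
    if y: "y < 2 * length (t # ts)" for y
  proof (cases "y < 2")
    case True
    then have "y = 0 \<or> y = 1" by arith
    then show ?thesis using ss by auto
  next
    case False
    then obtain z where "y = Suc (Suc z)" by (metis One_nat_def Suc_1 less_2_cases_iff not0_implies_Suc)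
    then show ?thesis using IH Cons.prems y ss by simp
  qed
  then show ?case using IH Cons.prems ss by simp
qed simp

lemma fixed_rows:
  "length (fixed_rows bs F i) = length F \<and>
   (\<forall>x<length F. fixed_rows bs F i ! x = F ! x @ doubled (nth_all bs (i + x)))"
  by (induction F arbitrary: i) (auto simp: nth_Cons split: nat.splits)

lemma pair_rows:
  assumes "length cs = length T"
  shows "length (pair_rows cs S j T) = 2 * length T \<and> (\<forall>x<2 * length T. pair_rows cs S j T ! x =
    cs ! (x div 2) @ (if even x then pair_row else pair_row') (nth_all S (j + x div 2)) (fst (T ! (x div 2))))"
  using assms
proof (induction T arbitrary: cs j)
  case (Cons t T)
  obtain c cs' where cs: "cs = c # cs'" using Cons.prems by (cases cs) auto
  obtain r r' where t: "t = (r, r')" by (cases t)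
  have IH: "length (pair_rows cs' S (Suc j) T) = 2 * length T \<and> (\<forall>x<2 * length T. pair_rows cs' S (Suc j) T ! x =
    cs' ! (x div 2) @ (if even x then pair_row else pair_row') (nth_all S (Suc j + x div 2)) (fst (T ! (x div 2))))"
    by (rule Cons.IH) (use Cons.prems cs in simp)
  have "pair_rows cs S j (t # T) ! x =
    cs ! (x div 2) @ (if even x then pair_row else pair_row') (nth_all S (j + x div 2)) (fst ((t # T) ! (x div 2)))"
    if x: "x < 2 * length (t # T)" for x
  proof (cases "x < 2")
    case True
    then have "x = 0 \<or> x = 1" by arith
    then show ?thesis using cs t by auto
  next
    case False
    then obtain z where z: "x = Suc (Suc z)" by (metis One_nat_def Suc_1 less_2_cases_iff not0_implies_Suc)
    then show ?thesis using IH x cs t by simp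
  qed
  then show ?case using IH cs t by auto
qed simp

lemma leaf_cert_okD:
  assumes "leaf_cert_ok bs cs ls qs" "l \<in> set ls"
  shows "\<exists>k<82. \<exists>p. is_perm 22 p \<and> select_rows p (select p (leaf_mat bs cs l)) = graph_mat k"
  using assms
proof (induction ls arbitrary: qs)
  case (Cons l' ls)
  obtain k p qs' where qs: "qs = (k, p) # qs'" using Cons.prems(1) by (cases qs) auto
  have 1: "k < 82" "is_perm 22 p" "select_rows p (select p (leaf_mat bs cs l')) = graph_mat k" "leaf_cert_ok bs cs ls qs'"
    using Cons.prems(1) unfolding qs leaf_cert_ok.simps by blast+
  show ?case
  proof (cases "l = l'")
    case True
    then show ?thesis using 1 by blast
  next
    case False
    then show ?thesis using Cons.IH[OF 1(4)] Cons.prems(2) by simp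
  qed
qed simp

section \<open>The matrices S and T as input of the search\<close>

context swap_dsrg
begin

definition sn :: "nat \<Rightarrow> nat \<Rightarrow> nat" where
  "sn j l = of_bool (A (6 + 2 * j) (6 + 2 * l)) + of_bool (A (6 + 2 * j) (7 + 2 * l))"

definition tr :: "nat \<Rightarrow> nat \<Rightarrow> trit" where
  "tr j l = (if A (6 + 2 * j) (6 + 2 * l) = A (6 + 2 * j) (7 + 2 * l) then Zer
     else if A (6 + 2 * j) (6 + 2 * l) then Pls else Mns)"

text \<open>With \<open>k = max j l\<close>, no odd entry of \<open>S\<close> precedes
  \<open>(j, l)\<close> in the order \<open>0 k, k 0, 1 k, k 1, ...\<close>. The odd entries of
  \<open>S\<close> are the positions where \<open>T\<close> is non-zero.\<close>

definition lead :: "nat \<Rightarrow> nat \<Rightarrow> bool" where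
  "lead j l \<longleftrightarrow> (\<forall>i<min j l. sn i (max j l) \<noteq> 1 \<and> sn (max j l) i \<noteq> 1) \<and> (l < j \<longrightarrow> sn l j \<noteq> 1)"

definition normal :: bool where
  "normal \<longleftrightarrow> (\<forall>j<8. \<forall>l<8. j \<noteq> l \<and> sn j l = 1 \<and> lead j l \<longrightarrow> tr j l = Pls)"

lemma S_sn: "S j l = int (sn j l)"
  by (simp add: S_def sn_def a_def)

lemma T_tr: "T j l = trit_int (tr j l)"
  by (simp add: T_def tr_def a_def)

lemma sn_le: "sn j l \<le> 2"
  by (simp add: sn_def)

lemma tr_cases: "tr j l \<in> set (if sn j l = 1 then [Pls, Mns] else [Zer])"
  by (auto simp: tr_def sn_def)

lemma diag_bit: "j < 8 \<Longrightarrow> \<not> A (6 + 2 * j) (6 + 2 * j)"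
  using dsrg by (simp add: dsrg_mat_def)

lemma tr_diag: "j < 8 \<Longrightarrow> tr j j = (if sn j j = 0 then Zer else Mns) \<and> sn j j \<le> 1"
  using diag_bit[of j] by (auto simp: tr_def sn_def)

text \<open>Stored by columns, like the matrices that \<open>s_cols\<close> returns.\<close>

definition s_mat :: "nat list list" where
  "s_mat = map (\<lambda>l. map (\<lambda>j. sn j l) [0..<8]) [0..<8]"

definition t_mat :: "(trit list \<times> trit list) list" where
  "t_mat = map (\<lambda>k. (map (tr k) [0..<8], map (\<lambda>j. tr j k) [0..<8])) [0..<8]"

lemma nth_s_mat: "j < 8 \<Longrightarrow> l < 8 \<Longrightarrow> s_mat ! l ! j = sn j l"
  by (simp add: s_mat_def)

lemma nth_t_mat: "k < 8 \<Longrightarrow> t_mat ! k = (map (tr k) [0..<8], map (\<lambda>j. tr j k) [0..<8])"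
  by (simp add: t_mat_def)

lemma s_lead_eq: "j < 8 \<Longrightarrow> l < 8 \<Longrightarrow> s_lead s_mat j l = lead j l"
  by (auto simp: s_lead_def lead_def s_odd_def nth_s_mat list_all_iff)

lemma tr_in_opt:
  assumes "normal" "j < 8" "l < 8"
  shows "tr j l \<in> set (t_opt s_mat j l)"
  using assms tr_cases[of j l] tr_diag[of j]
  by (auto simp: t_opt_def nth_s_mat s_odd_def s_lead_eq normal_def le_Suc_eq split: if_splits)

lemma t_eq_tr:
  assumes "j < 8" "l < 8"
  shows "t_eq (if j = l then 2 else 0) (map (tr j) [0..<8]) (map (\<lambda>i. tr i l) [0..<8]) (tr j l)"
  using pair_paths(2)[OF assms] by (auto simp: t_eq_iff[of _ 8] T_tr)

text \<open>Normality puts every entry among its options, and \<open>T^2 + T = 2 I\<close> passes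
  all tests between the new row and column and the earlier ones.\<close>

lemma t_mat_in_search:
  assumes normal
  shows "t_mat \<in> set (t_search s_mat)"
  unfolding t_search_def
proof (rule dfs_complete)
  fix m assume "m < length t_mat"
  then have m: "m < 8" by (simp add: t_mat_def)
  define p where "p = take m t_mat"
  have lp: "length p = m" using m by (simp add: p_def t_mat_def)
  have np: "p ! i = (map (tr i) [0..<8], map (\<lambda>j. tr j i) [0..<8])" if "i < m" for i
    using that m by (simp add: p_def nth_t_mat)
  let ?r = "map (tr m) [0..<8]" and ?c = "map (\<lambda>j. tr j m) [0..<8]"
  let ?O = "t_opts s_mat" and ?Q = "t_opts' s_mat"
  have r: "?r \<in> set (choices (heads_at m p @ drop m (?O ! m)))"
    unfolding set_choices
  proof (rule list_all2_all_nthI)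
    fix i assume "i < length ?r"
    then have i: "i < 8" by simp
    show "?r ! i \<in> set ((heads_at m p @ drop m (?O ! m)) ! i)"
      using i m tr_in_opt[OF assms m i] by (auto simp: heads_at_eq nth_append lp np t_opts_def)
  qed (use m in \<open>simp add: heads_at_eq lp t_opts_def\<close>)
  have row: "row_good p ?r" unfolding row_good.simps
  proof (rule row_okI)
    fix i assume "i < length p"
    then show "t_eq 0 ?r (snd (p ! i)) (?r ! i)" using t_eq_tr[of m i] m by (simp add: lp np)
  qed (use m lp in simp)
  have c: "?c \<in> set (choices (tails_at m p @ [?r ! m] # drop (Suc m) (?Q ! m)))"
    unfolding set_choices
  proof (rule list_all2_all_nthI)
    fix i assume "i < length ?c"
    then have i: "i < 8" by simp
    consider "i < m" | "i = m" | "m < i" by linarith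
    then show "?c ! i \<in> set ((tails_at m p @ [?r ! m] # drop (Suc m) (?Q ! m)) ! i)"
    proof cases
      case 3
      then obtain d where d: "i = m + Suc d" using less_imp_Suc_add by auto
      then show ?thesis using i m tr_in_opt[OF assms i m]
        by (simp add: tails_at_eq nth_append lp t_opts'_def)
    qed (use i m in \<open>auto simp: tails_at_eq nth_append lp np\<close>)
  qed (use m in \<open>simp add: tails_at_eq lp t_opts'_def\<close>)
  have col: "col_good p ?r (?r ! m) ?c" unfolding col_good.simps col_ok_if_iff
  proof (intro conjI col_okI)
    show "t_eq 2 ?r ?c (?r ! m)" using t_eq_tr[of m m] m by simp
    fix i assume "i < length p"
    then show "t_eq 0 (fst (p ! i)) ?c (?c ! i)" using t_eq_tr[of i m] m by (simp add: lp np)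
  qed (use m lp in simp)
  have "(?r, ?c) \<in> set (t_cand ?O ?Q p)"
    unfolding t_cand.simps t_cand_aux.simps set_cross lp
  proof (rule UN_I)
    show "?r \<in> set (sieve (row_good p) (choices (heads_at m p @ drop m (?O ! m))))"
      by (simp only: set_sieve mem_Collect_eq r row simp_thms)
    show "(?r, ?c) \<in> Pair ?r ` {c \<in> set (choices (tails_at m p @ [?r ! m] # drop (Suc m) (?Q ! m))). col_good p ?r (?r ! m) c}"
      by (rule imageI) (simp only: mem_Collect_eq c col simp_thms)
  qed
  then show "t_mat ! m \<in> set (t_cand ?O ?Q (take m t_mat))" using m by (simp only: p_def nth_t_mat)
qed (simp_all add: t_mat_def)

end

section \<open>Matrices whose blocks B and C are a stored representative\<close>

locale rep_dsrg = swap_dsrg +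
  fixes r :: "num list"
  assumes length_r: "length r = 8"
    and b_cols_r: "j < 8 \<Longrightarrow> b_cols r ! j = map (\<lambda>i. A i (6 + 2 * j)) [0..<6]"
    and c_rows_r: "j < 8 \<Longrightarrow> c_rows r ! j = map (\<lambda>i. A (6 + 2 * j) i) [0..<6]"
begin

abbreviation bs :: "bool list list" where
  "bs \<equiv> b_cols r"

abbreviation cs :: "bool list list" where
  "cs \<equiv> c_rows r"

lemma meet_int: "length xs = 6 \<Longrightarrow> length ys = 6 \<Longrightarrow> int (meet xs ys) = (\<Sum>i<6. of_bool (xs ! i) * of_bool (ys ! i))"
  unfolding meet_eq_sum[of xs 6 ys] of_nat_sum by (simp add: of_bool_conj del: sum_of_bool_eq)

lemma meet_g: "j < 8 \<Longrightarrow> int (meet (cs ! j) (cs ! j)) = g j"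
  by (simp add: meet_int c_rows_r g_def C_def a_def flip: of_bool_conj)

lemma meet_h: "l < 8 \<Longrightarrow> int (meet (bs ! l) (bs ! l)) = h l"
  by (simp add: meet_int b_cols_r h_def B_def a_def flip: of_bool_conj)

lemma meet_cb: "j < 8 \<Longrightarrow> l < 8 \<Longrightarrow> int (meet (cs ! j) (bs ! l)) = cb j l"
  by (simp add: meet_int b_cols_r c_rows_r cb_def C_def B_def a_def)

lemma e2_entry_E: "j < 8 \<Longrightarrow> l < 8 \<Longrightarrow> e2_entry bs cs l j = E j l"
  by (simp add: e2_entry_def Let_def meet_g meet_h meet_cb E_def)

lemma e2_cols_E: "j < 8 \<Longrightarrow> l < 8 \<Longrightarrow> e2_cols bs cs ! l ! j = E j l"
  by (simp add: e2_cols_def e2_col_def e2_entry_E)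

lemma S_from_pivot:
  assumes "pivot_ok (e2_cols bs cs) pq"
  obtains th where "th \<in> {1, -2}"
    "\<And>j l. j < 8 \<Longrightarrow> l < 8 \<Longrightarrow> 2 * S j l = (th + 1) * E j l + 2 * (- cfb j l - (if j = l then 1 else 0) - 1 + g j + h l)"
proof -
  obtain p q where pq: "pq = (p, q)" by (cases pq)
  have p: "p < 8" "q < 8" "E p q \<noteq> 0" using assms by (auto simp: pq pivot_ok_def e2_cols_E)
  have rank: "E j l * E p q = E j q * E p l" if j: "j < 8" and l: "l < 8" for j l
  proof -
    have len: "length (e2_cols bs cs) = 8" "length (e2_cols bs cs ! l) = 8" "length (e2_cols bs cs ! q) = 8"
      using l p by (simp_all add: e2_cols_def e2_col_def)
    have "proportional (e2_cols bs cs ! l ! p) (e2_cols bs cs ! q ! p) (e2_cols bs cs ! l) (e2_cols bs cs ! q)"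
      using assms l len by (simp add: pq pivot_ok_def list_all_length)
    from proportionalD[OF this, of j] show ?thesis using j l p len by (simp add: e2_cols_E mult.commute)
  qed
  obtain th where th: "th \<in> {1, -2}" "\<forall>j<8. \<forall>l<8. Z j l = th * E j l"
    using Z_multiple[OF p rank] by blast
  show ?thesis using that[OF th(1)] S_formula[OF th(2)] by blast
qed

abbreviation fl :: "bool list list" where
  "fl \<equiv> map (\<lambda>i. map (A i) [0..<6]) [0..<6]"

lemma sum_where_cfb:
  assumes "j < 8" "l < 8"
  shows "int (sum_where (cs ! j) (meets (bs ! l) fl)) = cfb j l"
proof -
  have "sum_where (cs ! j) (meets (bs ! l) fl) = (\<Sum>i<6. of_bool (cs ! j ! i) * meets (bs ! l) fl ! i)"
    by (rule sum_where_eq) (use assms in \<open>simp_all add: c_rows_r meets_eq\<close>)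
  also have "int \<dots> = (\<Sum>i<6. of_bool (cs ! j ! i) * int (meets (bs ! l) fl ! i))"
    by (simp only: of_nat_sum of_nat_mult of_nat_of_bool)
  also have "\<dots> = (\<Sum>i<6. C j i * (\<Sum>k<6. a i k * B k l))"
  proof (rule sum.cong)
    fix i :: nat assume "i \<in> {..<6}"
    then have i: "i < 6" by simp
    have "int (meets (bs ! l) fl ! i) = int (meet (map (A i) [0..<6]) (bs ! l))" using i by (simp add: meets_eq)
    also have "\<dots> = (\<Sum>k<6. a i k * B k l)" using assms by (simp add: meet_int b_cols_r a_def B_def)
    finally show "of_bool (cs ! j ! i) * int (meets (bs ! l) fl ! i) = C j i * (\<Sum>k<6. a i k * B k l)"
      using i assms by (simp add: c_rows_r C_def a_def)
  qed simp
  finally show ?thesis by (simp add: cfb_def)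
qed

lemma leaf_in:
  assumes pivot: "pivot_ok (e2_cols bs cs) pq" and nf: normal
  shows "(fl, s_mat, t_mat) \<in> set (rep_leaves fixed_parts r)"
proof -
  obtain th where th: "th \<in> {1, -2}" and
    S: "\<And>j l. j < 8 \<Longrightarrow> l < 8 \<Longrightarrow> 2 * S j l = (th + 1) * E j l + 2 * (- cfb j l - (if j = l then 1 else 0) - 1 + g j + h l)"
    using S_from_pivot[OF pivot] by blast
  \<comment> \<open>The entries of \<open>S + C F B\<close>, which \<open>w_entry\<close> computes
    without knowing \<open>F\<close>.\<close>
  define n where "n j l = sn j l + sum_where (cs ! j) (meets (bs ! l) fl)" for j l
  have w: "w_entry th bs cs (e2_cols bs cs) l j = Some (n j l)" if j: "j < 8" and l: "l < 8" for j l
  proof -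
    \<comment> \<open>\<open>S_formula\<close> makes this half of \<open>(th + 1) * E j l\<close>,
      so the test for parity succeeds.\<close>
    define e where "e = S j l + cfb j l + (if j = l then 1 else 0) + 1 - g j - h l"
    have "(th + 1) * E j l = 2 * e" using S[OF j l] by (simp add: e_def algebra_simps split: if_splits)
    then have "half_int ((th + 1) * (e2_cols bs cs ! l ! j)) = Some e" using j l by (simp add: e2_cols_E)
    moreover have "e - (if j = l then 1 else 0) - 1 + int (meet (cs ! j) (cs ! j)) + int (meet (bs ! l) (bs ! l)) = int (n j l)"
      using j l by (simp add: e_def n_def meet_g meet_h S_sn sum_where_cfb)
    ultimately show ?thesis by (simp add: w_entry_def)
  qed
  have "w_cols th bs cs (e2_cols bs cs) = Some (map (\<lambda>l. map (\<lambda>j. n j l) [0..<8]) [0..<8])"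
    unfolding w_cols_def by (rule all_some_map, unfold w_col_def, rule all_some_map) (simp add: w)
  moreover have "s_cols (map (\<lambda>l. map (\<lambda>j. n j l) [0..<8]) [0..<8]) cs bs fl = Some s_mat"
  proof (rule s_colsI)
    fix l assume "l < length bs"
    then have l: "l < 8" by (simp add: length_r)
    show "s_col (map (\<lambda>l. map (\<lambda>j. n j l) [0..<8]) [0..<8] ! l) cs (meets (bs ! l) fl) = Some (s_mat ! l)"
    proof (rule s_colI)
      fix j assume "j < length cs"
      then have j: "j < 8" by (simp add: length_r)
      show "small_diff (map (\<lambda>l. map (\<lambda>j. n j l) [0..<8]) [0..<8] ! l ! j) (sum_where (cs ! j) (meets (bs ! l) fl)) =
          Some (s_mat ! l ! j)"
        using j l small_diff_add[OF sn_le] by (simp add: n_def nth_s_mat)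
    qed (use l in \<open>simp_all add: length_r s_mat_def\<close>)
  qed (simp_all add: length_r s_mat_def)
  moreover have "(fl, s_mat, t_mat) \<in> set (s_extend fl (Some s_mat))"
    using t_mat_in_search[OF nf] by (simp add: set_t_extend)
  ultimately have "(fl, s_mat, t_mat) \<in> set (w_extend (w_cols th bs cs (e2_cols bs cs)) cs bs fixed_parts)"
    using fixed_part_in by (auto simp only: w_extend.simps set_f_extend)
  then show ?thesis using th by (auto simp: rep_leaves_def)
qed

lemma a_bool: "x < 22 \<Longrightarrow> y < 22 \<Longrightarrow> A (swap x) (swap y) = A x y"
  using inv by (simp add: swap_invariant_def)

text \<open>Sum and difference determine each circulant block, so the passage from the adjacency
  matrix to \<open>F\<close>, \<open>B\<close>, \<open>C\<close>, \<open>S\<close> and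
  \<open>T\<close> loses nothing.\<close>

lemma leaf_mat_eq: "leaf_mat bs cs (fl, s_mat, t_mat) = map (\<lambda>x. map (A x) [0..<22]) [0..<22]"
proof (rule nth_equalityI)
  have l1: "length (fixed_rows bs fl 0) = 6" using fixed_rows[of bs fl 0] by simp
  have tm: "length t_mat = 8" by (simp add: t_mat_def)
  have l2: "length (pair_rows cs s_mat 0 t_mat) = 16"
    using pair_rows[of cs t_mat s_mat 0] by (simp add: length_r tm)
  show "length (leaf_mat bs cs (fl, s_mat, t_mat)) = length (map (\<lambda>x. map (A x) [0..<22]) [0..<22])"
    using l1 l2 by simp
  fix x assume "x < length (leaf_mat bs cs (fl, s_mat, t_mat))"
  then have x: "x < 22" using l1 l2 by simp
  have sm: "nth_all s_mat j = map (sn j) [0..<8]" if "j < 8" for j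
    using that by (simp add: nth_all_eq s_mat_def)
  have pb: "even y \<Longrightarrow> A (6 + x') (6 + y) = A (6 + 2 * (x' div 2)) (6 + 2 * (y div 2))" if "even x'" for x' y
    using that by simp
  show "leaf_mat bs cs (fl, s_mat, t_mat) ! x = map (\<lambda>x. map (A x) [0..<22]) [0..<22] ! x"
  proof (rule nth_equalityI)
    have bits: "same_bit (sn j l) (tr j l) = A (6 + 2 * j) (6 + 2 * l)" "diff_bit (sn j l) (tr j l) = A (6 + 2 * j) (7 + 2 * l)" for j l
      by (auto simp: sn_def tr_def)
    have row: "leaf_mat bs cs (fl, s_mat, t_mat) ! x = (if x < 6 then map (A x) [0..<6] @ doubled (nth_all bs x)
      else cs ! ((x - 6) div 2) @ (if even x then pair_row else pair_row') (map (sn ((x - 6) div 2)) [0..<8]) (map (tr ((x - 6) div 2)) [0..<8]))"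
    proof (cases "x < 6")
      case True
      then show ?thesis using fixed_rows[of bs fl 0] l1 by (simp add: nth_append)
    next
      case False
      then have "(x - 6) div 2 < 8" "even (x - 6) = even x" using x by auto
      then show ?thesis using False x l1 pair_rows[of cs t_mat s_mat 0] by (simp add: nth_append length_r tm sm nth_t_mat)
    qed
    have lb: "length (nth_all bs x) = 8" by (simp add: nth_all_eq length_r)
    have lc: "length (cs ! ((x - 6) div 2)) = 6" if "\<not> x < 6" using that x by (simp add: c_rows_r)
    show "length (leaf_mat bs cs (fl, s_mat, t_mat) ! x) = length (map (\<lambda>x. map (A x) [0..<22]) [0..<22] ! x)"
      unfolding row using x lb lc by (simp add: pair_row)
    fix y assume "y < length (leaf_mat bs cs (fl, s_mat, t_mat) ! x)"
    then have y: "y < 22" unfolding row using x lb lc by (simp add: pair_row split: if_splits)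
    define l where "l = (y - 6) div 2"
    define j where "j = (x - 6) div 2"
    have lt: "l < 8" "j < 8" using x y by (auto simp: l_def j_def)
    have yc: "y < 6 \<or> y = 6 + 2 * l \<or> y = 7 + 2 * l" unfolding l_def by presburger
    have xc: "x < 6 \<or> x = 6 + 2 * j \<or> x = 7 + 2 * j" unfolding j_def by presburger
    have "leaf_mat bs cs (fl, s_mat, t_mat) ! x ! y = A x y"
    proof (cases "x < 6")
      case True
      show ?thesis
      proof (cases "y < 6")
        case False
        then have "leaf_mat bs cs (fl, s_mat, t_mat) ! x ! y = nth_all bs x ! l"
          unfolding row using True y lb by (simp add: nth_append nth_doubled l_def)
        also have "\<dots> = A x (6 + 2 * l)" using lt True by (simp add: nth_all_eq length_r b_cols_r)
        also have "\<dots> = A x y"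
          using yc False a_bool[of x "6 + 2 * l"] True lt by (auto simp: swap_values)
        finally show ?thesis .
      qed (use True row in \<open>simp add: nth_append\<close>)
    next
      case x6: False
      show ?thesis
      proof (cases "y < 6")
        case True
        have "leaf_mat bs cs (fl, s_mat, t_mat) ! x ! y = A (6 + 2 * j) y"
          unfolding row using True x6 lc lt by (simp add: nth_append j_def[symmetric] c_rows_r)
        also have "\<dots> = A x y"
          using xc x6 a_bool[of "6 + 2 * j" y] True lt by (auto simp: swap_values)
        finally show ?thesis .
      next
        case False
        have "y - 6 < 2 * 8" "even (y - 6) = even y" using y False by auto
        then have "leaf_mat bs cs (fl, s_mat, t_mat) ! x ! y = (if even x = even y then same_bit (sn j l) (tr j l) else diff_bit (sn j l) (tr j l))"
          unfolding row using False x6 lc lt by (auto simp: nth_append j_def[symmetric] l_def[symmetric] pair_row)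
        also have "\<dots> = A x y"
          using xc yc x6 False a_bool[of "6 + 2 * j" "6 + 2 * l"] a_bool[of "6 + 2 * j" "7 + 2 * l"] lt
          by (auto simp: bits swap_values)
        finally show ?thesis .
      qed
    qed
    then show "leaf_mat bs cs (fl, s_mat, t_mat) ! x ! y = map (\<lambda>x. map (A x) [0..<22]) [0..<22] ! x ! y"
      using x y by simp
  qed
qed

lemma isomorphic_to_graph:
  assumes "rep_ok fixed_parts r d" normal
  shows "\<exists>k<82. \<exists>p. bij_betw p {..<22} {..<22} \<and> (\<forall>x<22. \<forall>y<22. mat_fun (graph_mat k) x y = A (p x) (p y))"
proof -
  obtain pq qs where d: "d = (pq, qs)" by (cases d)
  have "pivot_ok (e2_cols bs cs) pq" "leaf_cert_ok bs cs (rep_leaves fixed_parts r) qs" using assms(1) by (simp_all add: d)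
  then obtain k p where k: "k < 82" and p: "is_perm 22 p"
    and eq: "select_rows p (select p (leaf_mat bs cs (fl, s_mat, t_mat))) = graph_mat k"
    using leaf_cert_okD leaf_in[OF _ assms(2)] by meson
  have p22: "length p = 22" "\<And>x. x < 22 \<Longrightarrow> p ! x < 22" using p by (auto simp: list_all_length)
  have "mat_fun (graph_mat k) x y = A (p ! x) (p ! y)" if "x < 22" "y < 22" for x y
    using that p22 by (simp add: mat_fun_def eq[symmetric] leaf_mat_eq del: leaf_mat.simps)
  then show ?thesis using k is_perm_bij[OF p] by blast
qed

end

subsection \<open>Normalisation\<close>

text \<open>A permutation that respects the pairs: \<open>p\<close> acts on the fixed points,
  \<open>q\<close> on the pairs, and \<open>e\<close> tells in which pairs the two points are
  exchanged. With bijective \<open>p\<close> and \<open>q\<close> it commutes with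
  \<open>swap\<close> on the 22 vertices.\<close>

definition relabel :: "(nat \<Rightarrow> nat) \<Rightarrow> (nat \<Rightarrow> nat) \<Rightarrow> (nat \<Rightarrow> bool) \<Rightarrow> nat \<Rightarrow> nat" where
  "relabel p q e x = (if x < 6 then p x else 6 + 2 * q ((x - 6) div 2) + of_bool (odd x \<noteq> e ((x - 6) div 2)))"

lemma relabel_values:
  "i < 6 \<Longrightarrow> relabel p q e i = p i"
  "relabel p q e (6 + 2 * j) = 6 + 2 * q j + of_bool (e j)"
  "relabel p q e (7 + 2 * j) = 6 + 2 * q j + of_bool (\<not> e j)"
  by (auto simp: relabel_def)

lemma relabel_bij:
  assumes p: "bij_betw p {..<6} {..<6}" and q: "bij_betw q {..<8} {..<8}"
  shows "bij_betw (relabel p q e) {..<22} {..<22}"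
proof -
  have p6: "p i < 6" if "i < 6" for i using p that bij_betwE by fastforce
  have q8: "q j < 8" if "j < 8" for j using q that bij_betwE by fastforce
  have into: "relabel p q e ` {..<22} \<subseteq> {..<22}"
  proof
    fix y assume "y \<in> relabel p q e ` {..<22}"
    then obtain x where x: "x < 22" "y = relabel p q e x" by auto
    show "y \<in> {..<22}"
    proof (cases "x < 6")
      case True
      then show ?thesis using x p6[of x] by (simp add: relabel_def)
    next
      case False
      then have "(x - 6) div 2 < 8" using x by auto
      from q8[OF this] show ?thesis using x False by (auto simp: relabel_def)
    qed
  qed
  moreover have "inj_on (relabel p q e) {..<22}"
  proof (rule inj_onI)
    fix x y assume xy: "x \<in> {..<22}" "y \<in> {..<22}" "relabel p q e x = relabel p q e y"
    have small: "relabel p q e z < 6 \<longleftrightarrow> z < 6" for z using p6[of z] by (auto simp: relabel_def)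
    show "x = y"
    proof (cases "x < 6")
      case True
      then have "y < 6" using small xy(3) by metis
      then show ?thesis using True xy(3) p by (auto simp: relabel_def bij_betw_def dest: inj_onD)
    next
      case False
      then have y6: "\<not> y < 6" using small xy(3) by metis
      define j where "j = (x - 6) div 2"
      define l where "l = (y - 6) div 2"
      have eq: "2 * q j + of_bool (odd x \<noteq> e j) = 2 * q l + (of_bool (odd y \<noteq> e l) :: nat)"
        using xy(3) False y6 by (simp add: relabel_def j_def l_def)
      then have "(2 * q j + of_bool (odd x \<noteq> e j)) div 2 = (2 * q l + (of_bool (odd y \<noteq> e l) :: nat)) div 2" by simp
      then have "q j = q l" by simp
      moreover have "j < 8" "l < 8" using xy(1,2) False y6 by (auto simp: j_def l_def)
      ultimately have jl: "j = l" using q by (auto simp: bij_betw_def dest: inj_onD)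
      have "(of_bool (odd x \<noteq> e j) :: nat) = of_bool (odd y \<noteq> e j)" using eq unfolding jl by linarith
      then have "(odd x \<noteq> e j) = (odd y \<noteq> e j)" by (simp only: of_bool_eq_iff)
      then have "odd x = odd y" by blast
      then show ?thesis using jl False y6 unfolding j_def l_def by presburger
    qed
  qed
  ultimately show ?thesis by (simp add: bij_betw_def endo_inj_surj)
qed

lemma swap_relabel:
  assumes "x < 22" "\<And>i. i < 6 \<Longrightarrow> p i < 6"
  shows "swap (relabel p q e x) = relabel p q e (swap x)"
proof -
  have "x < 6 \<or> x = 6 + 2 * ((x - 6) div 2) \<or> x = 7 + 2 * ((x - 6) div 2)" by presburger
  then obtain j where j: "x < 6 \<or> x = 6 + 2 * j \<or> x = 7 + 2 * j" by blast
  have sw: "swap (6 + 2 * j) = 7 + 2 * j" "swap (7 + 2 * j) = 6 + 2 * j" by (simp_all add: swap_def)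
  from j show ?thesis
  proof (elim disjE)
    assume x: "x < 6"
    then have "swap x = x" by (simp add: swap_def)
    then show ?thesis using assms(2)[OF x] by (simp add: relabel_values(1)[OF x] swap_def)
  next
    assume x: "x = 6 + 2 * j"
    show ?thesis unfolding x sw relabel_values by (cases "e j") (simp_all add: swap_def)
  next
    assume x: "x = 7 + 2 * j"
    show ?thesis unfolding x sw relabel_values by (cases "e j") (simp_all add: swap_def)
  qed
qed

lemma dsrg_mat_permuted:
  assumes p: "bij_betw p {..<22} {..<22}" and A: "dsrg_mat A"
  shows "dsrg_mat (\<lambda>x y. A (p x) (p y))"
proof -
  have p22: "p x < 22" if "x < 22" for x using p that bij_betwE by fastforce
  have "p x = p y \<longleftrightarrow> x = y" if "x < 22" "y < 22" for x y using p that by (auto simp: bij_betw_def dest: inj_onD)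
  then show ?thesis
    using A p22 card_permuted[OF p, of "A _"] card_permuted[OF p, of "\<lambda>y. A y _"] card_permuted[OF p, of "\<lambda>z. A _ z \<and> A z _"]
    by (simp add: dsrg_mat_def)
qed

lemma swap_dsrg_relabel:
  assumes "swap_dsrg A" and p: "bij_betw p {..<6} {..<6}" and q: "bij_betw q {..<8} {..<8}"
  shows "swap_dsrg (\<lambda>x y. A (relabel p q e x) (relabel p q e y))"
proof
  interpret swap_dsrg A by fact
  note b = relabel_bij[OF p q, of e]
  have p6: "p i < 6" if "i < 6" for i using p that bij_betwE by fastforce
  show "dsrg_mat (\<lambda>x y. A (relabel p q e x) (relabel p q e y))" by (rule dsrg_mat_permuted[OF b dsrg])
  have "relabel p q e x < 22" if "x < 22" for x using b that bij_betwE by fastforce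
  then show "swap_invariant (\<lambda>x y. A (relabel p q e x) (relabel p q e y))"
    using inv by (simp add: swap_invariant_def flip: swap_relabel[OF _ p6])
qed

context swap_dsrg
begin

definition leading :: "nat \<Rightarrow> nat \<Rightarrow> bool" where
  "leading j l \<longleftrightarrow> j \<noteq> l \<and> sn j l = 1 \<and> lead j l"

lemma leading_le:
  assumes "leading j l" "leading j' l'" "max j l = max j' l'"
  shows "min j' l' \<le> min j l"
proof (rule ccontr)
  assume "\<not> min j' l' \<le> min j l"
  then have "min j l < min j' l'" by (simp only: not_le)
  moreover have "sn i (max j l) \<noteq> 1 \<and> sn (max j l) i \<noteq> 1" if "i < min j' l'" for i
    using assms(2) that unfolding leading_def lead_def assms(3) by blast
  ultimately have "sn (min j l) (max j l) \<noteq> 1 \<and> sn (max j l) (min j l) \<noteq> 1" by blast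
  moreover have "sn j l = 1" using assms(1) by (simp add: leading_def)
  ultimately show False by (cases "j \<le> l") (auto simp: max_def min_def)
qed

text \<open>Each index \<open>k\<close> is the larger one of at most one position with a prescribed
  sign, so the prescriptions cannot conflict.\<close>

lemma leading_unique:
  assumes "leading j l" "leading j' l'" "max j l = max j' l'"
  shows "j = j' \<and> l = l'"
proof -
  have "min j l = min j' l'" by (rule antisym[OF leading_le[OF assms(2,1) assms(3)[symmetric]] leading_le[OF assms]])
  then have "(j = j' \<and> l = l') \<or> (j = l' \<and> l = j')" using assms(3) by (auto simp: min_def max_def split: if_splits)
  moreover have "\<not> (leading j l \<and> leading l j)" by (cases "l < j") (auto simp: leading_def lead_def)
  ultimately show ?thesis using assms by blast
qed

text \<open>Indices are treated in increasing order: the only leading position with larger index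
  \<open>k\<close> joins \<open>k\<close> to a smaller index, whose choice is already made.\<close>

lemma signs_exist: "\<exists>e :: nat \<Rightarrow> bool. \<forall>j<n. \<forall>l<n. leading j l \<longrightarrow> (e j = e l) = (tr j l = Pls)"
proof (induction n)
  case (Suc n)
  from Suc.IH obtain e :: "nat \<Rightarrow> bool" where "\<forall>j<n. \<forall>l<n. leading j l \<longrightarrow> (e j = e l) = (tr j l = Pls)" ..
  then have e: "j < n \<Longrightarrow> l < n \<Longrightarrow> leading j l \<Longrightarrow> (e j = e l) = (tr j l = Pls)" for j l by (elim allE impE)
  show ?case
  proof (cases "\<exists>j l. leading j l \<and> max j l = n")
    case False
    then have "leading j l \<Longrightarrow> j < Suc n \<Longrightarrow> l < Suc n \<Longrightarrow> j < n \<and> l < n" for j l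
      by (metis less_Suc_eq max.absorb3 max.absorb4 max.idem)
    then show ?thesis using e by blast
  next
    case True
    then obtain j0 l0 where l0: "leading j0 l0" "max j0 l0 = n" by blast
    define i where "i = min j0 l0"
    have i: "i < n" using l0 by (auto simp: leading_def i_def min_def max_def split: if_splits)
    \<comment> \<open>With this value \<open>n\<close> and \<open>i\<close> are treated alike
      exactly if the entry at the leading position is already positive.\<close>
    define e' where "e' = e(n := (e i = (tr j0 l0 = Pls)))"
    have "(e' j = e' l) = (tr j l = Pls)" if jl: "j < Suc n" "l < Suc n" "leading j l" for j l
    proof (cases "max j l = n")
      case True
      then have "j = j0 \<and> l = l0" using leading_unique[OF jl(3) l0(1)] l0(2) by simp
      moreover have "(j0 = n \<and> l0 = i) \<or> (j0 = i \<and> l0 = n)"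
        using l0(2) by (auto simp: i_def min_def max_def split: if_splits)
      ultimately show ?thesis using i by (auto simp: e'_def)
    next
      case False
      then have "j < n" "l < n" using jl(1,2) by auto
      then show ?thesis using e jl(3) by (simp add: e'_def)
    qed
    then show ?thesis by blast
  qed
qed simp

end

text \<open>Exchanging points inside pairs multiplies each entry of \<open>T\<close> by the signs of
  its row and its column. \<open>B\<close>, \<open>C\<close> and \<open>S\<close> do not change, so
  the matrix still fits the representative.\<close>

lemma normal_form:
  assumes "rep_dsrg A r"
  shows "\<exists>e. rep_dsrg (\<lambda>x y. A (relabel id id e x) (relabel id id e y)) r \<and>
    swap_dsrg.normal (\<lambda>x y. A (relabel id id e x) (relabel id id e y))"
proof -
  interpret rep_dsrg A r by fact
  obtain e :: "nat \<Rightarrow> bool" where "\<forall>j<8. \<forall>l<8. leading j l \<longrightarrow> (e j = e l) = (tr j l = Pls)"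
    using signs_exist[of 8] ..
  then have e: "j < 8 \<Longrightarrow> l < 8 \<Longrightarrow> leading j l \<Longrightarrow> (e j = e l) = (tr j l = Pls)" for j l by (elim allE impE)
  define A' where "A' x y = A (relabel id id e x) (relabel id id e y)" for x y
  have sd: "swap_dsrg A'"
    unfolding A'_def[abs_def] by (rule swap_dsrg_relabel[OF swap_dsrg_axioms bij_betw_id bij_betw_id])
  interpret A': swap_dsrg A' by fact
  have cross: "A' i (6 + 2 * j) = A i (6 + 2 * j)" "A' (6 + 2 * j) i = A (6 + 2 * j) i" if "i < 6" "j < 8" for i j
    using a_bool[of i "6 + 2 * j"] a_bool[of "6 + 2 * j" i] that by (auto simp: A'_def relabel_values swap_values)
  have rep: "rep_dsrg A' r"
  proof
    show "length r = 8" by (rule length_r)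
    fix j :: nat assume j: "j < 8"
    show "b_cols r ! j = map (\<lambda>i. A' i (6 + 2 * j)) [0..<6]" unfolding b_cols_r[OF j] by (rule map_cong) (use cross j in auto)
    show "c_rows r ! j = map (\<lambda>i. A' (6 + 2 * j) i) [0..<6]" unfolding c_rows_r[OF j] by (rule map_cong) (use cross j in auto)
  qed
  have block: "A' (6 + 2 * j) (6 + 2 * l) = (if e j = e l then A (6 + 2 * j) (6 + 2 * l) else A (6 + 2 * j) (7 + 2 * l))"
    "A' (6 + 2 * j) (7 + 2 * l) = (if e j = e l then A (6 + 2 * j) (7 + 2 * l) else A (6 + 2 * j) (6 + 2 * l))"
    if "j < 8" "l < 8" for j l
    using a_bool[of "6 + 2 * j" "6 + 2 * l"] a_bool[of "6 + 2 * j" "7 + 2 * l"] that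
    by (auto simp: A'_def relabel_values swap_values)
  have sn: "A'.sn j l = sn j l" if "j < 8" "l < 8" for j l
    using block[OF that] by (auto simp: A'.sn_def sn_def)
  have lead: "A'.lead j l = lead j l" if "j < 8" "l < 8" for j l
    using that sn by (auto simp: A'.lead_def lead_def)
  have "A'.tr j l = Pls" if jl: "j < 8" "l < 8" "j \<noteq> l" "A'.sn j l = 1" "A'.lead j l" for j l
  proof -
    have "leading j l" using jl sn lead by (simp add: leading_def)
    then have "(e j = e l) = (tr j l = Pls)" using e jl by blast
    moreover have "sn j l = 1" using jl sn by simp
    ultimately show ?thesis using block[OF jl(1,2)] by (auto simp: A'.tr_def tr_def sn_def split: if_splits)
  qed
  then have "A'.normal" by (simp add: A'.normal_def)
  with rep show ?thesis unfolding A'_def[abs_def] by blast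
qed

section \<open>From the representatives to the listed graphs\<close>

lemma length_reps: "length bc_reps = 112" "length rep_data = 112"
  by (simp_all add: bc_reps_def bc_rep_codes_def rep_data_def)

lemma reps_ok_extend:
  assumes "reps_ok m n" "l = m + n" "l \<le> 112" "\<forall>k<m. rep_ok fixed_parts (bc_reps ! k) (rep_data ! k)"
  shows "\<forall>k<l. rep_ok fixed_parts (bc_reps ! k) (rep_data ! k)"
proof (intro allI impI)
  fix k assume k: "k < l"
  show "rep_ok fixed_parts (bc_reps ! k) (rep_data ! k)"
  proof (cases "k < m")
    case False
    have "rep_ok fixed_parts (take n (drop m bc_reps) ! (k - m)) (take n (drop m rep_data) ! (k - m))"
      by (rule list_all2_nthD[OF assms(1)[unfolded reps_ok_def]]) (use assms(2,3) k False in \<open>simp add: length_reps\<close>)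
    then show ?thesis using assms(2,3) k False by (simp add: length_reps del: rep_ok.simps)
  qed (use assms(4) in blast)
qed

lemma reps_ok_all: "\<forall>k<112. rep_ok fixed_parts (bc_reps ! k) (rep_data ! k)"
  by (rule reps_ok_extend[OF reps_ok_110], simp, simp, rule reps_ok_extend[OF reps_ok_108], simp, simp,
    rule reps_ok_extend[OF reps_ok_106], simp, simp, rule reps_ok_extend[OF reps_ok_104], simp, simp,
    rule reps_ok_extend[OF reps_ok_101], simp, simp, rule reps_ok_extend[OF reps_ok_99], simp, simp,
    rule reps_ok_extend[OF reps_ok_88], simp, simp, rule reps_ok_extend[OF reps_ok_84], simp, simp,
    rule reps_ok_extend[OF reps_ok_76], simp, simp, rule reps_ok_extend[OF reps_ok_70], simp, simp,
    rule reps_ok_extend[OF reps_ok_61], simp, simp, rule reps_ok_extend[OF reps_ok_46], simp, simp,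
    rule reps_ok_extend[OF reps_ok_37], simp, simp, rule reps_ok_extend[OF reps_ok_28], simp, simp,
    rule reps_ok_extend[OF reps_ok_15], simp, simp, rule reps_ok_extend[OF reps_ok_4], simp, simp,
    rule reps_ok_extend[OF reps_ok_0], simp, simp, simp)

lemma isomorphic_to_listed:
  assumes "swap_dsrg A"
  shows "\<exists>k<82. \<exists>p. bij_betw p {..<22} {..<22} \<and> (\<forall>x<22. \<forall>y<22. mat_fun (graph_mat k) x y = A (p x) (p y))"
proof -
  interpret swap_dsrg A by fact
  have card_int: "card {j. j < 8 \<and> P j} = n \<longleftrightarrow> (\<Sum>j<8. of_bool (P j)) = int n" for P :: "nat \<Rightarrow> bool" and n
    using int_card_less[of 8 P] by linarith
  have "\<exists>k<112. \<exists>p q. bij_betw p {..<6} {..<6} \<and> bij_betw q {..<8} {..<8} \<and> length (bc_reps ! k) = 8 \<and>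
    (\<forall>j<8. b_cols (bc_reps ! k) ! j = map (\<lambda>i. A (p i) (6 + 2 * q j)) [0..<6] \<and>
      c_rows (bc_reps ! k) ! j = map (\<lambda>i. A (6 + 2 * q j) (p i)) [0..<6])"
  proof (rule bc_classification)
    fix i :: nat assume i: "i < 6"
    show "card {j. j < 8 \<and> A i (6 + 2 * j)} = 3" "card {j. j < 8 \<and> A (6 + 2 * j) i} = 3"
      unfolding card_int using B_row_sum[OF i] C_col_sum[OF i] by (simp_all add: block_bool)
    fix k :: nat assume k: "k < 6"
    show "card {j. j < 8 \<and> A i (6 + 2 * j) \<and> A (6 + 2 * j) k} = (if i = k then 2 else 1)"
      unfolding card_int using BC[OF i k] by (simp add: block_bool of_bool_conj)
  qed
  then obtain k p q where k: "k < 112" and p: "bij_betw p {..<6} {..<6}" and q: "bij_betw q {..<8} {..<8}"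
    and len: "length (bc_reps ! k) = 8"
    and rep: "\<And>j. j < 8 \<Longrightarrow> b_cols (bc_reps ! k) ! j = map (\<lambda>i. A (p i) (6 + 2 * q j)) [0..<6] \<and>
      c_rows (bc_reps ! k) ! j = map (\<lambda>i. A (6 + 2 * q j) (p i)) [0..<6]"
    by blast
  \<comment> \<open>The order inside the pairs is kept here, as it affects neither \<open>B\<close>
    nor \<open>C\<close>; \<open>normal_form\<close> then adjusts it to fix the signs in
    \<open>T\<close>.\<close>
  let ?f = "relabel p q (\<lambda>_. False)"
  have "rep_dsrg (\<lambda>x y. A (?f x) (?f y)) (bc_reps ! k)"
  proof (intro rep_dsrg.intro rep_dsrg_axioms.intro swap_dsrg_relabel[OF assms p q])
    show "length (bc_reps ! k) = 8" by (rule len)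
    fix j :: nat assume j: "j < 8"
    show "b_cols (bc_reps ! k) ! j = map (\<lambda>i. A (?f i) (?f (6 + 2 * j))) [0..<6]"
      "c_rows (bc_reps ! k) ! j = map (\<lambda>i. A (?f (6 + 2 * j)) (?f i)) [0..<6]"
      using rep[OF j] by (simp_all add: relabel_values)
  qed
  from normal_form[OF this] obtain e where
    e: "rep_dsrg (\<lambda>x y. A (?f (relabel id id e x)) (?f (relabel id id e y))) (bc_reps ! k)"
      "swap_dsrg.normal (\<lambda>x y. A (?f (relabel id id e x)) (?f (relabel id id e y)))" by blast
  from rep_dsrg.isomorphic_to_graph[OF e(1) reps_ok_all[rule_format, OF k] e(2)] obtain k' s where
    s: "k' < 82" "bij_betw s {..<22} {..<22}"
      "\<forall>x<22. \<forall>y<22. mat_fun (graph_mat k') x y = A (?f (relabel id id e (s x))) (?f (relabel id id e (s y)))" by blast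
  have "bij_betw (\<lambda>x. ?f (relabel id id e (s x))) {..<22} {..<22}"
    using bij_betw_trans[OF bij_betw_trans[OF s(2) relabel_bij[OF bij_betw_id bij_betw_id]] relabel_bij[OF p q]]
    by (simp only: o_def)
  with s show ?thesis by blast
qed

subsection \<open>The listed graphs\<close>

lemma length_graph_codes: "length graph_codes = 82" "length graph_data = 82"
  by (simp_all add: graph_codes_def graph_data_def)

lemma graphs_ok_extend:
  assumes "graphs_ok m n" "l = m + n" "\<forall>k<m. graph_ok (graph_mat k) (aut_type k) (graph_data ! k)"
  shows "\<forall>k<l. graph_ok (graph_mat k) (aut_type k) (graph_data ! k)"
proof (intro allI impI)
  fix k assume k: "k < l"
  show "graph_ok (graph_mat k) (aut_type k) (graph_data ! k)"
  proof (cases "k < m")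
    case False
    then show ?thesis using assms(1,2) k by (simp add: graphs_ok_def list_all_iff del: graph_ok.simps)
  qed (use assms(3) in blast)
qed

lemma graph_ok_all: "\<forall>k<82. graph_ok (graph_mat k) (aut_type k) (graph_data ! k)"
  by (rule graphs_ok_extend[OF graphs_ok_74], simp, rule graphs_ok_extend[OF graphs_ok_66], simp,
    rule graphs_ok_extend[OF graphs_ok_57], simp, rule graphs_ok_extend[OF graphs_ok_49], simp,
    rule graphs_ok_extend[OF graphs_ok_41], simp, rule graphs_ok_extend[OF graphs_ok_33], simp,
    rule graphs_ok_extend[OF graphs_ok_25], simp, rule graphs_ok_extend[OF graphs_ok_16], simp,
    rule graphs_ok_extend[OF graphs_ok_8], simp, rule graphs_ok_extend[OF graphs_ok_0], simp, simp)

lemma path_rows_okD: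
  "path_rows_ok i rs cols \<Longrightarrow> x < length rs \<Longrightarrow>
   \<not> rs ! x ! (i + x) \<and> meet (rs ! x) (rs ! x) = 9 \<and> meets (rs ! x) cols = path_counts (rs ! x) (i + x)"
proof (induction i rs cols arbitrary: x rule: path_rows_ok.induct)
  case (2 i r rs cols)
  show ?case
  proof (cases x)
    case 0
    then show ?thesis using 2 by simp
  next
    case (Suc z)
    then show ?thesis using "2.IH"[of z] "2.prems" by simp
  qed
qed simp

lemma col_sums_okD: "col_sums_ok cs \<Longrightarrow> c \<in> set cs \<Longrightarrow> meet c c = 9"
  by (induction cs) auto

lemma swap_perm: "x < 22 \<Longrightarrow> swap_perm ! x = swap x" "length swap_perm = 22"
proof -
  have "list_all (\<lambda>x. swap_perm ! x = swap x) [0..<22]" by (simp add: swap_perm_def swap_def upt_rec)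
  then show "x < 22 \<Longrightarrow> swap_perm ! x = swap x" by (simp add: list_all_iff)
qed (simp add: swap_perm_def)

lemma swap_less: "x < 22 \<Longrightarrow> swap x < 22"
  by (auto simp: swap_def)

lemma mat_ok_square: "mat_ok M \<Longrightarrow> square22 M"
  by (simp add: mat_ok_def square22_def list_all_iff)

lemma mat_ok_dsrg:
  assumes "mat_ok M"
  shows "swap_dsrg (mat_fun M)"
proof
  note M = mat_ok_square[OF assms]
  note len = length_M[OF M] length_row[OF M] length_cols_of[OF M] length_col[OF M]
  have ok: "path_rows_ok 0 M (cols_of M)" "col_sums_ok (cols_of M)" "select_rows swap_perm (select swap_perm M) = M"
    using assms by (auto simp: mat_ok_def)
  have "\<not> mat_fun M x x \<and> card {y. y < 22 \<and> mat_fun M x y} = 9 \<and> card {y. y < 22 \<and> mat_fun M y x} = 9 \<and>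
     (\<forall>y<22. card {z. z < 22 \<and> mat_fun M x z \<and> mat_fun M z y} = (if x = y then 6 else if mat_fun M x y then 3 else 4))"
    if x: "x < 22" for x
  proof (intro conjI allI impI)
    have row: "\<not> M ! x ! x" "meet (M ! x) (M ! x) = 9" "meets (M ! x) (cols_of M) = path_counts (M ! x) x"
      using path_rows_okD[OF ok(1), of x] x len by simp_all
    show "\<not> mat_fun M x x" using row by (simp add: mat_fun_def)
    show "card {y. y < 22 \<and> mat_fun M x y} = 9"
      using row(2) meet_eq_card[OF len(2)[OF x] len(2)[OF x]] by (simp add: mat_fun_def)
    have "meet (cols_of M ! x) (cols_of M ! x) = 9" using col_sums_okD[OF ok(2)] x len(3) by simp
    then show "card {y. y < 22 \<and> mat_fun M y x} = 9"
      using meet_eq_card[OF len(4)[OF x] len(4)[OF x]] x by (simp add: mat_fun_def nth_col[OF M] cong: conj_cong)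
    fix y :: nat assume y: "y < 22"
    have "card {z. z < 22 \<and> mat_fun M x z \<and> mat_fun M z y} = meet (cols_of M ! y) (M ! x)"
      using meet_eq_card[OF len(4)[OF y] len(2)[OF x]] y by (simp add: mat_fun_def nth_col[OF M] conj_commute cong: conj_cong)
    also have "\<dots> = path_counts (M ! x) x ! y" using row(3) y len(3) by (simp add: meets_eq flip: row(3))
    also have "\<dots> = (if x = y then 6 else if mat_fun M x y then 3 else 4)"
      using x y len(2)[OF x] by (auto simp: path_counts_def mat_fun_def nth_list_update)
    finally show "card {z. z < 22 \<and> mat_fun M x z \<and> mat_fun M z y} = (if x = y then 6 else if mat_fun M x y then 3 else 4)" .
  qed
  then show "dsrg_mat (mat_fun M)" by (simp add: dsrg_mat_def)
  have "M ! swap x ! swap y = M ! x ! y" if "x < 22" "y < 22" for x y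
    using that swap_perm by (subst (2) ok(3)[symmetric]) simp
  then show "swap_invariant (mat_fun M)" by (simp add: swap_invariant_def mat_fun_def)
qed

definition listed :: "nat \<Rightarrow> nat \<Rightarrow> nat \<Rightarrow> bool" where
  "listed k = mat_fun (graph_mat k)"

lemma graph_ok_parts:
  assumes "k < 82"
  shows "mat_ok (graph_mat k)" "colour_key (colouring (graph_mat k)) = fst (graph_data ! k)"
    "\<exists>a b. aut_ok (graph_mat k) (aut_type k) a b"
proof -
  obtain key a b where d: "graph_data ! k = (key, a, b)" by (metis prod_cases3)
  have ok: "graph_ok (graph_mat k) (aut_type k) (key, a, b)" using graph_ok_all[rule_format, OF assms] by (simp only: d)
  then show "mat_ok (graph_mat k)" "colour_key (colouring (graph_mat k)) = fst (graph_data ! k)"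
    "\<exists>a b. aut_ok (graph_mat k) (aut_type k) a b"
    unfolding graph_ok.simps d fst_conv by blast+
qed

lemma listed_dsrg: "k < 82 \<Longrightarrow> swap_dsrg (listed k)"
  unfolding listed_def by (rule mat_ok_dsrg[OF graph_ok_parts(1)])

lemma listed_invariant: "k < 82 \<Longrightarrow> invariant (listed k) = fst (graph_data ! k)"
  using graph_ok_parts(2) colour_key_invariant[OF mat_ok_square[OF graph_ok_parts(1)]] by (simp add: listed_def)

lemma listed_distinct:
  assumes "k < 82" "l < 82" "invariant (listed k) = invariant (listed l)"
  shows "k = l"
proof -
  have "map fst graph_data ! k = map fst graph_data ! l"
    using assms listed_invariant by (simp add: length_graph_codes)
  then show ?thesis using distinct_keys assms(1,2) by (simp add: nth_eq_iff_index_eq length_graph_codes del: nth_map)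
qed

lemma aut_type_pos: "aut_type k = (m, n) \<Longrightarrow> 0 < m \<and> 0 < n"
  by (auto simp: aut_type_def split: if_splits)

lemma listed_group:
  assumes "k < 82" "aut_type k = (m, n)"
  shows "integer_mod_group m \<times>\<times> integer_mod_group n \<cong> digraph_AutoGroup (mat_graph (listed k))"
  using graph_ok_parts(3)[OF assms(1)] aut_ok_iso[OF mat_ok_square[OF graph_ok_parts(1)[OF assms(1)]]] aut_type_pos[OF assms(2)]
  unfolding listed_def assms(2) by blast

subsection \<open>Counting isomorphism classes\<close>

lemma labels_change:
  assumes f: "labels f A G" and p: "bij_betw p {..<22} {..<22}" and A': "\<forall>x<22. \<forall>y<22. A' x y = A (p x) (p y)"
  shows "labels (f \<circ> p) A' G"
  using labels_comp[OF f p] A' by (simp add: labels_def)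

text \<open>Two numberings of one graph differ by a permutation that carries one matrix into the
  other.\<close>

lemma labels_invariant:
  assumes f: "labels f A G" and g: "labels g A' G"
  shows "invariant A = invariant A'"
proof -
  define p where "p = inv_into {..<22} g \<circ> f"
  have p: "bij_betw p {..<22} {..<22}"
    unfolding p_def using labels_bij[OF f] bij_betw_inv_into[OF labels_bij[OF g]] by (rule bij_betw_trans)
  have gp: "g (p x) = f x" if "x < 22" for x
    unfolding p_def using bij_betw_inv_into_right[OF labels_bij[OF g] labels_in[OF f that]] by simp
  have p22: "p x < 22" if "x < 22" for x using p that bij_betwE by fastforce
  have "A' (p x) (p y) = A x y" if "x < 22" "y < 22" for x y
    using labels_arc[OF f that] labels_arc[OF g p22[OF that(1)] p22[OF that(2)]] gp that by simp
  from invariant_permuted[where A' = A' and A = A, OF p this] show ?thesis by simp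
qed

lemma labels_same_iso:
  assumes f: "labels f A G" and g: "labels g A H" and G: "pair_wf_digraph G" and H: "pair_wf_digraph H"
  shows "digraph_iso (with_proj G) (with_proj H)"
proof -
  define h where "h = g \<circ> inv_into {..<22} f"
  have b: "bij_betw h (pverts G) (pverts H)"
    unfolding h_def using bij_betw_inv_into[OF labels_bij[OF f]] labels_bij[OF g] by (rule bij_betw_trans)
  have hf: "h (f x) = g x" if "x < 22" for x
    using bij_betw_inv_into_left[OF labels_bij[OF f], of x] that by (simp add: h_def)
  have "map_prod h h ` parcs G = parcs H"
  proof (intro equalityI subsetI)
    fix e assume "e \<in> map_prod h h ` parcs G"
    then obtain u v where uv: "(u, v) \<in> parcs G" "e = (h u, h v)" by auto
    obtain x where x: "x < 22" "u = f x" using labels_obtain[OF f] pair_wf_digraph.in_arcsD1[OF G uv(1)] by blast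
    obtain y where y: "y < 22" "v = f y" using labels_obtain[OF f] pair_wf_digraph.in_arcsD2[OF G uv(1)] by blast
    show "e \<in> parcs H" using labels_arc[OF f x(1) y(1)] labels_arc[OF g x(1) y(1)] uv x y hf by simp
  next
    fix e assume e: "e \<in> parcs H"
    obtain u v where uv: "e = (u, v)" by (cases e)
    obtain x where x: "x < 22" "u = g x" using labels_obtain[OF g] pair_wf_digraph.in_arcsD1[OF H] e uv by blast
    obtain y where y: "y < 22" "v = g y" using labels_obtain[OF g] pair_wf_digraph.in_arcsD2[OF H] e uv by blast
    have "(f x, f y) \<in> parcs G" using labels_arc[OF f x(1) y(1)] labels_arc[OF g x(1) y(1)] e uv x y by simp
    moreover have "e = map_prod h h (f x, f y)" using uv x y hf by simp
    ultimately show "e \<in> map_prod h h ` parcs G" by (rule rev_image_eqI)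
  qed
  then show ?thesis using b digraph_iso_with_proj_iff[OF G] by blast
qed

lemma labels_transfer:
  assumes f: "labels f A G" and G: "pair_wf_digraph G" and iso: "digraph_iso (with_proj G) (with_proj H)"
  shows "\<exists>g. labels g A H"
proof -
  obtain h where h: "bij_betw h (pverts G) (pverts H)" "map_prod h h ` parcs G = parcs H"
    using digraph_iso_with_proj_iff[OF G, THEN iffD1, OF iso] by blast
  have "(h (f x), h (f y)) \<in> parcs H \<longleftrightarrow> A x y" if x: "x < 22" and y: "y < 22" for x y
  proof
    assume "(h (f x), h (f y)) \<in> parcs H"
    then obtain u v where uv: "(u, v) \<in> parcs G" "h u = h (f x)" "h v = h (f y)" unfolding h(2)[symmetric] by auto
    have "u = f x" "v = f y"
      by (rule inj_onD[OF bij_betw_imp_inj_on[OF h(1)] uv(2) pair_wf_digraph.in_arcsD1[OF G uv(1)] labels_in[OF f x]],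
          rule inj_onD[OF bij_betw_imp_inj_on[OF h(1)] uv(3) pair_wf_digraph.in_arcsD2[OF G uv(1)] labels_in[OF f y]])
    then show "A x y" using uv(1) labels_arc[OF f x y] by simp
  next
    assume "A x y"
    then have "(f x, f y) \<in> parcs G" using labels_arc[OF f x y] by simp
    then show "(h (f x), h (f y)) \<in> parcs H" unfolding h(2)[symmetric] by force
  qed
  then have "labels (h \<circ> f) A H" using bij_betw_trans[OF labels_bij[OF f] h(1)] by (simp add: labels_def)
  then show ?thesis by blast
qed

text \<open>The automorphism is \<open>swap\<close> carried over by the numbering. Its square is the
  identity, and it moves vertex 6, the first one that is not fixed, so its order is exactly
  2.\<close>

lemma labels_involution:
  assumes f: "labels f A G" and inv: "swap_invariant A"
  shows "has_involution_fixing 6 G"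
proof -
  interpret group "digraph_AutoGroup G" by (rule group_digraph_AutoGroup)
  define f' where "f' = inv_into {..<22} f"
  have ff: "f' (f x) = x" if "x < 22" for x
    using bij_betw_inv_into_left[OF labels_bij[OF f], of x] that by (simp add: f'_def)
  define s where "s = (\<lambda>v\<in>pverts G. f (swap (f' v)))"
  have sf: "s (f x) = f (swap x)" if "x < 22" for x
    using labels_in[OF f that] ff[OF that] by (simp add: s_def)
  have ss: "swap (swap x) = x" for x by (auto simp: swap_def) presburger
  have "bij_betw swap {..<22} {..<22}"
    by (rule bij_betw_byWitness[where f' = swap]) (use ss swap_less in auto)
  then have "bij_betw (f \<circ> (swap \<circ> f')) (pverts G) (pverts G)"
    unfolding f'_def using labels_bij[OF f] bij_betw_inv_into[OF labels_bij[OF f]] by (blast intro: bij_betw_trans)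
  then have sb: "bij_betw s (pverts G) (pverts G)" by (rule bij_betw_cong[THEN iffD1, rotated]) (simp add: s_def)
  have "(u, v) \<in> parcs G \<longleftrightarrow> (s u, s v) \<in> parcs G" if uv: "u \<in> pverts G" "v \<in> pverts G" for u v
  proof -
    obtain x where x: "x < 22" "u = f x" using labels_obtain[OF f] uv by blast
    obtain y where y: "y < 22" "v = f y" using labels_obtain[OF f] uv by blast
    show ?thesis
      using labels_arc[OF f x(1) y(1)] labels_arc[OF f swap_less swap_less, OF x(1) y(1)] inv x y sf by (simp add: swap_invariant_def)
  qed
  then have "s \<in> digraph_auto G" using sb by (simp add: digraph_auto_def Bij_def s_def)
  then have sG: "s \<in> carrier (digraph_AutoGroup G)" by (simp add: digraph_AutoGroup_def)
  have one: "\<one>\<^bsub>digraph_AutoGroup G\<^esub> = (\<lambda>v\<in>pverts G. v)" by (simp add: digraph_AutoGroup_def BijGroup_def)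
  have "compose (pverts G) s s = (\<lambda>v\<in>pverts G. v)"
  proof (rule extensionalityI[of _ "pverts G"])
    fix v assume v: "v \<in> pverts G"
    obtain x where x: "x < 22" "v = f x" using labels_obtain[OF f] v by blast
    show "compose (pverts G) s s v = (\<lambda>v\<in>pverts G. v) v"
      using v x sf[OF x(1)] sf[OF swap_less[OF x(1)]] ss by (simp add: compose_eq)
  qed (auto simp: compose_def)
  then have "s [^]\<^bsub>digraph_AutoGroup G\<^esub> (2::nat) = \<one>\<^bsub>digraph_AutoGroup G\<^esub>"
    using \<open>s \<in> digraph_auto G\<close> sG unfolding one
    by (simp add: numeral_2_eq_2) (simp add: digraph_AutoGroup_def BijGroup_def digraph_auto_def)
  then have "ord s dvd 2" using pow_eq_id[OF sG] by simp
  moreover have "s \<noteq> \<one>\<^bsub>digraph_AutoGroup G\<^esub>"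
  proof
    assume "s = \<one>\<^bsub>digraph_AutoGroup G\<^esub>"
    then have "s (f 6) = f 6" using labels_in[OF f, of 6] by (simp add: one)
    then have "f 7 = f 6" using sf[of 6] by (simp add: swap_def)
    then show False using labels_bij[OF f] by (auto simp: bij_betw_def dest: inj_onD[of _ _ 7 6])
  qed
  then have "ord s \<noteq> 1" using ord_eq_1[OF sG] by simp
  moreover have "ord s \<le> 2" using \<open>ord s dvd 2\<close> by (rule dvd_imp_le) simp
  ultimately have "ord s = 2" by (cases "ord s = 0") auto
  moreover have "card {v \<in> pverts G. s v = v} = 6"
  proof -
    have "s (f x) = f x \<longleftrightarrow> x < 6" if "x < 22" for x
    proof -
      have "f (swap x) = f x \<longleftrightarrow> swap x = x"
        using labels_bij[OF f] that swap_less[OF that] by (auto simp: bij_betw_def dest: inj_onD)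
      then show ?thesis using sf[OF that] by (auto simp: swap_def split: if_splits)
    qed
    then have "{x. x < 22 \<and> s (f x) = f x} = {..<6}" by auto
    then show ?thesis by (simp add: labels_card[OF f])
  qed
  ultimately show ?thesis using sG unfolding has_involution_fixing_def by blast
qed

lemma classified:
  assumes "directed_strongly_regular_graph G 22 9 6 3 4" "has_involution_fixing 6 G"
  shows "\<exists>k<82. \<exists>f. labels f (listed k) G"
proof -
  obtain f A where f: "labels f A G" "swap_invariant A" using involution_labelling[OF assms] .
  then have "swap_dsrg A" using dsrg_mat_of_graph[OF assms(1) f(1)] by (simp add: swap_dsrg_def)
  from isomorphic_to_listed[OF this] obtain k p where
    "k < 82" "bij_betw p {..<22} {..<22}" "\<forall>x<22. \<forall>y<22. listed k x y = A (p x) (p y)" by (auto simp: listed_def)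
  then show ?thesis using labels_change[OF f(1)] by blast
qed

text \<open>This is where the size of the vertex type enters: a set of 22 elements carries a copy of
  each listed matrix, so none of the counted classes is empty.\<close>

lemma listed_realised:
  fixes V :: "'a set"
  assumes "card V = 22" "k < 82"
  shows "\<exists>(G :: 'a pair_pre_digraph) f. labels f (listed k) G \<and> directed_strongly_regular_graph G 22 9 6 3 4 \<and> has_involution_fixing 6 G"
proof -
  have "finite V" using assms(1) card.infinite by fastforce
  then obtain f where f: "bij_betw f {..<22::nat} V"
    using ex_bij_betw_nat_finite[of V] assms(1) by (auto simp: atLeast0LessThan)
  define G where "G = \<lparr>pverts = V, parcs = {(f x, f y) | x y. x < 22 \<and> y < 22 \<and> listed k x y}\<rparr>"
  have "(f x, f y) \<in> parcs G \<longleftrightarrow> listed k x y" if "x < 22" "y < 22" for x y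
    using that f by (auto simp: G_def bij_betw_def inj_on_def)
  then have l: "labels f (listed k) G" using f by (simp add: labels_def G_def)
  have "parcs G \<subseteq> pverts G \<times> pverts G" using f bij_betwE by (fastforce simp: G_def)
  moreover have d: "swap_dsrg (listed k)" by (rule listed_dsrg[OF assms(2)])
  ultimately show ?thesis
    using l graph_of_dsrg_mat[OF _ l] labels_involution[OF l] unfolding swap_dsrg_def by blast
qed

lemma labelled_group:
  assumes l: "labels f (listed k) G" and k: "k < 82" and t: "aut_type k = (m, n)"
  shows "digraph_AutoGroup G \<cong> integer_mod_group m \<times>\<times> integer_mod_group n"
proof -
  have "digraph_AutoGroup (mat_graph (listed k)) \<cong> digraph_AutoGroup G"
    by (rule digraph_AutoGroup_iso[of f]) (use l in \<open>auto simp: labels_def mat_graph_def\<close>)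
  with listed_group[OF k t] have "integer_mod_group m \<times>\<times> integer_mod_group n \<cong> digraph_AutoGroup G"
    by (rule iso_trans)
  then show ?thesis
    by (rule group.iso_sym[OF DirProd_group[OF group_integer_mod_group group_integer_mod_group]])
qed

text \<open>The list index determines the group, and as the four groups are pairwise non-isomorphic,
  the group determines the range of the index.\<close>

lemma labelled_group_iff:
  assumes l: "labels f (listed k) G" and k: "k < 82"
  shows "digraph_AutoGroup G \<cong> integer_mod_group 2 \<longleftrightarrow> k \<in> {..<64}"
    and "digraph_AutoGroup G \<cong> integer_mod_group 4 \<longleftrightarrow> k \<in> {64..<68}"
    and "digraph_AutoGroup G \<cong> integer_mod_group 2 \<times>\<times> integer_mod_group 2 \<longleftrightarrow> k \<in> {68..<78}"
    and "digraph_AutoGroup G \<cong> integer_mod_group 4 \<times>\<times> integer_mod_group 2 \<longleftrightarrow> k \<in> {78..<82}"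
proof -
  let ?A = "digraph_AutoGroup G"
  let ?C2 = "integer_mod_group 2" and ?C4 = "integer_mod_group 4"
  have cyc: "?A \<cong> integer_mod_group m" if "?A \<cong> integer_mod_group m \<times>\<times> integer_mod_group 1" for m
    using that trivial_factor_iso by (rule iso_trans)
  have 1: "?A \<cong> ?C2" if "k < 64" using labelled_group[OF l k] that cyc by (simp add: aut_type_def)
  have 2: "?A \<cong> ?C4" if "64 \<le> k" "k < 68" using labelled_group[OF l k] that cyc by (simp add: aut_type_def)
  have 3: "?A \<cong> ?C2 \<times>\<times> ?C2" if "68 \<le> k" "k < 78" using labelled_group[OF l k] that by (simp add: aut_type_def)
  have 4: "?A \<cong> ?C4 \<times>\<times> ?C2" if "78 \<le> k" using labelled_group[OF l k] that by (simp add: aut_type_def)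
  \<comment> \<open>Cyclic groups and products live on different types, hence three versions of the
    same transitivity.\<close>
  have t12: "X \<cong> Y" if "?A \<cong> X" "?A \<cong> Y" for X Y :: "int monoid"
    using group.iso_sym[OF group_digraph_AutoGroup that(1)] that(2) by (rule iso_trans)
  have t13: "X \<cong> Y" if "?A \<cong> X" "?A \<cong> Y" for X :: "int monoid" and Y :: "(int \<times> int) monoid"
    using group.iso_sym[OF group_digraph_AutoGroup that(1)] that(2) by (rule iso_trans)
  have t33: "X \<cong> Y" if "?A \<cong> X" "?A \<cong> Y" for X Y :: "(int \<times> int) monoid"
    using group.iso_sym[OF group_digraph_AutoGroup that(1)] that(2) by (rule iso_trans)
  note n = integer_mod_groups_not_iso integer_mod_group_4_not_iso
  have d: "\<not> (?A \<cong> ?C2 \<and> ?A \<cong> ?C4)" "\<not> (?A \<cong> ?C2 \<and> ?A \<cong> ?C2 \<times>\<times> ?C2)" "\<not> (?A \<cong> ?C2 \<and> ?A \<cong> ?C4 \<times>\<times> ?C2)"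
    "\<not> (?A \<cong> ?C4 \<and> ?A \<cong> ?C2 \<times>\<times> ?C2)" "\<not> (?A \<cong> ?C4 \<and> ?A \<cong> ?C4 \<times>\<times> ?C2)" "\<not> (?A \<cong> ?C2 \<times>\<times> ?C2 \<and> ?A \<cong> ?C4 \<times>\<times> ?C2)"
    using t12[of ?C2 ?C4] t13[of ?C2] t13[of ?C4] t33[of "?C2 \<times>\<times> ?C2" "?C4 \<times>\<times> ?C2"] n by blast+
  consider "k < 64" | "64 \<le> k" "k < 68" | "68 \<le> k" "k < 78" | "78 \<le> k" by linarith
  then show "?A \<cong> ?C2 \<longleftrightarrow> k \<in> {..<64}" "?A \<cong> ?C4 \<longleftrightarrow> k \<in> {64..<68}"
    "?A \<cong> ?C2 \<times>\<times> ?C2 \<longleftrightarrow> k \<in> {68..<78}" "?A \<cong> ?C4 \<times>\<times> ?C2 \<longleftrightarrow> k \<in> {78..<82}"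
    using 1 2 3 4 d k by (cases; simp; blast)+
qed

text \<open>The isomorphism classes are the sets \<open>cl k\<close> of graphs numbered by the
  listed matrix \<open>k\<close>: a common matrix gives an isomorphism, isomorphisms transport
  numberings, and the invariant keeps different indices apart. The set \<open>S\<close> is a union
  of such classes, with \<open>K\<close> as the set of their indices.\<close>

lemma card_iso_classes:
  fixes \<G> :: "'a pair_pre_digraph set"
  assumes large: "\<exists>V :: 'a set. card V = 22"
    and \<G>: "\<G> = {G. directed_strongly_regular_graph G 22 9 6 3 4 \<and> has_involution_fixing 6 G}"
    and K: "K \<subseteq> {..<82}"
    and S: "S \<subseteq> \<G>" "\<And>G f k. G \<in> \<G> \<Longrightarrow> k < 82 \<Longrightarrow> labels f (listed k) G \<Longrightarrow> G \<in> S \<longleftrightarrow> k \<in> K"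
  shows "card (iso_classes S) = card K"
proof -
  define cl where "cl k = {G \<in> \<G>. \<exists>f. labels f (listed k) G}" for k
  have wf: "pair_wf_digraph G" if "G \<in> \<G>" for G
    using that \<G> by (auto simp: directed_strongly_regular_graph_def pair_digraph_def pair_fin_digraph_def)
  have unique: "k = l" if "k < 82" "l < 82" "labels f (listed k) G" "labels g (listed l) G" for k l f g and G :: "'a pair_pre_digraph"
    using listed_distinct[OF that(1,2) labels_invariant[OF that(3,4)]] .
  have nonempty: "cl k \<noteq> {}" if "k < 82" for k
    using large listed_realised[OF _ that] unfolding cl_def \<G> by blast
  have cl_S: "cl k \<subseteq> S" if "k \<in> K" for k using that S(2) K by (auto simp: cl_def)
  let ?R = "{(G, H). G \<in> S \<and> H \<in> S \<and> digraph_iso (with_proj G) (with_proj H)}"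
  have image_cl: "?R `` {G} = cl k" if G: "G \<in> cl k" and k: "k \<in> K" for G k
  proof (intro equalityI subsetI)
    obtain f where f: "labels f (listed k) G" "G \<in> \<G>" using G by (auto simp: cl_def)
    fix H
    { assume "H \<in> ?R `` {G}"
      then have "H \<in> S" "digraph_iso (with_proj G) (with_proj H)" by auto
      then show "H \<in> cl k" using labels_transfer[OF f(1) wf[OF f(2)]] S(1) by (auto simp: cl_def) }
    { assume H: "H \<in> cl k"
      then obtain g where g: "labels g (listed k) H" "H \<in> \<G>" by (auto simp: cl_def)
      then show "H \<in> ?R `` {G}" using labels_same_iso[OF f(1) g(1) wf[OF f(2)] wf[OF g(2)]] cl_S[OF k] G H by auto }
  qed
  have "iso_classes S = cl ` K"
  proof (intro equalityI subsetI)
    fix X assume "X \<in> iso_classes S"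
    then obtain G where G: "G \<in> S" "X = ?R `` {G}" unfolding iso_classes_def by (rule quotientE)
    then obtain k f where k: "k < 82" "labels f (listed k) G" using classified S(1) \<G> by blast
    then have "k \<in> K" using S G(1) by blast
    moreover have "G \<in> cl k" using k G(1) S(1) by (auto simp: cl_def)
    ultimately show "X \<in> cl ` K" using image_cl G(2) by blast
  next
    fix X assume "X \<in> cl ` K"
    then obtain k where k: "k \<in> K" "X = cl k" by blast
    then obtain G where G: "G \<in> cl k" using nonempty K by blast
    then have "X = ?R `` {G}" using image_cl k by blast
    then show "X \<in> iso_classes S" unfolding iso_classes_def using G cl_S[OF k(1)] by (blast intro: quotientI)
  qed
  moreover have "inj_on cl K"
  proof (rule inj_onI)
    fix k l assume kl: "k \<in> K" "l \<in> K" "cl k = cl l"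
    have k82: "k < 82" "l < 82" using kl K by auto
    then obtain G where "G \<in> cl k" using nonempty by blast
    then obtain f where f: "labels f (listed k) G" by (auto simp: cl_def)
    have "G \<in> cl l" using \<open>G \<in> cl k\<close> kl(3) by simp
    then obtain g where "labels g (listed l) G" by (auto simp: cl_def)
    from unique[OF k82 f this] show "k = l" .
  qed
  ultimately show ?thesis by (simp add: card_image)
qed

theorem theorem4p9:
  fixes \<G> :: "'a pair_pre_digraph set"
  assumes large_enough: "\<exists>V :: 'a set. card V = 22"
  defines "\<G> \<equiv> {G. directed_strongly_regular_graph G 22 9 6 3 4 \<and> has_involution_fixing 6 G}"
  shows "card (iso_classes \<G>) = 82 \<and>
    card (iso_classes {G \<in> \<G>. digraph_AutoGroup G \<cong> integer_mod_group 2}) = 64 \<and>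
    card (iso_classes {G \<in> \<G>. digraph_AutoGroup G \<cong> integer_mod_group 4}) = 4 \<and>
    card (iso_classes {G \<in> \<G>. digraph_AutoGroup G \<cong>
      integer_mod_group 2 \<times>\<times> integer_mod_group 2}) = 10 \<and>
    card (iso_classes {G \<in> \<G>. digraph_AutoGroup G \<cong>
      integer_mod_group 4 \<times>\<times> integer_mod_group 2}) = 4"
proof -
  \<comment> \<open>The same count serves all five sets; the index set is all of
    \<open>{..<82}\<close> or the range that belongs to one group.\<close>
  note count = card_iso_classes[OF large_enough \<G>_def[THEN meta_eq_to_obj_eq]]
  have "card (iso_classes \<G>) = card {..<82::nat}" by (rule count) auto
  moreover have "card (iso_classes {G \<in> \<G>. digraph_AutoGroup G \<cong> integer_mod_group 2}) = card {..<64::nat}"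
    by (rule count) (auto simp: labelled_group_iff)
  moreover have "card (iso_classes {G \<in> \<G>. digraph_AutoGroup G \<cong> integer_mod_group 4}) = card {64..<68::nat}"
    by (rule count) (auto simp: labelled_group_iff)
  moreover have "card (iso_classes {G \<in> \<G>. digraph_AutoGroup G \<cong> integer_mod_group 2 \<times>\<times> integer_mod_group 2}) =
      card {68..<78::nat}"
    by (rule count) (auto simp: labelled_group_iff)
  moreover have "card (iso_classes {G \<in> \<G>. digraph_AutoGroup G \<cong> integer_mod_group 4 \<times>\<times> integer_mod_group 2}) =
      card {78..<82::nat}"
    by (rule count) (auto simp: labelled_group_iff)
  ultimately show ?thesis by simp
qed

end
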